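(* Let $T$ and $T'$ be trees with $\nu(T)\le 4$ and $\nu(T')\le 4$. Suppose that $\operatorname{Spec}(T)=\operatorname{Spec}(T')$ and that $\mathbf 1^{\mathsf T}A(T)^k\mathbf 1=\mathbf 1^{\mathsf T}A(T')^k\mathbf 1$ for every integer $k\ge 0$. Then $T\cong T'$.
   Context: All graphs are finite, simple and undirected. For a graph $G$, $A(G)$ is its adjacency matrix, $\operatorname{Spec}(G)$ is its adjacency spectrum (the multiset of eigenvalues of $A(G)$), $\nu(G)$ is its matching number (maximum size of a matching), and $\mathbf 1$ is the all-one vector of length $|V(G)|$. *)

theory Defs
  imports
    "Graph_Theory.Digraph_Isomorphism"
    "Jordan_Normal_Form.Char_Poly"
    "HOL-Library.Countable_Set"
begin

text \<open>
  A finite simple undirected graph is a \<open>pair_graph\<close>: a finite, loop-free pair digraph whose arc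
  relation is symmetric, so the undirected edge \<open>{u, v}\<close> is the pair of arcs \<open>(u, v)\<close>, \<open>(v, u)\<close>.

  The constant \<open>tree\<close> of \<open>Graph_Theory\<close> is not usable here, because on a symmetric digraph every
  edge traversed back and forth is a \<open>cycle\<close> of length 2. A cycle (arc walk returning to its start
  with no other repeated vertex) of length at least 3 is exactly a cycle of the undirected graph.
\<close>

definition undirected_tree :: "'a pair_pre_digraph \<Rightarrow> bool" where
  "undirected_tree G \<longleftrightarrow>
     pair_graph G \<and> Digraph_Component.connected (with_proj G) \<and>
     \<not> (\<exists>p. pre_digraph.cycle (with_proj G) p \<and> 3 \<le> length p)"

definition undirected_edges :: "'a pair_pre_digraph \<Rightarrow> 'a set set" where
  "undirected_edges G = {{u, v} | u v. (u, v) \<in> parcs G}"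

definition matching :: "'a pair_pre_digraph \<Rightarrow> 'a set set \<Rightarrow> bool" where
  "matching G M \<longleftrightarrow> M \<subseteq> undirected_edges G \<and> pairwise disjnt M"

definition matching_number :: "'a pair_pre_digraph \<Rightarrow> nat" where
  "matching_number G = Max (card ` {M. matching G M})"

text \<open>
  For a finite vertex set, \<open>from_nat_into (pverts G)\<close> is a bijection from \<open>{..<card (pverts G)}\<close>
  onto \<open>pverts G\<close>. Another vertex order conjugates the matrix by a permutation matrix, which
  changes neither the spectrum nor the sums \<open>1\<^sup>T A\<^sup>k 1\<close>.
\<close>

definition adjacency_matrix :: "'a pair_pre_digraph \<Rightarrow> real mat" where
  "adjacency_matrix G =
     mat (card (pverts G)) (card (pverts G))
       (\<lambda>(i, j). if (from_nat_into (pverts G) i, from_nat_into (pverts G) j) \<in> parcs G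
                 then 1 else 0)"

text \<open>
  Eigenvalues are counted with multiplicity as roots of the characteristic polynomial; the matrix
  is real symmetric, so all of them are real.
\<close>

definition adjacency_spectrum :: "'a pair_pre_digraph \<Rightarrow> real multiset" where
  "adjacency_spectrum G = proots (char_poly (adjacency_matrix G))"

definition all_ones :: "'a pair_pre_digraph \<Rightarrow> real vec" where
  "all_ones G = vec (card (pverts G)) (\<lambda>_. 1)"

text \<open>
  On loop-free pair digraphs with symmetric arcs, \<open>digraph_iso\<close> is isomorphism of undirected graphs.
\<close>

lemma digraph_iso_with_proj_iff:
  assumes "pair_graph G" and "pair_graph H"
  shows "digraph_iso (with_proj G) (with_proj H) \<longleftrightarrow>
    (\<exists>f. bij_betw f (pverts G) (pverts H) \<and>
         (\<forall>u\<in>pverts G. \<forall>v\<in>pverts G. (u, v) \<in> parcs G \<longleftrightarrow> (f u, f v) \<in> parcs H))"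
proof
  interpret G: pair_graph G by fact
  assume "digraph_iso (with_proj G) (with_proj H)"
  then obtain h where h: "pre_digraph.digraph_isomorphism (with_proj G) h"
    and H: "with_proj H = app_iso h (with_proj G)"
    unfolding digraph_iso_def by blast
  define f where "f = iso_verts h"
  from arg_cong[OF H, of verts] have vH: "pverts H = f ` pverts G" by (simp add: f_def)
  from arg_cong[OF H, of arcs] have aH: "parcs H = iso_arcs h ` parcs G" by simp
  have th: "iso_tail h = fst" "iso_head h = snd"
    using arg_cong[OF H, of tail] arg_cong[OF H, of head] by simp_all
  have inj: "inj_on f (pverts G)"
    using h by (simp add: pre_digraph.digraph_isomorphism_def f_def)
  have arc: "iso_arcs h e = (f (fst e), f (snd e))" if "e \<in> parcs G" for e
    using h that th by (auto simp: pre_digraph.digraph_isomorphism_def f_def intro!: prod_eqI)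
  have aH': "parcs H = (\<lambda>e. (f (fst e), f (snd e))) ` parcs G"
    unfolding aH using arc by (rule image_cong[OF refl])
  have "(u, v) \<in> parcs G \<longleftrightarrow> (f u, f v) \<in> parcs H" if "u \<in> pverts G" "v \<in> pverts G" for u v
  proof
    assume "(u, v) \<in> parcs G"
    then show "(f u, f v) \<in> parcs H" unfolding aH' by force
  next
    assume "(f u, f v) \<in> parcs H"
    then obtain e where e: "e \<in> parcs G" "f u = f (fst e)" "f v = f (snd e)"
      unfolding aH' by auto
    have "u = fst e" "v = snd e"
      using inj_onD[OF inj e(2)] inj_onD[OF inj e(3)] that e(1)
        G.arc_fst_in_verts G.arc_snd_in_verts by auto
    with e(1) show "(u, v) \<in> parcs G" by simp
  qed
  with inj vH show "\<exists>f. bij_betw f (pverts G) (pverts H) \<and>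
         (\<forall>u\<in>pverts G. \<forall>v\<in>pverts G. (u, v) \<in> parcs G \<longleftrightarrow> (f u, f v) \<in> parcs H)"
    unfolding bij_betw_def by blast
next
  interpret G: pair_graph G by fact
  interpret H: pair_graph H by fact
  assume "\<exists>f. bij_betw f (pverts G) (pverts H) \<and>
         (\<forall>u\<in>pverts G. \<forall>v\<in>pverts G. (u, v) \<in> parcs G \<longleftrightarrow> (f u, f v) \<in> parcs H)"
  then obtain f where f: "inj_on f (pverts G)" "f ` pverts G = pverts H"
    and a: "\<And>u v. u \<in> pverts G \<Longrightarrow> v \<in> pverts G \<Longrightarrow> (u, v) \<in> parcs G \<longleftrightarrow> (f u, f v) \<in> parcs H"
    unfolding bij_betw_def by blast
  define h where "h = \<lparr>iso_verts = f, iso_arcs = (\<lambda>e. (f (fst e), f (snd e))),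
    iso_head = snd, iso_tail = fst\<rparr>"
  have "inj_on (\<lambda>e. (f (fst e), f (snd e))) (parcs G)"
  proof (rule inj_onI)
    fix d e assume d: "d \<in> parcs G" and e: "e \<in> parcs G"
      and eq: "(f (fst d), f (snd d)) = (f (fst e), f (snd e))"
    have "fst d = fst e" "snd d = snd e"
      using inj_onD[OF f(1), of "fst d" "fst e"] inj_onD[OF f(1), of "snd d" "snd e"] eq
        G.arc_fst_in_verts[OF d] G.arc_fst_in_verts[OF e]
        G.arc_snd_in_verts[OF d] G.arc_snd_in_verts[OF e] by simp_all
    then show "d = e" by (rule prod_eqI)
  qed
  then have 1: "pre_digraph.digraph_isomorphism (with_proj G) h"
    using f(1) G.wf_digraph_axioms by (simp add: pre_digraph.digraph_isomorphism_def h_def)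
  have "parcs H = (\<lambda>e. (f (fst e), f (snd e))) ` parcs G"
  proof (intro equalityI subsetI)
    fix x assume x: "x \<in> parcs H"
    from H.arc_fst_in_verts[OF x] f(2) obtain u where u: "u \<in> pverts G" "fst x = f u" by auto
    from H.arc_snd_in_verts[OF x] f(2) obtain v where v: "v \<in> pverts G" "snd x = f v" by auto
    have xuv: "x = (f u, f v)" using u(2) v(2) by (simp add: prod_eq_iff)
    then have "(u, v) \<in> parcs G" using a[OF u(1) v(1)] x by simp
    then show "x \<in> (\<lambda>e. (f (fst e), f (snd e))) ` parcs G"
      using xuv by (intro image_eqI[of _ _ "(u, v)"]) simp_all
  next
    fix x assume "x \<in> (\<lambda>e. (f (fst e), f (snd e))) ` parcs G"
    then obtain e where e: "e \<in> parcs G" "x = (f (fst e), f (snd e))" by blast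
    then show "x \<in> parcs H"
      using a[OF G.arc_fst_in_verts[OF e(1)] G.arc_snd_in_verts[OF e(1)]] by simp
  qed
  with f(2) have "with_proj H = app_iso h (with_proj G)"
    by (simp add: app_iso_def with_proj_def h_def)
  with 1 show "digraph_iso (with_proj G) (with_proj H)"
    unfolding digraph_iso_def by blast
qed

end

theory Submission
  imports Defs "HOL-Computational_Algebra.Fundamental_Theorem_Algebra"
begin

text \<open>
  Removing the parent of a deepest leaf together with its leaves lowers the matching number of a tree by one.
  Rebuilding the tree, one sees that with matching number at most four it is one of 20 shapes: a fixed small
  core whose cover vertices carry arbitrary numbers of leaves. The characteristic polynomial yields the numbers
  of matchings, and multiplying it with the generating function of the walk numbers yields further invariants;
  all of them are polynomials in the leaf counts. Linear combinations of these invariants, of constant sign on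
  whole families, tell the shapes apart, and within a shape suitable combinations determine the leaf counts
  up to the automorphisms of the core.
\<close>

section \<open>Spectra of real symmetric matrices\<close>

text \<open>Each removed star gives its centre to a vertex cover and one of its edges to a matching,
  so the cover has at most four vertices. All other vertices are independent. Up to a power of x,
  the characteristic polynomial is therefore the determinant of a Schur complement of size at most
  four, and there are at most four pairs of nonzero eigenvalues. The generating function of the walk
  numbers is a sum of terms c / (1 - theta t) over the eigenvalues theta. Clearing the nonzero ones
  leaves a numerator of degree at most eight; its coefficients have bounded degree in the leaf
  counts, whereas the degree of the walk numbers grows with the length. The obstacle is
  degeneration: a cover vertex without leaves can make two cores describe the same tree, or give a
  core further symmetries. The choice of admissible leaf counts removes the first ambiguity, and
  special cases in the recovery of the leaf counts deal with the second. One pair of shapes,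
  \<open>Td\<close> and \<open>Tc\<close>, is told apart by a nonlinear argument.\<close>

lemma symmetric_real_eigenvalue:
  fixes A :: "real mat"
  assumes A: "A \<in> carrier_mat n n" and sym: "\<And>i j. i < n \<Longrightarrow> j < n \<Longrightarrow> A $$ (i, j) = A $$ (j, i)"
    and root: "poly (map_poly complex_of_real (char_poly A)) z = 0"
  shows "Im z = 0"
proof -
  let ?B = "map_mat complex_of_real A"
  have B: "?B \<in> carrier_mat n n" using A by simp
  have "poly (char_poly ?B) z = 0"
    using root of_real_hom.char_poly_hom[OF A, where 'a = complex] by simp
  then have "eigenvalue ?B z" using eigenvalue_root_char_poly[OF B] by simp
  then obtain v where v: "v \<in> carrier_vec n" "v \<noteq> 0\<^sub>v n" and ev: "?B *\<^sub>v v = z \<cdot>\<^sub>v v"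
    using B unfolding eigenvalue_def eigenvector_def by auto
  have row: "(\<Sum>j<n. of_real (A $$ (i, j)) * v $ j) = z * v $ i" if "i < n" for i
  proof -
    have "(?B *\<^sub>v v) $ i = (\<Sum>j<n. of_real (A $$ (i, j)) * v $ j)"
      using A v(1) that by (auto simp: scalar_prod_def atLeast0LessThan intro!: sum.cong)
    then show ?thesis using ev v(1) that by simp
  qed
  define s where "s = (\<Sum>i<n. (cmod (v $ i))\<^sup>2)"
  \<comment> \<open>\<open>t\<close> is the Hermitian form of \<open>A\<close> at \<open>v\<close>:
    real because \<open>A\<close> is symmetric, and equal to \<open>z\<close> times the squared norm
    \<open>s\<close> of \<open>v\<close>.\<close>
  define t where "t = (\<Sum>i<n. \<Sum>j<n. cnj (v $ i) * (of_real (A $$ (i, j)) * v $ j))"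
  have t: "t = z * of_real s"
  proof -
    have "(\<Sum>j<n. cnj (v $ i) * (of_real (A $$ (i, j)) * v $ j)) = z * of_real ((cmod (v $ i))\<^sup>2)"
      if "i < n" for i
      unfolding sum_distrib_left[symmetric] row[OF that] complex_norm_square by (simp add: mult_ac)
    then show ?thesis unfolding t_def s_def by (simp add: sum_distrib_left)
  qed
  have "cnj t = (\<Sum>i<n. \<Sum>j<n. cnj (v $ j) * (of_real (A $$ (i, j)) * v $ i))"
    unfolding t_def by (simp add: mult_ac)
  also have "\<dots> = (\<Sum>j<n. \<Sum>i<n. cnj (v $ j) * (of_real (A $$ (i, j)) * v $ i))"
    by (rule sum.swap)
  also have "\<dots> = t"
    unfolding t_def by (intro sum.cong refl) (simp add: sym)
  finally have "Im t = 0" by (metis complex_cnj_cancel_iff Reals_cnj_iff complex_is_Real_iff)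
  moreover have "s \<noteq> 0"
  proof
    assume "s = 0"
    then have "\<forall>i<n. v $ i = 0" unfolding s_def by (simp add: sum_nonneg_eq_0_iff)
    then show False using v by auto
  qed
  ultimately show ?thesis using t by simp
qed

text \<open>A nonconstant polynomial has a complex root, which is real by hypothesis. Its linear
  factor splits off over the reals, and the quotient inherits the hypothesis.\<close>

lemma real_rooted_poly_decompose:
  fixes p :: "real poly"
  assumes "p \<noteq> 0" and "\<And>z. poly (map_poly complex_of_real p) z = 0 \<Longrightarrow> Im z = 0"
  shows "p = Polynomial.smult (lead_coeff p) (\<Prod>x\<in>#proots p. [:- x, 1:])"
  using assms
proof (induction "degree p" arbitrary: p)
  case 0
  then obtain c where c: "p = [:c:]" by (metis degree_eq_zeroE)
  with 0 have "proots p = {#}" by (simp add: proots_const)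
  then show ?case using c by simp
next
  case (Suc d)
  interpret h: map_poly_comm_ring_hom complex_of_real ..
  have "degree (map_poly complex_of_real p) = Suc d"
    using Suc(2) by (simp add: degree_map_poly)
  then obtain z where z: "poly (map_poly complex_of_real p) z = 0"
    using alg_closed_imp_poly_has_root[of "map_poly complex_of_real p"] by auto
  then have "z = of_real (Re z)" using Suc(4) by (simp add: complex_eq_iff)
  with z have "poly p (Re z) = 0"
    by (metis of_real_0 of_real_eq_iff of_real_hom.poly_map_poly)
  then obtain q where q: "p = [:- Re z, 1:] * q" by (metis dvdE poly_eq_0_iff_dvd)
  have q0: "q \<noteq> 0" using q Suc(3) by auto
  have dq: "d = degree q" using Suc(2) q0 unfolding q by (subst (asm) degree_mult_eq) auto
  have "Im w = 0" if "poly (map_poly complex_of_real q) w = 0" for w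
    using Suc(4)[of w] that unfolding q h.hom_mult by simp
  then have IH: "q = Polynomial.smult (lead_coeff q) (\<Prod>x\<in>#proots q. [:- x, 1:])"
    using Suc(1)[OF dq q0] by blast
  have "proots p = add_mset (Re z) (proots q)"
    unfolding q using q0 by (subst proots_mult) auto
  moreover have "lead_coeff p = lead_coeff q" unfolding q lead_coeff_mult by simp
  ultimately show ?case using IH q by (metis (no_types, lifting) image_mset_add_mset mult_smult_right
      prod_mset.add_mset)
qed

text \<open>\<open>proots\<close> collects the real roots only. They determine a monic polynomial
  once it splits over the reals, which symmetry of the matrix guarantees.\<close>

lemma char_poly_eq_of_proots_eq:
  fixes A B :: "real mat"
  assumes "A \<in> carrier_mat n n" "\<And>i j. i < n \<Longrightarrow> j < n \<Longrightarrow> A $$ (i, j) = A $$ (j, i)"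
    and "B \<in> carrier_mat m m" "\<And>i j. i < m \<Longrightarrow> j < m \<Longrightarrow> B $$ (i, j) = B $$ (j, i)"
    and "proots (char_poly A) = proots (char_poly B)"
  shows "char_poly A = char_poly B"
proof -
  have *: "char_poly C = (\<Prod>x\<in>#proots (char_poly C). [:- x, 1:])"
    if "C \<in> carrier_mat k k" "\<And>i j. i < k \<Longrightarrow> j < k \<Longrightarrow> C $$ (i, j) = C $$ (j, i)" for C :: "real mat" and k
  proof -
    have "monic (char_poly C)" using degree_monic_char_poly[OF that(1)] by simp
    then show ?thesis
      using real_rooted_poly_decompose[of "char_poly C"] symmetric_real_eigenvalue[OF that] by fastforce
  qed
  show ?thesis using *[OF assms(1,2)] *[OF assms(3,4)] assms(5) by simp
qed

section \<open>Determinants: change of the vertex order and Schur complements\<close>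

lemma poly_char_poly:
  fixes A :: "'a :: field mat"
  assumes A: "A \<in> carrier_mat n n"
  shows "poly (char_poly A) x = det (mat n n (\<lambda>(i, j). (if i = j then x else 0) - A $$ (i, j)))"
  unfolding char_poly_def
  by (rule poly_det_cong[of _ n]) (use A in \<open>auto simp: char_poly_matrix_def\<close>)

text \<open>The two matrices are conjugate by a permutation matrix. The permutation acts once on the
  rows and, after transposing, once on the columns, so its sign enters squared.\<close>

lemma det_reindex:
  fixes f :: "'a \<Rightarrow> 'a \<Rightarrow> 'b :: comm_ring_1"
  assumes g: "bij_betw g {..<n} V" and h: "bij_betw h {..<n} V"
  shows "det (mat n n (\<lambda>(i, j). f (g i) (g j))) = det (mat n n (\<lambda>(i, j). f (h i) (h j)))"
proof -
  define p where "p i = (if i < n then inv_into {..<n} h (g i) else i)" for i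
  have b: "bij_betw (inv_into {..<n} h \<circ> g) {..<n} {..<n}"
    using g h by (meson bij_betw_inv_into bij_betw_trans)
  have "bij_betw p {0..<n} {0..<n}"
    unfolding atLeast0LessThan using b by (rule bij_betw_cong[THEN iffD1, rotated]) (simp add: p_def)
  then have p: "p permutes {0..<n}"
    by (rule bij_imp_permutes) (simp add: p_def)
  have hp: "h (p i) = g i" if "i < n" for i
    using that h g by (simp add: p_def bij_betw_def f_inv_into_f bij_betw_apply)
  have pn: "p i < n" if "i < n" for i
    using permutes_in_image[OF p, of i] that by simp
  define M where "M = mat n n (\<lambda>(i, j). f (h i) (h j))"
  define M1 where "M1 = mat n n (\<lambda>(i, j). M $$ (p i, j))"
  have "det M1 = signof p * det M" unfolding M1_def
    by (rule det_permute_rows[OF _ p]) (simp add: M_def)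
  moreover have "det (mat n n (\<lambda>(i, j). transpose_mat M1 $$ (p i, j))) = signof p * det (transpose_mat M1)"
    by (rule det_permute_rows[OF _ p]) (simp add: M1_def)
  moreover have "mat n n (\<lambda>(i, j). transpose_mat M1 $$ (p i, j)) = transpose_mat (mat n n (\<lambda>(i, j). f (g i) (g j)))"
    by (rule eq_matI) (auto simp: M1_def M_def pn hp)
  moreover have "det (transpose_mat M1) = det M1" by (rule det_transpose[of _ n]) (simp add: M1_def)
  moreover have "det (transpose_mat (mat n n (\<lambda>(i, j). f (g i) (g j)))) = det (mat n n (\<lambda>(i, j). f (g i) (g j)))"
    by (rule det_transpose[of _ n]) simp
  moreover have "signof p * signof p = (1 :: 'b)" by (simp add: sign_def)
  ultimately show ?thesis by (metis M_def mult.assoc mult_1)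
qed

text \<open>A Schur complement without division: multiplying by \<open>?N\<close> on the right
  clears the lower left block. The factor \<open>x ^ c\<close> is the determinant of
  \<open>?N\<close>.\<close>

lemma det_four_block_scalar:
  fixes x :: "'a :: field"
  assumes A: "A \<in> carrier_mat c c" and B: "B \<in> carrier_mat c m" and x: "x \<noteq> 0"
    and C: "C \<in> carrier_mat m c"
  shows "x ^ c * det (four_block_mat A B C (x \<cdot>\<^sub>m 1\<^sub>m m)) = x ^ m * det (x \<cdot>\<^sub>m A - B * C)"
proof -
  let ?M = "four_block_mat A B C (x \<cdot>\<^sub>m 1\<^sub>m m)"
  let ?N = "four_block_mat (x \<cdot>\<^sub>m 1\<^sub>m c) (0\<^sub>m c m) (- C) (1\<^sub>m m)"
  have D: "x \<cdot>\<^sub>m 1\<^sub>m m \<in> carrier_mat m m" by simp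
  have M: "?M \<in> carrier_mat (c + m) (c + m)" using A by (intro four_block_carrier_mat) auto
  have N: "?N \<in> carrier_mat (c + m) (c + m)" by (intro four_block_carrier_mat) auto
  have e1: "A * (x \<cdot>\<^sub>m 1\<^sub>m c) + B * - C = x \<cdot>\<^sub>m A - B * C"
    using A B C by (auto simp: mult_smult_distrib minus_add_uminus_mat[of _ c c])
  have e2: "C * (x \<cdot>\<^sub>m 1\<^sub>m c) + (x \<cdot>\<^sub>m 1\<^sub>m m) * - C = 0\<^sub>m m c"
    using C by (intro eq_matI) (auto simp: mult_smult_distrib mult_smult_assoc_mat[of _ m m])
  have "?M * ?N = four_block_mat (A * (x \<cdot>\<^sub>m 1\<^sub>m c) + B * - C) (A * 0\<^sub>m c m + B * 1\<^sub>m m)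
      (C * (x \<cdot>\<^sub>m 1\<^sub>m c) + (x \<cdot>\<^sub>m 1\<^sub>m m) * - C) (C * 0\<^sub>m c m + (x \<cdot>\<^sub>m 1\<^sub>m m) * 1\<^sub>m m)"
    by (rule mult_four_block_mat[OF A B C D]) (use C in auto)
  also have "\<dots> = four_block_mat (x \<cdot>\<^sub>m A - B * C) B (0\<^sub>m m c) (x \<cdot>\<^sub>m 1\<^sub>m m)"
    unfolding e1 e2 using A B C by simp
  finally have MN: "?M * ?N = four_block_mat (x \<cdot>\<^sub>m A - B * C) B (0\<^sub>m m c) (x \<cdot>\<^sub>m 1\<^sub>m m)" .
  have "det ?M * det ?N = det (?M * ?N)" using det_mult[OF M N] ..
  also have "\<dots> = det (x \<cdot>\<^sub>m A - B * C) * det (x \<cdot>\<^sub>m 1\<^sub>m m)" unfolding MN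
    by (rule det_four_block_mat_lower_left_zero) (use A B C in auto)
  also have "det ?N = det (x \<cdot>\<^sub>m 1\<^sub>m c) * det (1\<^sub>m m)"
    by (rule det_four_block_mat_upper_right_zero) (use C in auto)
  finally show ?thesis by (simp add: det_smult mult_ac)
qed

section \<open>Rooted trees\<close>

text \<open>Bare vertex and arc sets make deleting a vertex a mere restriction. A cycle is a list of
  distinct vertices whose last one is joined to the first; length at least 3 excludes an edge
  traversed back and forth.\<close>

definition utree :: "'a set \<Rightarrow> 'a rel \<Rightarrow> bool" where
  "utree V E \<longleftrightarrow> finite V \<and> V \<noteq> {} \<and> E \<subseteq> V \<times> V \<and> sym E \<and> irrefl E \<and>
     (\<forall>u\<in>V. \<forall>v\<in>V. (u, v) \<in> E\<^sup>*) \<and>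
     \<not> (\<exists>p. distinct p \<and> 3 \<le> length p \<and> successively (\<lambda>x y. (x, y) \<in> E) p \<and> (last p, hd p) \<in> E)"

text \<open>Translates a closed vertex list into the arc walks that \<open>pre_digraph.cycle\<close>
  speaks of. The walk has as many arcs as the list \<open>x # q\<close> has vertices, which carries
  over the bound 3.\<close>

lemma closing_arcs:
  assumes "successively (\<lambda>x y. (x, y) \<in> E) (x # q)" and "(last (x # q), y) \<in> E"
  shows "\<exists>p. pcas x p y \<and> pawalk_verts x p = x # q @ [y] \<and> set p \<subseteq> E \<and> length p = Suc (length q)"
  using assms
proof (induction q arbitrary: x)
  case Nil
  then show ?case by (intro exI[of _ "[(x, y)]"]) auto
next
  case (Cons z q)
  then obtain p where "pcas z p y \<and> pawalk_verts z p = z # q @ [y] \<and> set p \<subseteq> E \<and> length p = Suc (length q)"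
    by fastforce
  with Cons.prems show ?case by (intro exI[of _ "(x, z) # p"]) auto
qed

lemma undirected_tree_utree:
  assumes "undirected_tree T"
  shows "utree (pverts T) (parcs T)"
proof -
  interpret pair_graph T using assms by (simp add: undirected_tree_def)
  have sym: "sym (parcs T)" using pair_sym_arcs by (simp add: symmetric_def)
  \<comment> \<open>\<open>connected\<close> means strong connectedness of the symmetric closure.
    The arcs are symmetric already, so the closure changes nothing.\<close>
  have arcs: "parcs (mk_symmetric (with_proj T)) = parcs T"
    using sym by (auto simp: mk_symmetric_def sym_def)
  have verts: "pverts (mk_symmetric (with_proj T)) = pverts T"
    by (simp add: mk_symmetric_def)
  have con: "strongly_connected (with_proj (mk_symmetric (with_proj T)))"
    using assms unfolding undirected_tree_def Digraph_Component.connected_def by blast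
  have "(u, v) \<in> (parcs T)\<^sup>*" if "u \<in> pverts T" "v \<in> pverts T" for u v
  proof -
    have "(u, v) \<in> rtrancl_on (pverts T) (parcs T)"
      using con that unfolding strongly_connected_def reachable_def with_proj_simps arcs verts by blast
    then show ?thesis
      by (induction rule: rtrancl_on.induct) (auto intro: rtrancl_into_rtrancl)
  qed
  moreover have "pverts T \<noteq> {}"
    using con unfolding strongly_connected_def with_proj_simps verts by blast
  moreover have irr: "irrefl (parcs T)" unfolding irrefl_def using pair_no_loops by force
  moreover have arcs_in: "parcs T \<subseteq> pverts T \<times> pverts T"
    using in_arcsD1 in_arcsD2 by auto
  moreover have False if d: "distinct p" "3 \<le> length p"
    and s: "successively (\<lambda>x y. (x, y) \<in> parcs T) p" "(last p, hd p) \<in> parcs T" for p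
  proof -
    obtain x q where p: "p = x # q" using d(2) by (cases p) auto
    obtain c where c: "pcas x c x" "pawalk_verts x c = x # q @ [x]" "set c \<subseteq> parcs T" "length c = Suc (length q)"
      using closing_arcs[of "parcs T" x q x] s by (auto simp: p)
    have "x \<in> pverts T" using s(2) p arc_snd_in_verts[OF s(2)] by simp
    then have "pre_digraph.cycle (with_proj T) c"
      using c d(1) p unfolding pre_digraph.cycle_def pre_digraph.awalk_def
      by (auto simp: cas_with_proj_eq awalk_verts_with_proj_eq intro!: exI[of _ x])
    with assms c(4) d(2) p show False by (auto simp: undirected_tree_def)
  qed
  ultimately show ?thesis
    unfolding utree_def using pair_finite_verts sym irr arcs_in by blast
qed

lemma utree_leaf:
  assumes T: "utree V E" and n: "card V \<noteq> 1"
  obtains w u where "w \<in> V" "u \<in> V" "(w, u) \<in> E" "\<And>x. (w, x) \<in> E \<Longrightarrow> x = u"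
proof -
  let ?P = "\<lambda>p. p \<noteq> [] \<and> distinct p \<and> set p \<subseteq> V \<and> successively (\<lambda>x y. (x, y) \<in> E) p"
  have fin: "finite V" and ne: "V \<noteq> {}" and EV: "E \<subseteq> V \<times> V" and sym: "sym E" and irr: "irrefl E"
    and con: "\<And>u v. u \<in> V \<Longrightarrow> v \<in> V \<Longrightarrow> (u, v) \<in> E\<^sup>*"
    and acyc: "\<And>p. distinct p \<Longrightarrow> 3 \<le> length p \<Longrightarrow> successively (\<lambda>x y. (x, y) \<in> E) p \<Longrightarrow> (last p, hd p) \<notin> E"
    using T by (auto simp: utree_def)
  have "length p < Suc (card V)" if "?P p" for p
    using that fin by (metis card_mono distinct_card le_imp_less_Suc)
  moreover obtain a where a: "a \<in> V" using ne by blast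
  moreover obtain b where b: "b \<in> V" "b \<noteq> a"
  proof -
    have "V \<noteq> {a}" using n by auto
    then show thesis using that a by blast
  qed
  moreover obtain c where "(a, c) \<in> E" using con[OF a b(1)] b(2) by (metis converse_rtranclE)
  then have "?P [a, c]" using EV irr by (auto simp: irrefl_def)
  \<comment> \<open>A longest path. A neighbour of its first vertex \<open>w\<close> other than
    \<open>u\<close> would extend the path or close a cycle.\<close>
  ultimately obtain p where p: "?P p" and max: "\<And>q. ?P q \<Longrightarrow> length q \<le> length p"
    using ex_has_greatest_nat[of ?P "[a, c]" length "Suc (card V)"] less_imp_le_nat by blast
  have "2 \<le> length p" using max[OF \<open>?P [a, c]\<close>] by simp
  then obtain w u q where pq: "p = w # u # q"
    by (cases p; cases "tl p") auto
  have wu: "(w, u) \<in> E" and V: "w \<in> V" "u \<in> V" using p pq by auto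
  have "x = u" if x: "(w, x) \<in> E" for x
  proof (rule ccontr)
    assume xu: "x \<noteq> u"
    have xV: "x \<in> V" and xw: "x \<noteq> w" "(x, w) \<in> E"
      using x EV irr sym by (auto simp: irrefl_def sym_def)
    show False
    proof (cases "x \<in> set p")
      case False
      then have "?P (x # p)" using p pq xV xw by auto
      then show False using max[of "x # p"] by simp
    next
      case True
      then have "x \<in> set q" using xu xw pq by auto
      then obtain q1 q2 where q: "q = q1 @ x # q2" by (metis split_list)
      have "successively (\<lambda>x y. (x, y) \<in> E) ((w # u # q1 @ [x]) @ q2)" using p pq q by simp
      then have "successively (\<lambda>x y. (x, y) \<in> E) (w # u # q1 @ [x])"
        using successively_append_iff by blast
      moreover have "distinct (w # u # q1 @ [x])" using p pq q by auto
      ultimately show False using acyc[of "w # u # q1 @ [x]"] xw by simp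
    qed
  qed
  then show thesis using that V wu by blast
qed

lemma utree_remove_leaf:
  assumes T: "utree V E" and n: "card V \<noteq> 1" and w: "w \<in> V" "(w, u) \<in> E" "\<And>x. (w, x) \<in> E \<Longrightarrow> x = u"
  shows "utree (V - {w}) (E \<inter> (V - {w}) \<times> (V - {w}))"
proof -
  let ?E = "E \<inter> (V - {w}) \<times> (V - {w})"
  have fin: "finite V" and EV: "E \<subseteq> V \<times> V" and sym: "sym E" and irr: "irrefl E"
    and con: "\<And>u v. u \<in> V \<Longrightarrow> v \<in> V \<Longrightarrow> (u, v) \<in> E\<^sup>*"
    and acyc: "\<not> (\<exists>p. distinct p \<and> 3 \<le> length p \<and> successively (\<lambda>x y. (x, y) \<in> E) p \<and> (last p, hd p) \<in> E)"
    using T by (auto simp: utree_def)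
  have u: "u \<in> V" "u \<noteq> w" using w(2) EV irr by (auto simp: irrefl_def)
  have nb: "x = u" if "(x, w) \<in> E" for x using w(3) sym that by (meson symD)
  \<comment> \<open>Walks are followed with \<open>w\<close> contracted to its only neighbour
    \<open>u\<close>, so that a detour through the leaf becomes a stay at \<open>u\<close>.\<close>
  have reach: "(a, if b = w then u else b) \<in> ?E\<^sup>*" if "a \<in> V - {w}" "(a, b) \<in> E\<^sup>*" for a b
    using that(2)
  proof (induction rule: rtrancl_induct)
    case base
    then show ?case using that(1) by auto
  next
    case (step y z)
    show ?case
    proof (cases "y = w \<or> z = w")
      case True
      then show ?thesis using step w(3) nb irr u by (auto simp: irrefl_def)
    next
      case False
      then have "(y, z) \<in> ?E" using step(2) EV by auto
      then show ?thesis using step False by (auto intro: rtrancl_into_rtrancl)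
    qed
  qed
  have "(a, b) \<in> ?E\<^sup>*" if "a \<in> V - {w}" "b \<in> V - {w}" for a b
    using reach[OF that(1), of b] that con[of a b] by simp
  moreover have "\<not> (\<exists>p. distinct p \<and> 3 \<le> length p \<and> successively (\<lambda>x y. (x, y) \<in> ?E) p \<and> (last p, hd p) \<in> ?E)"
    using acyc successively_mono[of "\<lambda>x y. (x, y) \<in> ?E" _ "\<lambda>x y. (x, y) \<in> E"] by blast
  ultimately show ?thesis
    using fin sym irr u unfolding utree_def by (auto simp: irrefl_def sym_def)
qed

text \<open>The depth drops by one at each parent step, so iterating \<open>par\<close> ends at
  \<open>r\<close>. This form takes the place of connectedness and acyclicity in the induction over
  stars.\<close>

definition rooted :: "'a set \<Rightarrow> 'a rel \<Rightarrow> 'a \<Rightarrow> ('a \<Rightarrow> 'a) \<Rightarrow> ('a \<Rightarrow> nat) \<Rightarrow> bool" where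
  "rooted V E r par dep \<longleftrightarrow> finite V \<and> r \<in> V \<and> dep r = 0 \<and>
     (\<forall>v\<in>V - {r}. par v \<in> V \<and> dep v = Suc (dep (par v))) \<and>
     E = (\<lambda>v. (v, par v)) ` (V - {r}) \<union> (\<lambda>v. (par v, v)) ` (V - {r})"

lemma utree_rooted:
  assumes "utree V E"
  shows "\<exists>r par dep. rooted V E r par dep"
  using assms
proof (induction "card V" arbitrary: V E)
  case 0
  then show ?case by (auto simp: utree_def)
next
  case (Suc n)
  show ?case
  proof (cases "card V = 1")
    case True
    then obtain r where "V = {r}" by (auto simp: card_1_singleton_iff)
    moreover from this have "E = {}" using Suc(3) by (auto simp: utree_def irrefl_def)
    ultimately have "rooted V E r id (\<lambda>_. 0)" by (simp add: rooted_def)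
    then show ?thesis by blast
  next
    case False
    obtain w u where w: "w \<in> V" "u \<in> V" "(w, u) \<in> E" "\<And>x. (w, x) \<in> E \<Longrightarrow> x = u"
      using utree_leaf[OF Suc(3) False] by metis
    let ?V = "V - {w}" and ?E = "E \<inter> (V - {w}) \<times> (V - {w})"
    have fin: "finite V" and EV: "E \<subseteq> V \<times> V" and sym: "sym E" and irr: "irrefl E"
      using Suc(3) by (auto simp: utree_def)
    have uw: "u \<noteq> w" using w(3) irr by (auto simp: irrefl_def)
    have "n = card ?V" using Suc(2) w(1) fin by simp
    then obtain r par dep where r: "rooted ?V ?E r par dep"
      using Suc(1) utree_remove_leaf[OF Suc(3) False w(1,3,4)] by blast
    let ?p = "par(w := u)" and ?R = "V - {w} - {r}"
    have rV: "r \<in> V - {w}" and E0: "?E = (\<lambda>v. (v, par v)) ` ?R \<union> (\<lambda>v. (par v, v)) ` ?R"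
      using r unfolding rooted_def by blast+
    have "(x, y) \<in> ?E \<union> {(w, u), (u, w)}" if "(x, y) \<in> E" for x y
      using that w(4)[of x] w(4)[of y] symD[OF sym that] EV by blast
    moreover have "(u, w) \<in> E" using sym w(3) by (rule symD)
    ultimately have "E = ?E \<union> {(w, u), (u, w)}" using w(3) by auto
    moreover note E0
    moreover have V: "V - {r} = insert w ?R" using rV w(1) by auto
    moreover have img: "(\<lambda>v. (v, ?p v)) ` ?R = (\<lambda>v. (v, par v)) ` ?R"
      "(\<lambda>v. (?p v, v)) ` ?R = (\<lambda>v. (par v, v)) ` ?R"
      by (auto intro!: image_cong)
    ultimately have e: "E = (\<lambda>v. (v, par v)) ` ?R \<union> (\<lambda>v. (par v, v)) ` ?R \<union> {(w, u), (u, w)}"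
      by simp
    have "(\<lambda>v. (v, ?p v)) ` (V - {r}) = insert (w, u) ((\<lambda>v. (v, par v)) ` ?R)"
      "(\<lambda>v. (?p v, v)) ` (V - {r}) = insert (u, w) ((\<lambda>v. (par v, v)) ` ?R)"
      unfolding V image_insert img by simp_all
    with e have "E = (\<lambda>v. (v, ?p v)) ` (V - {r}) \<union> (\<lambda>v. (?p v, v)) ` (V - {r})"
      by (simp add: insert_commute)
    then have "rooted V E r (par(w := u)) (dep(w := Suc (dep u)))"
      using r w(1,2) uw fin unfolding rooted_def by auto
    then show ?thesis by blast
  qed
qed

text \<open>The inverse of removing the parent \<open>v\<close> of a deepest leaf: a star with
  centre \<open>v\<close> and leaves \<open>L\<close> is hung at the old vertex \<open>u\<close>. As
  \<open>L\<close> is nonempty, the star has an edge that avoids the old tree.\<close>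

definition attach_star :: "'a set \<Rightarrow> 'a rel \<Rightarrow> 'a \<Rightarrow> 'a \<Rightarrow> 'a set \<Rightarrow> 'a set \<Rightarrow> 'a rel \<Rightarrow> bool" where
  "attach_star V E u v L V' E' \<longleftrightarrow> u \<in> V \<and> v \<notin> V \<and> v \<notin> L \<and> finite L \<and> L \<noteq> {} \<and> L \<inter> V = {} \<and>
     V' = insert v (V \<union> L) \<and>
     E' = E \<union> {(u, v), (v, u)} \<union> {v} \<times> L \<union> L \<times> {v}"

text \<open>If a vertex \<open>w\<close> of maximal depth has depth at least 2 and \<open>v\<close>
  is its parent, then the children of \<open>v\<close> are leaves, because a grandchild of
  \<open>v\<close> would be deeper than \<open>w\<close>. So \<open>v\<close> and its children form
  a star hung at the parent of \<open>v\<close>. Smaller depth leaves a single vertex or a star with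
  centre \<open>r\<close>.\<close>

lemma rooted_cases:
  assumes R: "rooted V E r par dep"
  obtains "V - {r} = {}" "E = {}"
    | "E = {r} \<times> (V - {r}) \<union> (V - {r}) \<times> {r}" "V - {r} \<noteq> {}"
    | V0 E0 u v L where "rooted V0 E0 r par dep" "attach_star V0 E0 u v L V E"
proof -
  have fin: "finite V" and r: "r \<in> V" "dep r = 0"
    and par: "\<And>v. v \<in> V \<Longrightarrow> v \<noteq> r \<Longrightarrow> par v \<in> V" "\<And>v. v \<in> V \<Longrightarrow> v \<noteq> r \<Longrightarrow> dep v = Suc (dep (par v))"
    and E: "E = (\<lambda>v. (v, par v)) ` (V - {r}) \<union> (\<lambda>v. (par v, v)) ` (V - {r})"
    using R by (auto simp: rooted_def)
  have "Max (dep ` V) \<in> dep ` V" using fin r(1) by (intro Max_in) auto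
  then obtain w where w0: "w \<in> V" "dep w = Max (dep ` V)" by force
  have w: "w \<in> V" "\<And>x. x \<in> V \<Longrightarrow> dep x \<le> dep w"
    using fin w0 by auto
  consider "V - {r} = {}" | "V - {r} \<noteq> {}" "dep w \<le> 1" | "dep w \<ge> 2" by linarith
  then show thesis
  proof cases
    case 1
    then show thesis using that(1) E by simp
  next
    case 2
    have "par x = r" if "x \<in> V" "x \<noteq> r" for x
    proof (rule ccontr)
      assume "par x \<noteq> r"
      then have "dep x = Suc (Suc (dep (par (par x))))" using par that by simp
      then show False using w(2)[OF that(1)] 2(2) by simp
    qed
    then have "(\<lambda>v. (v, par v)) ` (V - {r}) = (V - {r}) \<times> {r}" "(\<lambda>v. (par v, v)) ` (V - {r}) = {r} \<times> (V - {r})"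
      by (auto simp: image_iff)
    then show thesis using that(2) E 2(1) by blast
  next
    case 3
    define v where "v = par w"
    define L where "L = {x \<in> V - {r}. par x = v}"
    define V0 where "V0 = V - insert v L"
    define E0 where "E0 = (\<lambda>v. (v, par v)) ` (V0 - {r}) \<union> (\<lambda>v. (par v, v)) ` (V0 - {r})"
    have wr: "w \<noteq> r" using 3 r by auto
    have v: "v \<in> V" "dep w = Suc (dep v)" using par w(1) wr by (auto simp: v_def)
    have vr: "v \<noteq> r" using 3 v r by auto
    have wL: "w \<in> L" using w(1) wr by (simp add: L_def v_def)
    have child: "par y \<notin> L" if "y \<in> V" "y \<noteq> r" for y
    proof
      assume "par y \<in> L"
      then have "dep y = Suc (Suc (dep v))" using par that by (auto simp: L_def)
      then show False using w(2)[OF that(1)] v(2) by simp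
    qed
    have vL: "v \<notin> L" using par(2)[OF v(1) vr] by (auto simp: L_def)
    have u: "par v \<in> V0" using par[OF v(1) vr] child[OF v(1) vr] by (auto simp: V0_def)
    have "rooted V0 E0 r par dep"
      using fin r par vr child unfolding rooted_def V0_def E0_def by (auto simp: L_def)
    moreover have V: "V - {r} = insert v ((V0 - {r}) \<union> L)" "V = insert v (V0 \<union> L)"
      using v vr r by (auto simp: V0_def L_def)
    have L: "(\<lambda>x. (x, par x)) ` L = L \<times> {v}" "(\<lambda>x. (par x, x)) ` L = {v} \<times> L"
      by (auto simp: L_def image_iff)
    have "E = E0 \<union> {(par v, v), (v, par v)} \<union> {v} \<times> L \<union> L \<times> {v}"
      unfolding E V(1) E0_def image_insert image_Un L by blast
    then have "attach_star V0 E0 (par v) v L V E"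
      using V(2) u vL wL fin unfolding attach_star_def V0_def by (auto simp: L_def)
    ultimately show thesis using that(3) by blast
  qed
qed

section \<open>Trees as a core with leaves\<close>

text \<open>\<open>f\<close> places the core vertices \<open>0, ..., k - 1\<close> in the graph, and
  every other vertex \<open>x\<close> is a leaf at \<open>f (g x)\<close>. Only the numbers
  \<open>l\<close> of leaves are fixed, which suffices to compare graphs on different vertex
  types.\<close>

definition modelled :: "'a set \<Rightarrow> 'a rel \<Rightarrow> nat \<Rightarrow> nat rel \<Rightarrow> (nat \<Rightarrow> nat) \<Rightarrow> (nat \<Rightarrow> 'a) \<Rightarrow> ('a \<Rightarrow> nat) \<Rightarrow> bool" where
  "modelled V E k R l f g \<longleftrightarrow> finite V \<and> inj_on f {..<k} \<and> f ` {..<k} \<subseteq> V \<and> R \<subseteq> {..<k} \<times> {..<k} \<and> sym R \<and>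
     g ` (V - f ` {..<k}) \<subseteq> {..<k} \<and>
     E = (\<lambda>(i, j). (f i, f j)) ` R \<union> (\<lambda>x. (x, f (g x))) ` (V - f ` {..<k}) \<union> (\<lambda>x. (f (g x), x)) ` (V - f ` {..<k}) \<and>
     (\<forall>i<k. card {x \<in> V - f ` {..<k}. g x = i} = l i)"

definition model :: "'a set \<Rightarrow> 'a rel \<Rightarrow> nat \<Rightarrow> nat rel \<Rightarrow> (nat \<Rightarrow> nat) \<Rightarrow> bool" where
  "model V E k R l \<longleftrightarrow> (\<exists>f g. modelled V E k R l f g)"

lemma model_star:
  assumes "finite V" "r \<in> V" "E = {r} \<times> (V - {r}) \<union> (V - {r}) \<times> {r}"
  shows "modelled V E 1 {} (\<lambda>_. card V - 1) (\<lambda>_. r) (\<lambda>_. 0)"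
proof -
  have [simp]: "{..<1::nat} = {0}" by auto
  have "{x \<in> V - {r}. (0::nat) = 0} = V - {r}" by auto
  then have "card {x \<in> V - {r}. (0::nat) = 0} = card V - 1" using assms(1,2) by simp
  then show ?thesis
    using assms unfolding modelled_def by (auto simp: sym_def inj_on_def lessThan_Suc)
qed

lemma modelled_grow_core:
  assumes M: "modelled V E k R l f g" and i: "i < k" and A: "attach_star V E (f i) v L V' E'"
  shows "modelled V' E' (Suc k) (R \<union> {(i, k), (k, i)}) (l(k := card L)) (f(k := v)) (\<lambda>x. if x \<in> L then k else g x)"
proof -
  let ?f = "f(k := v)" and ?g = "\<lambda>x. if x \<in> L then k else g x" and ?W = "V - f ` {..<k}"
  have R: "R \<subseteq> {..<k} \<times> {..<k}" and fV: "f ` {..<k} \<subseteq> V" and gk: "g ` ?W \<subseteq> {..<k}" and inj: "inj_on f {..<k}"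
    and E: "E = (\<lambda>(i, j). (f i, f j)) ` R \<union> (\<lambda>x. (x, f (g x))) ` ?W \<union> (\<lambda>x. (f (g x), x)) ` ?W"
    and l: "\<And>i. i < k \<Longrightarrow> card {x \<in> ?W. g x = i} = l i"
    using M by (auto simp: modelled_def)
  have L: "v \<notin> V" "v \<notin> L" "finite L" "L \<inter> V = {}" "V' = insert v (V \<union> L)"
    and E': "E' = E \<union> {(f i, v), (v, f i)} \<union> {v} \<times> L \<union> L \<times> {v}"
    using A by (auto simp: attach_star_def)
  have im: "?f ` {..<Suc k} = insert v (f ` {..<k})" by (auto simp: lessThan_Suc)
  have W: "V' - ?f ` {..<Suc k} = ?W \<union> L" unfolding im using L fV by auto
  have WL: "x \<notin> L" if "x \<in> ?W" for x using that L by auto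
  have 1: "(\<lambda>(i, j). (?f i, ?f j)) ` R = (\<lambda>(i, j). (f i, f j)) ` R"
    using R by (intro image_cong) auto
  have 2: "(\<lambda>x. (x, ?f (?g x))) ` (?W \<union> L) = (\<lambda>x. (x, f (g x))) ` ?W \<union> L \<times> {v}"
    "(\<lambda>x. (?f (?g x), x)) ` (?W \<union> L) = (\<lambda>x. (f (g x), x)) ` ?W \<union> {v} \<times> L"
    unfolding image_Un using WL gk by (auto simp: image_iff)
  have E2: "E' = (\<lambda>(i, j). (?f i, ?f j)) ` (R \<union> {(i, k), (k, i)}) \<union>
      (\<lambda>x. (x, ?f (?g x))) ` (?W \<union> L) \<union> (\<lambda>x. (?f (?g x), x)) ` (?W \<union> L)"
    unfolding 2 image_Un[of _ R] 1 E' E using i by auto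
  have "card {x \<in> ?W \<union> L. ?g x = j} = (l(k := card L)) j" if "j < Suc k" for j
  proof (cases "j = k")
    case True
    have "{x \<in> ?W \<union> L. ?g x = k} = L" using gk by fastforce
    then show ?thesis using True by simp
  next
    case False
    then have "{x \<in> ?W \<union> L. ?g x = j} = {x \<in> ?W. g x = j}" using WL by auto
    then show ?thesis using False that l by simp
  qed
  moreover have "inj_on ?f {..<Suc k}" using inj L(1) fV by (auto simp: inj_on_def lessThan_Suc)
  moreover have "sym (R \<union> {(i, k), (k, i)})" using M by (auto simp: modelled_def sym_def)
  moreover have "finite V'" using M L by (simp add: modelled_def)
  moreover have "?f ` {..<Suc k} \<subseteq> V'" unfolding im using fV L by auto
  moreover have "R \<union> {(i, k), (k, i)} \<subseteq> {..<Suc k} \<times> {..<Suc k}" using R i by auto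
  moreover have "?g ` (?W \<union> L) \<subseteq> {..<Suc k}" using gk WL by force
  ultimately show ?thesis
    using E2 unfolding modelled_def W by blast
qed

text \<open>Prepares for a star hung at a leaf: the graph is unchanged, but \<open>u\<close> now
  counts as a core vertex without leaves, where \<open>modelled_grow_core\<close> can attach the
  star.\<close>

lemma modelled_promote_leaf:
  assumes M: "modelled V E k R l f g" and u: "u \<in> V - f ` {..<k}" and i: "i = g u"
  shows "modelled V E (Suc k) (R \<union> {(i, k), (k, i)}) (l(i := l i - 1, k := 0)) (f(k := u)) g"
proof -
  let ?f = "f(k := u)" and ?W = "V - f ` {..<k}"
  have R: "R \<subseteq> {..<k} \<times> {..<k}" and fV: "f ` {..<k} \<subseteq> V" and gk: "g ` ?W \<subseteq> {..<k}" and inj: "inj_on f {..<k}"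
    and E: "E = (\<lambda>(i, j). (f i, f j)) ` R \<union> (\<lambda>x. (x, f (g x))) ` ?W \<union> (\<lambda>x. (f (g x), x)) ` ?W"
    and l: "\<And>i. i < k \<Longrightarrow> card {x \<in> ?W. g x = i} = l i" and fin: "finite V"
    using M by (auto simp: modelled_def)
  have ik: "i < k" using gk u i by auto
  have im: "?f ` {..<Suc k} = insert u (f ` {..<k})" by (auto simp: lessThan_Suc)
  have W: "V - ?f ` {..<Suc k} = ?W - {u}" unfolding im by auto
  have Wu: "?W = insert u (?W - {u})" using u by auto
  have 1: "(\<lambda>(i, j). (?f i, ?f j)) ` R = (\<lambda>(i, j). (f i, f j)) ` R"
    using R by (intro image_cong) auto
  have 2: "(\<lambda>x. (x, ?f (g x))) ` (?W - {u}) = (\<lambda>x. (x, f (g x))) ` (?W - {u})"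
    "(\<lambda>x. (?f (g x), x)) ` (?W - {u}) = (\<lambda>x. (f (g x), x)) ` (?W - {u})"
    using gk by (auto intro!: image_cong)
  have 3: "(\<lambda>x. (x, f (g x))) ` ?W = insert (u, f i) ((\<lambda>x. (x, f (g x))) ` (?W - {u}))"
    "(\<lambda>x. (f (g x), x)) ` ?W = insert (f i, u) ((\<lambda>x. (f (g x), x)) ` (?W - {u}))"
    using Wu i by (metis (no_types, lifting) image_insert)+
  have E2: "E = (\<lambda>(i, j). (?f i, ?f j)) ` (R \<union> {(i, k), (k, i)}) \<union>
      (\<lambda>x. (x, ?f (g x))) ` (?W - {u}) \<union> (\<lambda>x. (?f (g x), x)) ` (?W - {u})"
    unfolding 2 image_Un[of _ R] 1 E 3 using ik by auto
  have "card {x \<in> ?W - {u}. g x = j} = (l(i := l i - 1, k := 0)) j" if "j < Suc k" for j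
  proof -
    consider "j = k" | "j = i" | "j \<noteq> k" "j \<noteq> i" by blast
    then show ?thesis
    proof cases
      case 1
      have "{x \<in> ?W - {u}. g x = k} = {}" using gk by fastforce
      then show ?thesis unfolding 1 by (simp only: fun_upd_same card.empty)
    next
      case 2
      have "{x \<in> ?W - {u}. g x = i} = {x \<in> ?W. g x = i} - {u}" by auto
      then show ?thesis using 2 ik l[OF ik] u i fin by simp
    next
      case 3
      have "{x \<in> ?W - {u}. g x = j} = {x \<in> ?W. g x = j}" using 3 i by auto
      then show ?thesis using 3 that l by simp
    qed
  qed
  moreover have "inj_on ?f {..<Suc k}" using inj u by (auto simp: inj_on_def lessThan_Suc)
  moreover have "sym (R \<union> {(i, k), (k, i)})" using M by (auto simp: modelled_def sym_def)
  moreover have "?f ` {..<Suc k} \<subseteq> V" unfolding im using fV u by auto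
  moreover have "R \<union> {(i, k), (k, i)} \<subseteq> {..<Suc k} \<times> {..<Suc k}" using R ik by auto
  moreover have "g ` (?W - {u}) \<subseteq> {..<Suc k}" using gk by auto
  ultimately show ?thesis
    using fin E2 unfolding modelled_def W by blast
qed

text \<open>\<open>p i\<close> is the old name of the core vertex now named \<open>i\<close>; hence
  \<open>f\<close> is composed with \<open>p\<close>, and \<open>g\<close> with the inverse of
  \<open>p\<close>.\<close>

lemma model_relabel:
  assumes M: "model V E k R l" and p: "p permutes {..<k}"
    and R': "\<And>i j. (i, j) \<in> R' \<longleftrightarrow> i < k \<and> j < k \<and> (p i, p j) \<in> R"
    and l': "\<And>i. i < k \<Longrightarrow> l' i = l (p i)"
  shows "model V E k R' l'"
proof -
  from M obtain f g where m: "modelled V E k R l f g" by (auto simp: model_def)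
  let ?q = "Hilbert_Choice.inv p" and ?W = "V - f ` {..<k}"
  have im: "(f \<circ> p) ` {..<k} = f ` {..<k}" using p by (metis image_comp permutes_image)
  have R: "R \<subseteq> {..<k} \<times> {..<k}" and gk: "g ` ?W \<subseteq> {..<k}"
    and l: "\<And>i. i < k \<Longrightarrow> card {x \<in> ?W. g x = i} = l i"
    using m by (auto simp: modelled_def)
  have pk: "p i < k \<longleftrightarrow> i < k" for i using permutes_in_image[OF p, of i] by simp
  have ipk: "?q i < k \<longleftrightarrow> i < k" for i using permutes_in_image[OF permutes_inv[OF p], of i] by simp
  have pi: "p (?q i) = i" "?q (p i) = i" for i using permutes_inverses[OF p] by auto
  have RR: "(\<lambda>(i, j). (f (p i), f (p j))) ` R' = (\<lambda>(i, j). (f i, f j)) ` R"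
  proof (intro equalityI subsetI)
    fix e assume "e \<in> (\<lambda>(i, j). (f i, f j)) ` R"
    then obtain i j where ij: "(i, j) \<in> R" "e = (f i, f j)" by auto
    then have "(?q i, ?q j) \<in> R'" using R by (auto simp: R' pi ipk)
    then show "e \<in> (\<lambda>(i, j). (f (p i), f (p j))) ` R'" using ij(2) pi
      by (intro image_eqI[of _ _ "(?q i, ?q j)"]) auto
  qed (use R' in auto)
  have "inj_on (f \<circ> p) {..<k}"
    using m p by (metis comp_inj_on modelled_def permutes_image permutes_inj_on)
  moreover have "card {x \<in> ?W. (?q \<circ> g) x = i} = l' i" if "i < k" for i
  proof -
    have "{x \<in> ?W. (?q \<circ> g) x = i} = {x \<in> ?W. g x = p i}" using pi by auto
    then show ?thesis using that l l' pk by simp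
  qed
  moreover have "R' \<subseteq> {..<k} \<times> {..<k}" "sym R'" using R' m by (auto simp: sym_def modelled_def)
  moreover have "(?q \<circ> g) ` ?W \<subseteq> {..<k}" using gk ipk by auto
  ultimately have "modelled V E k R' l' (f \<circ> p) (?q \<circ> g)"
    using m RR unfolding modelled_def im comp_apply pi by simp
  then show ?thesis by (auto simp: model_def)
qed

text \<open>The two core placements match the core vertices. Leaves at one core vertex are
  interchangeable, so arbitrary bijections between the equally large leaf sets complete the
  isomorphism.\<close>

lemma model_isomorphic:
  assumes M: "model V E k R l" and M': "model V' E' k R l"
  shows "\<exists>h. bij_betw h V V' \<and> (\<forall>u\<in>V. \<forall>v\<in>V. (u, v) \<in> E \<longleftrightarrow> (h u, h v) \<in> E')"
proof -
  from M obtain f g where m: "modelled V E k R l f g" by (auto simp: model_def)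
  from M' obtain f' g' where m': "modelled V' E' k R l f' g'" by (auto simp: model_def)
  let ?C = "f ` {..<k}" and ?C' = "f' ` {..<k}"
  let ?W = "V - ?C" and ?W' = "V' - ?C'"
  have R: "R \<subseteq> {..<k} \<times> {..<k}" and fV: "?C \<subseteq> V" and gk: "g ` ?W \<subseteq> {..<k}" and inj: "inj_on f {..<k}"
    and E: "E = (\<lambda>(i, j). (f i, f j)) ` R \<union> (\<lambda>x. (x, f (g x))) ` ?W \<union> (\<lambda>x. (f (g x), x)) ` ?W"
    and l: "\<And>i. i < k \<Longrightarrow> card {x \<in> ?W. g x = i} = l i" and fin: "finite V"
    using m by (auto simp: modelled_def)
  have fV': "?C' \<subseteq> V'" and gk': "g' ` ?W' \<subseteq> {..<k}" and inj': "inj_on f' {..<k}"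
    and E': "E' = (\<lambda>(i, j). (f' i, f' j)) ` R \<union> (\<lambda>x. (x, f' (g' x))) ` ?W' \<union> (\<lambda>x. (f' (g' x), x)) ` ?W'"
    and l': "\<And>i. i < k \<Longrightarrow> card {x \<in> ?W'. g' x = i} = l i" and fin': "finite V'"
    using m' by (auto simp: modelled_def)
  have "\<exists>b. bij_betw b {x \<in> ?W. g x = i} {x \<in> ?W'. g' x = i}" if "i < k" for i
    by (rule finite_same_card_bij) (use fin fin' l l' that in auto)
  then obtain b where b: "\<And>i. i < k \<Longrightarrow> bij_betw (b i) {x \<in> ?W. g x = i} {x \<in> ?W'. g' x = i}" by metis
  define h where "h x = (if x \<in> ?C then f' (inv_into {..<k} f x) else b (g x) x)" for x
  have hf: "h (f i) = f' i" if "i < k" for i using that inj by (simp add: h_def)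
  have hW: "h x \<in> ?W'" "g' (h x) = g x" if "x \<in> ?W" for x
  proof -
    have "h x = b (g x) x" using that by (simp add: h_def)
    moreover have "g x < k" using gk that by auto
    ultimately have "h x \<in> {y \<in> ?W'. g' y = g x}" using bij_betwE[OF b] that by auto
    then show "h x \<in> ?W'" "g' (h x) = g x" by auto
  qed
  have surjW: "y \<in> h ` ?W" if "y \<in> ?W'" for y
  proof -
    have "g' y < k" using gk' that by auto
    then have "y \<in> b (g' y) ` {x \<in> ?W. g x = g' y}" using b that by (simp add: bij_betw_def)
    then obtain x where x: "x \<in> ?W" "g x = g' y" "y = b (g' y) x" by blast
    then have "y = h x" by (simp add: h_def)
    then show ?thesis using x(1) by blast
  qed
  have injW: "x = y" if "x \<in> ?W" "y \<in> ?W" "h x = h y" for x y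
  proof -
    have g: "g x = g y" using hW that by metis
    moreover have "g x < k" using gk that by auto
    then have "inj_on (b (g x)) {z \<in> ?W. g z = g x}" using b by (simp add: bij_betw_def)
    ultimately show ?thesis using that by (auto simp: h_def inj_on_def)
  qed
  have C: "h ` ?C = ?C'" using hf by (force simp: image_iff)
  have "h ` ?W \<subseteq> ?W'" by (rule image_subsetI) (rule hW(1))
  moreover have "?W' \<subseteq> h ` ?W" by (rule subsetI) (rule surjW)
  ultimately have Wim: "h ` ?W = ?W'" by (rule subset_antisym)
  have "inj_on h ?C" using hf inj inj' by (auto simp: inj_on_def)
  moreover have "inj_on h ?W" by (rule inj_onI) (rule injW)
  moreover have "h ` (?C - ?W) \<inter> h ` (?W - ?C) = {}"
    using image_mono[of "?C - ?W" ?C h] image_mono[of "?W - ?C" ?W h] unfolding C Wim by blast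
  ultimately have "inj_on h (?C \<union> ?W)" unfolding inj_on_Un by blast
  moreover have V: "?C \<union> ?W = V" using fV by auto
  ultimately have injV: "inj_on h V" by simp
  have "h ` V = h ` ?C \<union> h ` ?W" using V by (metis image_Un)
  then have "h ` V = V'" using C Wim fV' by auto
  with injV have bij: "bij_betw h V V'" by (simp add: bij_betw_def)
  have "f (g x) \<in> V" if "x \<in> ?W" for x using that gk fV by blast
  moreover have "f i \<in> V" if "i < k" for i using that fV by blast
  ultimately have EV: "E \<subseteq> V \<times> V" unfolding E using R by auto
  have fx: "h (f (g x)) = f' (g' (h x))" if "x \<in> ?W" for x
    using hf[of "g x"] gk hW(2)[OF that] that by auto
  have "(\<lambda>(x, y). (h x, h y)) ` (\<lambda>(i, j). (f i, f j)) ` R = (\<lambda>(i, j). (f' i, f' j)) ` R"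
    unfolding image_image using R by (intro image_cong) (auto simp: hf)
  moreover have "(\<lambda>(x, y). (h x, h y)) ` (\<lambda>x. (x, f (g x))) ` ?W = (\<lambda>x. (x, f' (g' x))) ` h ` ?W"
    unfolding image_image by (intro image_cong refl) (simp add: fx)
  moreover have "(\<lambda>(x, y). (h x, h y)) ` (\<lambda>x. (f (g x), x)) ` ?W = (\<lambda>x. (f' (g' x), x)) ` h ` ?W"
    unfolding image_image by (intro image_cong refl) (simp add: fx)
  ultimately have EE: "(\<lambda>(x, y). (h x, h y)) ` E = E'"
    unfolding E E' image_Un Wim by simp
  have "(u, v) \<in> E \<longleftrightarrow> (h u, h v) \<in> E'" if "u \<in> V" "v \<in> V" for u v
  proof
    assume "(h u, h v) \<in> E'"
    then obtain x y where xy: "(x, y) \<in> E" "h u = h x" "h v = h y" unfolding EE[symmetric] by auto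
    then have "u = x" "v = y" using injV that EV by (auto dest: inj_onD)
    then show "(u, v) \<in> E" using xy by simp
  qed (use EE in force)
  with bij show ?thesis by blast
qed

section \<open>Walk counts\<close>

fun walks :: "'a set \<Rightarrow> 'a rel \<Rightarrow> nat \<Rightarrow> 'a \<Rightarrow> nat" where
  "walks V E 0 v = 1"
| "walks V E (Suc j) v = (\<Sum>u\<in>{u \<in> V. (v, u) \<in> E}. walks V E j u)"

text \<open>Symmetry allows a walk of length \<open>i + j\<close> to be cut into two walks that
  start at the cutting vertex. So the walk numbers up to length 8 need only walks of length at most
  4 from each vertex.\<close>

lemma sum_walks_add:
  assumes "finite V" "sym E"
  shows "(\<Sum>v\<in>V. walks V E (i + j) v) = (\<Sum>v\<in>V. walks V E i v * walks V E j v)"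
proof (induction i arbitrary: j)
  case (Suc i)
  have "(\<Sum>v\<in>V. walks V E (Suc i) v * walks V E j v) =
      (\<Sum>v\<in>V. \<Sum>u\<in>V. if (v, u) \<in> E then walks V E i u * walks V E j v else 0)"
    using assms(1) by (simp add: sum_distrib_right sum.If_cases Int_def conj_commute)
  also have "\<dots> = (\<Sum>u\<in>V. \<Sum>v\<in>V. if (v, u) \<in> E then walks V E i u * walks V E j v else 0)"
    by (rule sum.swap)
  also have "\<dots> = (\<Sum>u\<in>V. walks V E i u * walks V E (Suc j) u)"
  proof (intro sum.cong refl)
    fix u
    have "{v \<in> V. (v, u) \<in> E} = {v \<in> V. (u, v) \<in> E}" using assms(2) by (auto simp: sym_def)
    then show "(\<Sum>v\<in>V. if (v, u) \<in> E then walks V E i u * walks V E j v else 0) =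
        walks V E i u * walks V E (Suc j) u"
      using assms(1) by (simp add: sum_distrib_left sum.If_cases Int_def)
  qed
  finally show ?case using Suc[of "Suc j"] by simp
qed simp

lemma adjacency_pow_all_ones:
  fixes T :: "'a pair_pre_digraph"
  assumes fin: "finite (pverts T)"
  shows "all_ones T \<bullet> ((adjacency_matrix T ^\<^sub>m k) *\<^sub>v all_ones T) =
    real (\<Sum>v\<in>pverts T. walks (pverts T) (parcs T) k v)"
proof -
  define V where "V = pverts T"
  define E where "E = parcs T"
  define n where "n = card V"
  define e where "e = from_nat_into V"
  define A where "A = adjacency_matrix T"
  have e: "bij_betw e {..<n} V"
    unfolding e_def n_def using fin by (simp add: V_def bij_betw_from_nat_into_finite)
  have A: "A = mat n n (\<lambda>(i, j). if (e i, e j) \<in> E then 1 else 0)"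
    by (simp add: A_def adjacency_matrix_def n_def e_def V_def E_def)
  have Ac: "A \<in> carrier_mat n n" by (simp add: A)
  have step: "A *\<^sub>v vec n (\<lambda>i. real (walks V E j (e i))) = vec n (\<lambda>i. real (walks V E (Suc j) (e i)))" for j
  proof (rule eq_vecI)
    fix i assume "i < dim_vec (vec n (\<lambda>i. real (walks V E (Suc j) (e i))))"
    then have i: "i < n" by simp
    have "(A *\<^sub>v vec n (\<lambda>i. real (walks V E j (e i)))) $ i =
        (\<Sum>b<n. if (e i, e b) \<in> E then real (walks V E j (e b)) else 0)"
      using i by (auto simp: A scalar_prod_def atLeast0LessThan intro!: sum.cong)
    also have "\<dots> = (\<Sum>u\<in>V. if (e i, u) \<in> E then real (walks V E j u) else 0)"
      by (rule sum.reindex_bij_betw[OF e])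
    also have "\<dots> = real (walks V E (Suc j) (e i))"
      using fin by (simp add: V_def sum.If_cases Int_def)
    finally show "(A *\<^sub>v vec n (\<lambda>i. real (walks V E j (e i)))) $ i = vec n (\<lambda>i. real (walks V E (Suc j) (e i))) $ i"
      using i by simp
  qed (simp add: A)
  have "(A ^\<^sub>m j) *\<^sub>v vec n (\<lambda>i. real (walks V E m (e i))) = vec n (\<lambda>i. real (walks V E (j + m) (e i)))" for j m
  proof (induction j arbitrary: m)
    case (Suc j)
    let ?x = "\<lambda>m. vec n (\<lambda>i. real (walks V E m (e i)))"
    have "(A ^\<^sub>m Suc j) *\<^sub>v ?x m = (A ^\<^sub>m j) *\<^sub>v (A *\<^sub>v ?x m)"
      unfolding pow_mat.simps by (rule assoc_mult_mat_vec[of _ n n _ n]) (use Ac in auto)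
    also have "\<dots> = ?x (j + Suc m)" unfolding step by (rule Suc)
    finally show ?case by simp
  qed (use Ac in simp)
  from this[of k 0] have "(A ^\<^sub>m k) *\<^sub>v all_ones T = vec n (\<lambda>i. real (walks V E k (e i)))"
    by (simp add: all_ones_def n_def V_def)
  then have "all_ones T \<bullet> ((A ^\<^sub>m k) *\<^sub>v all_ones T) = (\<Sum>i<n. real (walks V E k (e i)))"
    by (simp add: all_ones_def scalar_prod_def atLeast0LessThan n_def V_def)
  also have "\<dots> = (\<Sum>v\<in>V. real (walks V E k v))" by (rule sum.reindex_bij_betw[OF e])
  finally show ?thesis by (simp add: A_def V_def E_def)
qed

text \<open>Only core vertices are tracked: a walk that steps onto a leaf has to return at once,
  which contributes \<open>l i\<close> times the count for two steps fewer, and just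
  \<open>l i\<close> for length one. Sums over lists can be unfolded by rewriting.\<close>

fun core_walks :: "nat \<Rightarrow> nat rel \<Rightarrow> (nat \<Rightarrow> nat) \<Rightarrow> nat \<Rightarrow> nat \<Rightarrow> nat" where
  "core_walks k R l 0 i = 1"
| "core_walks k R l (Suc 0) i = (\<Sum>b\<leftarrow>[0..<k]. if (i, b) \<in> R then 1 else 0) + l i"
| "core_walks k R l (Suc (Suc j)) i =
     (\<Sum>b\<leftarrow>[0..<k]. if (i, b) \<in> R then core_walks k R l (Suc j) b else 0) + l i * core_walks k R l j i"

definition leaf_walks :: "nat \<Rightarrow> nat rel \<Rightarrow> (nat \<Rightarrow> nat) \<Rightarrow> nat \<Rightarrow> nat \<Rightarrow> nat" where
  "leaf_walks k R l j i = (case j of 0 \<Rightarrow> 1 | Suc j \<Rightarrow> core_walks k R l j i)"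

lemma modelled_adj_core:
  assumes M: "modelled V E k R l f g" and i: "i < k"
  shows "{u \<in> V. (f i, u) \<in> E} = f ` {b. b < k \<and> (i, b) \<in> R} \<union> {x \<in> V - f ` {..<k}. g x = i}"
proof -
  have R: "R \<subseteq> {..<k} \<times> {..<k}" and fV: "f ` {..<k} \<subseteq> V" and gk: "g ` (V - f ` {..<k}) \<subseteq> {..<k}" and inj: "inj_on
      f {..<k}"
    and E: "E = (\<lambda>(i, j). (f i, f j)) ` R \<union> (\<lambda>x. (x, f (g x))) ` (V - f ` {..<k}) \<union> (\<lambda>x. (f (g x), x)) ` (V - f `
        {..<k})"
    using M by (auto simp: modelled_def)
  have 1: "f i = f j \<longleftrightarrow> i = j" if "j < k" for j using inj i that by (auto simp: inj_on_def)
  have "(f i, u) \<in> E \<longleftrightarrow> (\<exists>b. (i, b) \<in> R \<and> u = f b) \<or> (u \<in> V - f ` {..<k} \<and> g u = i)" for u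
  proof
    assume "(f i, u) \<in> E"
    then consider a b where "(a, b) \<in> R" "f i = f a" "u = f b" | x where "x \<in> V - f ` {..<k}" "x = f i"
      | "u \<in> V - f ` {..<k}" "f i = f (g u)"
      unfolding E by auto
    then show "(\<exists>b. (i, b) \<in> R \<and> u = f b) \<or> (u \<in> V - f ` {..<k} \<and> g u = i)"
    proof cases
      case (1 a b)
      then have "a < k" using R by auto
      then have "i = a" using inj i 1(2) by (auto simp: inj_on_def)
      then show ?thesis using 1 by blast
    next
      case 2
      then show ?thesis using i by auto
    next
      case 3
      then have "g u < k" using gk by auto
      then have "i = g u" using inj i 3(2) by (auto simp: inj_on_def)
      then show ?thesis using 3 by blast
    qed
  next
    assume "(\<exists>b. (i, b) \<in> R \<and> u = f b) \<or> (u \<in> V - f ` {..<k} \<and> g u = i)"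
    then show "(f i, u) \<in> E" unfolding E by force
  qed
  then show ?thesis using R fV by auto
qed

lemma modelled_adj_leaf:
  assumes M: "modelled V E k R l f g" and x: "x \<in> V - f ` {..<k}"
  shows "{u \<in> V. (x, u) \<in> E} = {f (g x)}"
proof -
  have R: "R \<subseteq> {..<k} \<times> {..<k}" and fV: "f ` {..<k} \<subseteq> V" and gk: "g ` (V - f ` {..<k}) \<subseteq> {..<k}"
    and E: "E = (\<lambda>(i, j). (f i, f j)) ` R \<union> (\<lambda>x. (x, f (g x))) ` (V - f ` {..<k}) \<union> (\<lambda>x. (f (g x), x)) ` (V - f `
        {..<k})"
    using M by (auto simp: modelled_def)
  have "g x < k" using gk x by auto
  moreover have "f (g y) \<noteq> x" if "y \<in> V - f ` {..<k}" for y using that gk x by auto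
  ultimately show ?thesis using x R fV unfolding E by auto
qed

lemma sum_list_upt_filter:
  "(\<Sum>b\<leftarrow>[0..<k]. if P b then h b else 0) = (\<Sum>b\<in>{b. b < k \<and> P b}. h b :: 'b :: comm_monoid_add)"
proof -
  have "(\<Sum>b\<leftarrow>[0..<k]. if P b then h b else 0) = (\<Sum>b\<in>{..<k}. if P b then h b else 0)"
    by (simp add: sum_list_distinct_conv_sum_set atLeast0LessThan)
  also have "\<dots> = (\<Sum>b\<in>{b. b < k \<and> P b}. h b)" by (simp add: sum.If_cases Int_def)
  finally show ?thesis .
qed

lemma modelled_walks:
  assumes M: "modelled V E k R l f g"
  shows "\<And>i. i < k \<Longrightarrow> walks V E j (f i) = core_walks k R l j i"
    and "\<And>x. x \<in> V - f ` {..<k} \<Longrightarrow> walks V E j x = leaf_walks k R l j (g x)"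
proof -
  have fin: "finite V" and gk: "g ` (V - f ` {..<k}) \<subseteq> {..<k}" and inj: "inj_on f {..<k}"
    and l: "\<And>i. i < k \<Longrightarrow> card {x \<in> V - f ` {..<k}. g x = i} = l i"
    using M by (auto simp: modelled_def)
  have step: "walks V E (Suc j) (f i) = (\<Sum>b\<leftarrow>[0..<k]. if (i, b) \<in> R then walks V E j (f b) else 0) +
      (\<Sum>x\<in>{x \<in> V - f ` {..<k}. g x = i}. walks V E j x)" if "i < k" for i j
  proof -
    have "walks V E (Suc j) (f i) = (\<Sum>x\<in>f ` {b. b < k \<and> (i, b) \<in> R}. walks V E j x) +
        (\<Sum>x\<in>{x \<in> V - f ` {..<k}. g x = i}. walks V E j x)"
      unfolding walks.simps modelled_adj_core[OF M that] by (rule sum.union_disjoint) (use fin in auto)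
    also have "(\<Sum>x\<in>f ` {b. b < k \<and> (i, b) \<in> R}. walks V E j x) = (\<Sum>b\<in>{b. b < k \<and> (i, b) \<in> R}. walks V E j (f b))"
      by (rule sum.reindex_cong[of f]) (use inj in \<open>auto simp: inj_on_def\<close>)
    finally show ?thesis by (simp only: sum_list_upt_filter)
  qed
  have leaf: "walks V E (Suc j) x = walks V E j (f (g x))" if "x \<in> V - f ` {..<k}" for x j
    unfolding walks.simps modelled_adj_leaf[OF M that] by simp
  \<comment> \<open>Two consecutive lengths are carried along because the recursion looks back two
    steps.\<close>
  have core: "(\<forall>i<k. walks V E j (f i) = core_walks k R l j i) \<and> (\<forall>i<k. walks V E (Suc j) (f i) = core_walks k R
      l (Suc j) i)" for j
  proof (induction j)
    case 0
    have "walks V E (Suc 0) (f i) = core_walks k R l (Suc 0) i" if "i < k" for i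
      unfolding step[OF that] using l[OF that] by (simp cong: if_cong)
    then show ?case by simp
  next
    case (Suc j)
    have "walks V E (Suc (Suc j)) (f i) = core_walks k R l (Suc (Suc j)) i" if "i < k" for i
    proof -
      have "(\<Sum>x\<in>{x \<in> V - f ` {..<k}. g x = i}. walks V E (Suc j) x) =
          (\<Sum>x\<in>{x \<in> V - f ` {..<k}. g x = i}. walks V E j (f i))"
        by (rule sum.cong) (auto simp: leaf simp del: walks.simps)
      also have "\<dots> = l i * core_walks k R l j i" using l[OF that] Suc that by simp
      moreover have "(\<Sum>b\<leftarrow>[0..<k]. if (i, b) \<in> R then walks V E (Suc j) (f b) else 0) =
          (\<Sum>b\<leftarrow>[0..<k]. if (i, b) \<in> R then core_walks k R l (Suc j) b else 0)"
        using Suc by (intro arg_cong[of _ _ sum_list] map_cong) auto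
      ultimately show ?thesis unfolding step[OF that] by simp
    qed
    then show ?case using Suc by blast
  qed
  show "walks V E j (f i) = core_walks k R l j i" if "i < k" for i using core that by blast
  show "walks V E j x = leaf_walks k R l j (g x)" if "x \<in> V - f ` {..<k}" for x
  proof (cases j)
    case (Suc j')
    have "g x < k" using gk that by auto
    then show ?thesis using core leaf[OF that] Suc by (simp add: leaf_walks_def del: walks.simps)
  qed (simp add: leaf_walks_def)
qed

definition walk_count :: "nat \<Rightarrow> nat rel \<Rightarrow> (nat \<Rightarrow> nat) \<Rightarrow> nat \<Rightarrow> nat \<Rightarrow> nat" where
  "walk_count k R l i j = (\<Sum>b\<leftarrow>[0..<k]. core_walks k R l i b * core_walks k R l j b) +
     (\<Sum>b\<leftarrow>[0..<k]. l b * (leaf_walks k R l i b * leaf_walks k R l j b))"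

lemma model_sum_walks:
  assumes "model V E k R l"
  shows "(\<Sum>v\<in>V. walks V E (i + j) v) = walk_count k R l i j"
proof -
  obtain f g where M: "modelled V E k R l f g" using assms by (auto simp: model_def)
  let ?C = "f ` {..<k}" and ?h = "\<lambda>v. walks V E i v * walks V E j v"
  have fin: "finite V" and fV: "?C \<subseteq> V" and gk: "g ` (V - ?C) \<subseteq> {..<k}" and inj: "inj_on f {..<k}"
    and l: "\<And>i. i < k \<Longrightarrow> card {x \<in> V - ?C. g x = i} = l i" and R: "sym R"
    and E: "E = (\<lambda>(i, j). (f i, f j)) ` R \<union> (\<lambda>x. (x, f (g x))) ` (V - ?C) \<union> (\<lambda>x. (f (g x), x)) ` (V - ?C)"
    using M by (auto simp: modelled_def)
  have "sym E" unfolding E using R by (force simp: sym_def)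
  then have "(\<Sum>v\<in>V. walks V E (i + j) v) = sum ?h V" using fin by (rule sum_walks_add[rotated])
  also have "\<dots> = sum ?h (V - ?C) + sum ?h ?C" using fin fV by (rule sum.subset_diff[rotated])
  also have "sum ?h ?C = (\<Sum>b<k. core_walks k R l i b * core_walks k R l j b)"
    by (rule sum.reindex_cong[OF inj refl]) (simp add: modelled_walks(1)[OF M])
  also have "sum ?h (V - ?C) = (\<Sum>x\<in>V - ?C. leaf_walks k R l i (g x) * leaf_walks k R l j (g x))"
    by (intro sum.cong refl) (simp add: modelled_walks(2)[OF M])
  also have "\<dots> = (\<Sum>b<k. \<Sum>x\<in>{x \<in> V - ?C. g x = b}. leaf_walks k R l i (g x) * leaf_walks k R l j (g x))"
    by (rule sum.group[symmetric]) (use fin gk in auto)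
  also have "\<dots> = (\<Sum>b<k. l b * (leaf_walks k R l i b * leaf_walks k R l j b))"
    using l by (intro sum.cong refl) simp
  finally show ?thesis
    by (simp only: walk_count_def interv_sum_list_conv_sum_set_nat set_upt atLeast0LessThan add.commute)
qed

section \<open>The characteristic polynomial of a core with leaves\<close>

text \<open>An entry of \<open>x (x I - A) - B B^T\<close>, where \<open>A\<close> is the adjacency
  block of the cover vertices \<open>0, ..., c - 1\<close> and \<open>B\<close> their adjacency to
  all other vertices. The product \<open>B B^T\<close> counts common neighbours outside the cover:
  leaves, on the diagonal only, and connectors \<open>c, ..., k - 1\<close>.\<close>

definition schur_entry :: "nat \<Rightarrow> nat \<Rightarrow> nat rel \<Rightarrow> (nat \<Rightarrow> nat) \<Rightarrow> real \<Rightarrow> nat \<Rightarrow> nat \<Rightarrow> real" where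
  "schur_entry c k R l x i j = (if i = j then x\<^sup>2 - real (l i) else 0) - (if (i, j) \<in> R then x else 0)
     - (\<Sum>q\<leftarrow>[c..<k]. if (i, q) \<in> R \<and> (j, q) \<in> R then 1 else 0)"

text \<open>By the hypotheses, core vertices from \<open>c\<close> on carry no leaves and are not
  joined to each other, so every edge meets one of the first \<open>c\<close> core vertices. With
  these in front, the remaining diagonal block is \<open>x I\<close>, and
  \<open>det_four_block_scalar\<close> reduces the determinant to size \<open>c\<close>.\<close>

lemma modelled_char_poly:
  fixes T :: "'a pair_pre_digraph"
  assumes M: "modelled (pverts T) (parcs T) k R l f g" and c: "c \<le> k"
    and l0: "\<And>i. c \<le> i \<Longrightarrow> i < k \<Longrightarrow> l i = 0"
    and R0: "\<And>i j. c \<le> i \<Longrightarrow> c \<le> j \<Longrightarrow> (i, j) \<notin> R" and irr: "\<And>i. (i, i) \<notin> R" and x: "x \<noteq> 0"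
  shows "x ^ c * poly (char_poly (adjacency_matrix T)) x =
    x ^ (card (pverts T) - c) * det (mat c c (\<lambda>(i, j). schur_entry c k R l x i j))"
proof -
  define V where "V = pverts T"
  define E where "E = parcs T"
  define n where "n = card V"
  define e where "e = from_nat_into V"
  define m where "m = n - c"
  have M: "modelled V E k R l f g" using M by (simp add: V_def E_def)
  have fin: "finite V" and R: "R \<subseteq> {..<k} \<times> {..<k}" and sym: "sym R" and fV: "f ` {..<k} \<subseteq> V"
    and gk: "g ` (V - f ` {..<k}) \<subseteq> {..<k}" and inj: "inj_on f {..<k}"
    and E: "E = (\<lambda>(i, j). (f i, f j)) ` R \<union> (\<lambda>x. (x, f (g x))) ` (V - f ` {..<k}) \<union> (\<lambda>x. (f (g x), x)) ` (V - f `
        {..<k})"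
    and l: "\<And>i. i < k \<Longrightarrow> card {x \<in> V - f ` {..<k}. g x = i} = l i"
    using M by (auto simp: modelled_def)
  let ?U = "V - f ` {..<c}"
  have symE: "(u, v) \<in> E \<longleftrightarrow> (v, u) \<in> E" for u v
    unfolding E using sym by (force simp: sym_def)
  have injf: "f i = f j \<longleftrightarrow> i = j" if "i < k" "j < k" for i j using inj that by (auto simp: inj_on_def)
  \<comment> \<open>Leaves hang at cover vertices, since the other core vertices have leaf count
    0.\<close>
  have leaf: "g y < c" if "y \<in> V - f ` {..<k}" for y
  proof (rule ccontr)
    assume "\<not> g y < c"
    moreover have "g y < k" using gk that by auto
    ultimately have "card {z \<in> V - f ` {..<k}. g z = g y} = 0" using l l0 by simp
    moreover have "finite {z \<in> V - f ` {..<k}. g z = g y}" using fin by simp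
    ultimately show False using that by auto
  qed
  have indep: "(u, v) \<notin> E" if "u \<in> ?U" "v \<in> ?U" for u v
  proof
    assume "(u, v) \<in> E"
    then consider i j where "(i, j) \<in> R" "u = f i" "v = f j" | y where "y \<in> V - f ` {..<k}" "f (g y) = u \<or> f (g y) = v"
      unfolding E by auto
    then show False
    proof cases
      case 1
      then have "c \<le> i" "c \<le> j" using that by (auto simp: not_less[symmetric])
      then show False using R0 1 by blast
    next
      case 2
      then show False using leaf[OF 2(1)] that by auto
    qed
  qed
  define F where "F u v = (if u = v then x else 0) - (if (u, v) \<in> E then 1 else 0 :: real)" for u v
  have e: "bij_betw e {..<n} V"
    unfolding e_def n_def using fin by (simp add: bij_betw_from_nat_into_finite)
  have einj: "e i = e j \<longleftrightarrow> i = j" if "i < n" "j < n" for i j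
    using e that by (auto simp: bij_betw_def inj_on_def)
  have "f ` {..<c} \<subseteq> V" using fV c by auto
  moreover have "card (f ` {..<c}) = c" using inj c by (simp add: card_image inj_on_def)
  ultimately have cn: "c \<le> n" "card ?U = m" unfolding n_def m_def using fin
    by (metis card_mono, simp add: card_Diff_subset finite_subset)
  obtain b where b: "bij_betw b {c..<n} ?U"
    using finite_same_card_bij[of "{c..<n}" ?U] fin cn by (auto simp: m_def)
  \<comment> \<open>A vertex order with the cover in front; \<open>det_reindex\<close> exchanges it
    for the order \<open>e\<close> of the adjacency matrix.\<close>
  define h where "h i = (if i < c then f i else b i)" for i
  have "bij_betw h {..<c} (f ` {..<c})"
    using inj c by (auto simp: bij_betw_def inj_on_def h_def)
  moreover have hb: "bij_betw h {c..<n} ?U"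
    using b by (rule bij_betw_cong[THEN iffD1, rotated]) (simp add: h_def)
  ultimately have "bij_betw h ({..<c} \<union> {c..<n}) (f ` {..<c} \<union> ?U)"
    by (rule bij_betw_combine) auto
  moreover have "{..<c} \<union> {c..<n} = {..<n}" using cn by auto
  moreover have "f ` {..<c} \<union> ?U = V" using fV c by auto
  ultimately have h: "bij_betw h {..<n} V" by simp
  have hinj: "h i = h j \<longleftrightarrow> i = j" if "i < n" "j < n" for i j
    using h that by (auto simp: bij_betw_def inj_on_def)
  have hU: "h i \<in> ?U" if "c \<le> i" "i < n" for i using bij_betwE[OF hb] that by simp
  have A: "adjacency_matrix T = mat n n (\<lambda>(i, j). if (e i, e j) \<in> E then 1 else 0)"
    by (simp add: adjacency_matrix_def n_def e_def V_def E_def)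
  have "poly (char_poly (adjacency_matrix T)) x =
      det (mat n n (\<lambda>(i, j). (if i = j then x else 0) - adjacency_matrix T $$ (i, j)))"
    by (rule poly_char_poly) (simp add: A)
  also have "mat n n (\<lambda>(i, j). (if i = j then x else 0) - adjacency_matrix T $$ (i, j)) =
      mat n n (\<lambda>(i, j). F (e i) (e j))"
    by (rule cong_mat) (auto simp: A F_def einj)
  also have "det (mat n n (\<lambda>(i, j). F (e i) (e j))) = det (mat n n (\<lambda>(i, j). F (h i) (h j)))"
    by (rule det_reindex[OF e h])
  also have "mat n n (\<lambda>(i, j). F (h i) (h j)) = four_block_mat (mat c c (\<lambda>(i, j). F (f i) (f j)))
      (mat c m (\<lambda>(i, j). F (f i) (h (c + j)))) (mat m c (\<lambda>(i, j). F (h (c + i)) (f j))) (x \<cdot>\<^sub>m 1\<^sub>m m)"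
    (is "_ = four_block_mat ?A ?B ?C _")
  proof (rule eq_matI)
    fix i j assume "i < dim_row (four_block_mat ?A ?B ?C (x \<cdot>\<^sub>m 1\<^sub>m m))"
        "j < dim_col (four_block_mat ?A ?B ?C (x \<cdot>\<^sub>m 1\<^sub>m m))"
    then have ij: "i < n" "j < n" using cn by (simp_all add: m_def)
    have "F (h i) (h j) = (if i = j then x else 0)" if "c \<le> i" "c \<le> j"
      using indep[OF hU[OF that(1) ij(1)] hU[OF that(2) ij(2)]] hinj[OF ij] by (simp add: F_def)
    then show "mat n n (\<lambda>(i, j). F (h i) (h j)) $$ (i, j) = four_block_mat ?A ?B ?C (x \<cdot>\<^sub>m 1\<^sub>m m) $$ (i, j)"
      using ij cn by (auto simp: m_def h_def not_less)
  qed (use cn in \<open>auto simp: m_def\<close>)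
  finally have "x ^ c * poly (char_poly (adjacency_matrix T)) x = x ^ m * det (x \<cdot>\<^sub>m ?A - ?B * ?C)"
    using det_four_block_scalar[of ?A c ?B m x ?C] x by simp
  also have "x \<cdot>\<^sub>m ?A - ?B * ?C = mat c c (\<lambda>(i, j). schur_entry c k R l x i j)"
  proof (rule eq_matI)
    fix i j assume "i < dim_row (mat c c (\<lambda>(i, j). schur_entry c k R l x i j))"
      "j < dim_col (mat c c (\<lambda>(i, j). schur_entry c k R l x i j))"
    then have ij: "i < c" "j < c" by simp_all
    then have ijk: "i < k" "j < k" using c by auto
    have off: "F (f a) (h (c + q)) = - (if (f a, h (c + q)) \<in> E then 1 else 0)"
      "F (h (c + q)) (f a) = - (if (f a, h (c + q)) \<in> E then 1 else 0)" if "a < c" "q < m" for a q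
    proof -
      have "c + q < n" using that by (simp add: m_def)
      then have "h (c + q) \<noteq> f a" using hU[of "c + q"] that by auto
      then show "F (f a) (h (c + q)) = - (if (f a, h (c + q)) \<in> E then 1 else 0)"
        "F (h (c + q)) (f a) = - (if (f a, h (c + q)) \<in> E then 1 else 0)"
        by (auto simp: F_def symE)
    qed
    let ?P = "\<lambda>u. (f i, u) \<in> E \<and> (f j, u) \<in> E"
    \<comment> \<open>The two minus signs cancel, so this entry counts the common neighbours of
      \<open>f i\<close> and \<open>f j\<close> outside the cover.\<close>
    have "(?B * ?C) $$ (i, j) = (\<Sum>q<m. F (f i) (h (c + q)) * F (h (c + q)) (f j))"
      using ij by (simp add: scalar_prod_def atLeast0LessThan)
    also have "\<dots> = (\<Sum>q<m. if ?P (h (c + q)) then 1 else 0)"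
      using ij by (intro sum.cong refl) (simp add: off)
    also have "\<dots> = (\<Sum>q\<in>{c..<n}. if ?P (h q) then 1 else 0)"
      by (rule sum.reindex_bij_witness[of _ "\<lambda>q. q - c" "\<lambda>q. c + q"]) (auto simp: m_def)
    also have "\<dots> = (\<Sum>u\<in>?U. if ?P u then 1 else 0)"
      by (rule sum.reindex_bij_betw[OF hb])
    also have "\<dots> = real (card {u \<in> ?U. ?P u})" using fin by (simp add: sum.If_cases Int_def)
    also have "{u \<in> ?U. ?P u} = ({u \<in> V. (f i, u) \<in> E} \<inter> {u \<in> V. (f j, u) \<in> E}) - f ` {..<c}" by auto
    also have "\<dots> = f ` {q. c \<le> q \<and> q < k \<and> (i, q) \<in> R \<and> (j, q) \<in> R} \<union>
        (if i = j then {y \<in> V - f ` {..<k}. g y = i} else {})" (is "_ = f ` ?Q \<union> ?L")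
    proof -
      have "f ` {b. b < k \<and> (i, b) \<in> R} \<inter> f ` {b. b < k \<and> (j, b) \<in> R} - f ` {..<c} = f ` ?Q"
        using c by (auto simp: injf image_iff not_less[symmetric])
      moreover have "f ` {..<c} \<subseteq> f ` {..<k}" using c by auto
      ultimately show ?thesis unfolding modelled_adj_core[OF M ijk(1)] modelled_adj_core[OF M ijk(2)] by auto
    qed
    also have "card (f ` ?Q \<union> ?L) = card (f ` ?Q) + card ?L"
      by (rule card_Un_disjoint) (use fin in auto)
    also have "card (f ` ?Q) = card ?Q" by (rule card_image) (use inj in \<open>auto simp: inj_on_def\<close>)
    also have "card ?L = (if i = j then l i else 0)" using l ijk by simp
    also have "real (card ?Q + (if i = j then l i else 0)) =
        (\<Sum>q\<leftarrow>[c..<k]. if (i, q) \<in> R \<and> (j, q) \<in> R then 1 else 0) + (if i = j then real (l i) else 0)"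
    proof -
      have "{q \<in> {c..<k}. (i, q) \<in> R \<and> (j, q) \<in> R} = ?Q" by auto
      then have "(\<Sum>q\<in>{c..<k}. if (i, q) \<in> R \<and> (j, q) \<in> R then 1 else 0 :: real) = real (card ?Q)"
        by (simp add: sum.If_cases Int_def)
      then show ?thesis by (simp add: interv_sum_list_conv_sum_set_nat)
    qed
    finally have BC: "(?B * ?C) $$ (i, j) = (\<Sum>q\<leftarrow>[c..<k]. if (i, q) \<in> R \<and> (j, q) \<in> R then 1 else 0) +
        (if i = j then real (l i) else 0)" .
    have "(f i, f j) \<in> E \<longleftrightarrow> (i, j) \<in> R"
    proof -
      have "f j \<in> {u \<in> V. (f i, u) \<in> E} \<longleftrightarrow> (i, j) \<in> R"
        unfolding modelled_adj_core[OF M ijk(1)] using ijk by (auto simp: injf)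
      then show ?thesis using fV ijk by auto
    qed
    then have "x * F (f i) (f j) = (if i = j then x\<^sup>2 else 0) - (if (i, j) \<in> R then x else 0)"
      using irr by (auto simp: F_def injf ijk power2_eq_square)
    then show "(x \<cdot>\<^sub>m ?A - ?B * ?C) $$ (i, j) = mat c c (\<lambda>(i, j). schur_entry c k R l x i j) $$ (i, j)"
      using ij BC by (simp add: schur_entry_def)
  qed auto
  finally show ?thesis by (simp add: m_def n_def V_def)
qed

text \<open>Laplace expansion in a form that rewriting can iterate: the minors are again given by a
  function, and the sum runs over an explicit list.\<close>

lemma det_expand:
  fixes F :: "nat \<Rightarrow> nat \<Rightarrow> 'b :: comm_ring_1"
  shows "det (mat (Suc n) (Suc n) (\<lambda>(i, j). F i j)) =
    (\<Sum>j\<leftarrow>[0..<Suc n]. (- 1) ^ j * F 0 j * det (mat n n (\<lambda>(i, b). F (Suc i) (if b < j then b else Suc b))))"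
proof -
  let ?A = "mat (Suc n) (Suc n) (\<lambda>(i, j). F i j)"
  have "det ?A = (\<Sum>j<Suc n. ?A $$ (0, j) * cofactor ?A 0 j)"
    by (rule laplace_expansion_row[of _ "Suc n"]) auto
  also have "\<dots> = (\<Sum>j<Suc n. (- 1) ^ j * F 0 j * det (mat n n (\<lambda>(i, b). F (Suc i) (if b < j then b else Suc b))))"
  proof (intro sum.cong refl)
    fix j assume j: "j \<in> {..<Suc n}"
    have "mat_delete ?A 0 j = mat n n (\<lambda>(i, b). F (Suc i) (if b < j then b else Suc b))"
      unfolding mat_delete_def by (rule eq_matI) auto
    then show "?A $$ (0, j) * cofactor ?A 0 j =
        (- 1) ^ j * F 0 j * det (mat n n (\<lambda>(i, b). F (Suc i) (if b < j then b else Suc b)))"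
      using j by (simp add: cofactor_def)
  qed
  finally show ?thesis by (simp only: interv_sum_list_conv_sum_set_nat set_upt atLeast0LessThan)
qed

lemma det_0: "det (mat 0 0 F) = (1 :: 'b :: comm_ring_1)"
  by (rule det_dim_zero) simp

section \<open>Shapes and their invariants\<close>

definition sc :: "(nat \<times> nat) list \<Rightarrow> nat rel" where "sc es = set es \<union> (set es)\<inverse>"

text \<open>The default 0 makes connectors leafless: either they lie beyond the list of four
  entries, or, with fewer than four cover vertices, \<open>valid\<close> sets their entry to
  0.\<close>

definition lv :: "nat list \<Rightarrow> nat \<Rightarrow> nat" where "lv p i = (if i < length p then p ! i else 0)"

declare core_walks.simps [simp del]

text \<open>Length 4 is enough by \<open>sum_walks_add\<close>. Each equation refers to shorter
  walks as closed terms, so their computed values can be inserted before going on, instead of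
  unfolding the whole recursion.\<close>

lemma core_walks_numeral:
  "core_walks k R l 0 i = 1"
  "core_walks k R l (Suc 0) i = (\<Sum>b\<leftarrow>[0..<k]. if (i, b) \<in> R then 1 else 0) + l i"
  "core_walks k R l 2 i = (\<Sum>b\<leftarrow>[0..<k]. if (i, b) \<in> R then core_walks k R l (Suc 0) b else 0) + l i"
  "core_walks k R l 3 i = (\<Sum>b\<leftarrow>[0..<k]. if (i, b) \<in> R then core_walks k R l 2 b else 0) + l i * core_walks k R l
      (Suc 0) i"
  "core_walks k R l 4 i = (\<Sum>b\<leftarrow>[0..<k]. if (i, b) \<in> R then core_walks k R l 3 b else 0) + l i * core_walks k R l 2 i"
  by (simp_all add: core_walks.simps eval_nat_numeral cong: if_cong)

lemma leaf_walks_numeral: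
  "leaf_walks k R l 0 i = 1" "leaf_walks k R l (Suc 0) i = 1" "leaf_walks k R l 2 i = core_walks k R l (Suc 0) i"
  "leaf_walks k R l 3 i = core_walks k R l 2 i" "leaf_walks k R l 4 i = core_walks k R l 3 i"
  by (simp_all add: leaf_walks_def eval_nat_numeral core_walks.simps)

lemma sc_Nil: "(i, j) \<in> sc [] \<longleftrightarrow> False"
  and sc_Cons: "(i, j) \<in> sc ((a, b) # es) \<longleftrightarrow> (i = a \<and> j = b) \<or> (i = b \<and> j = a) \<or> (i, j) \<in> sc es"
  by (auto simp: sc_def)

lemma lv_simps: "lv [] i = 0" "lv (x # p) 0 = x" "lv (x # p) (Suc i) = lv p i"
   "lv (x # p) (numeral n) = lv p (pred_numeral n)"
  by (auto simp: lv_def numeral_eq_Suc)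

type_synonym invariant_tuple = "nat \<times> nat \<times> nat \<times> nat \<times> nat \<times> nat \<times> nat \<times> nat \<times> nat \<times> nat"

text \<open>
  If \<open>m\<^sub>i\<close> counts the matchings of size \<open>i\<close>, the spectrum determines the \<open>m\<^sub>i\<close>, and together with the total walk
  numbers \<open>W\<^sub>j\<close> it determines \<open>g\<^sub>e = (\<Sum>i. (-1)\<^sup>i m\<^sub>i W\<^sub>k)\<close> with \<open>k = 8 - 2i - e\<close>. For trees with matching number at most
  four these are polynomials of low degree in the leaf counts. The components \<open>h\<^sub>e = - g\<^sub>e\<close> make all coefficients
  nonnegative, and \<open>W i j\<close> below is \<open>W\<^sub>i\<^sub>+\<^sub>j\<close>.
\<close>

fun walk_data :: "nat \<Rightarrow> nat rel \<Rightarrow> (nat \<Rightarrow> nat) \<Rightarrow> invariant_tuple \<Rightarrow> bool" where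
  "walk_data k R l (n, m2, m3, m4, g0, h1, h2, g3, g4, h5) \<longleftrightarrow> (let W = \<lambda>i j. int (walk_count k R l i j) in
     int n = W 0 0 \<and>
     int g0 = W 4 4 - (int n - 1) * W 3 3 + int m2 * W 2 2 - int m3 * W (Suc 0) (Suc 0) + int m4 * W 0 0 \<and>
     - int h1 = W 3 4 - (int n - 1) * W 2 3 + int m2 * W (Suc 0) 2 - int m3 * W 0 (Suc 0) \<and>
     - int h2 = W 3 3 - (int n - 1) * W 2 2 + int m2 * W (Suc 0) (Suc 0) - int m3 * W 0 0 \<and>
     int g3 = W 2 3 - (int n - 1) * W (Suc 0) 2 + int m2 * W 0 (Suc 0) \<and>
     int g4 = W 2 2 - (int n - 1) * W (Suc 0) (Suc 0) + int m2 * W 0 0 \<and>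
     - int h5 = W (Suc 0) 2 - (int n - 1) * W 0 (Suc 0))"

text \<open>The characteristic polynomial of a forest is its matching polynomial; hence the
  alternating signs, and the edge number \<open>n - 1\<close> as the coefficient at
  \<open>x ^ 6\<close>. The factor \<open>x ^ (8 - 2 * c)\<close> lifts all cover sizes to degree 8,
  which makes the coefficients of different shapes comparable.\<close>

fun matching_data :: "nat \<Rightarrow> nat \<Rightarrow> nat rel \<Rightarrow> (nat \<Rightarrow> nat) \<Rightarrow> invariant_tuple \<Rightarrow> bool" where
  "matching_data c k R l (n, m2, m3, m4, _) \<longleftrightarrow> (\<forall>x. x ^ (8 - 2 * c) * det (mat c c (\<lambda>(i, j). schur_entry c k R l x
      i j)) =
     x ^ 8 - (real n - 1) * x ^ 6 + real m2 * x ^ 4 - real m3 * x\<^sup>2 + real m4)"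

lemmas of_nat_push = of_nat_add of_nat_mult of_nat_power of_nat_numeral of_nat_1 of_nat_0

text \<open>
  A shape is a tree of cover vertices \<open>a, b, c, d\<close>, each carrying a number of leaves, possibly zero. In the names,
  \<open>d\<close> is an edge between two cover vertices and \<open>c\<close> is a path of length two through a connector,
  a core vertex without leaves.
  \<open>P\<close> is a path \<open>a - b - c - d\<close>, \<open>S\<close> a star with centre \<open>a\<close>, \<open>Tri\<close> a connector adjacent to
  \<open>a, b, c\<close>, \<open>Td\<close> and \<open>Tc\<close> attach \<open>d\<close> to the vertex \<open>a\<close> of \<open>Tri\<close>, and \<open>Q\<close> is a connector adjacent to all
  four cover vertices.
\<close>

datatype shape = Star | Pd | Pc | Pdd | Pdc | Pcc | Tri | Pddd | Pddc | Pdcd | Pcdc | Pdcc | Pccc | Sddd | Sddc |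
    Sdcc | Sccc | Td | Tc | Q

fun cover_size :: "shape \<Rightarrow> nat" where
"cover_size Star = 1"
| "cover_size Pd = 2"
| "cover_size Pc = 2"
| "cover_size Pdd = 3"
| "cover_size Pdc = 3"
| "cover_size Pcc = 3"
| "cover_size Tri = 3"
| "cover_size Pddd = 4"
| "cover_size Pddc = 4"
| "cover_size Pdcd = 4"
| "cover_size Pcdc = 4"
| "cover_size Pdcc = 4"
| "cover_size Pccc = 4"
| "cover_size Sddd = 4"
| "cover_size Sddc = 4"
| "cover_size Sdcc = 4"
| "cover_size Sccc = 4"
| "cover_size Td = 4"
| "cover_size Tc = 4"
| "cover_size Q = 4"

fun core_size :: "shape \<Rightarrow> nat" where
"core_size Star = 1"
| "core_size Pd = 2"
| "core_size Pc = 3"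
| "core_size Pdd = 3"
| "core_size Pdc = 4"
| "core_size Pcc = 5"
| "core_size Tri = 4"
| "core_size Pddd = 4"
| "core_size Pddc = 5"
| "core_size Pdcd = 5"
| "core_size Pcdc = 6"
| "core_size Pdcc = 6"
| "core_size Pccc = 7"
| "core_size Sddd = 4"
| "core_size Sddc = 5"
| "core_size Sdcc = 6"
| "core_size Sccc = 7"
| "core_size Td = 5"
| "core_size Tc = 6"
| "core_size Q = 5"

fun core_edges :: "shape \<Rightarrow> (nat \<times> nat) list" where
"core_edges Star = []"
| "core_edges Pd = [(0, 1)]"
| "core_edges Pc = [(0, 2), (1, 2)]"
| "core_edges Pdd = [(0, 1), (1, 2)]"
| "core_edges Pdc = [(0, 1), (1, 3), (2, 3)]"
| "core_edges Pcc = [(0, 3), (1, 3), (1, 4), (2, 4)]"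
| "core_edges Tri = [(0, 3), (1, 3), (2, 3)]"
| "core_edges Pddd = [(0, 1), (1, 2), (2, 3)]"
| "core_edges Pddc = [(0, 1), (1, 2), (2, 4), (3, 4)]"
| "core_edges Pdcd = [(0, 1), (2, 3), (1, 4), (2, 4)]"
| "core_edges Pcdc = [(1, 2), (0, 4), (1, 4), (2, 5), (3, 5)]"
| "core_edges Pdcc = [(0, 1), (1, 4), (2, 4), (2, 5), (3, 5)]"
| "core_edges Pccc = [(0, 4), (1, 4), (1, 5), (2, 5), (2, 6), (3, 6)]"
| "core_edges Sddd = [(0, 1), (0, 2), (0, 3)]"
| "core_edges Sddc = [(0, 1), (0, 2), (0, 4), (3, 4)]"
| "core_edges Sdcc = [(0, 1), (0, 4), (2, 4), (0, 5), (3, 5)]"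
| "core_edges Sccc = [(0, 4), (1, 4), (0, 5), (2, 5), (0, 6), (3, 6)]"
| "core_edges Td = [(0, 3), (0, 4), (1, 4), (2, 4)]"
| "core_edges Tc = [(0, 4), (1, 4), (2, 4), (0, 5), (3, 5)]"
| "core_edges Q = [(0, 4), (1, 4), (2, 4), (3, 4)]"

text \<open>The components are \<open>n, m2, m3, m4, g0, h1, h2, g3, g4, h5\<close>, expanded in the
  leaf counts and certified below by \<open>walk_data\<close> and \<open>matching_data\<close>. With
  \<open>c\<close> cover vertices the numerator of the walk generating function has degree at most
  \<open>2 * c\<close>, so the components of index below \<open>8 - 2 * c\<close> among the last six
  vanish, as do the matching numbers beyond \<open>c\<close>.\<close>

fun invariants :: "shape \<Rightarrow> nat \<Rightarrow> nat \<Rightarrow> nat \<Rightarrow> nat \<Rightarrow> invariant_tuple" where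
"invariants Star a b c d =
    (a + 1, 0, 0, 0, 0, 0, 0, 0, 0, 0)"
| "invariants Pd a b c d =
    (a + b + 2, a*b, 0, 0, 0, 0, 0, 0, 0, 2*a*b)"
| "invariants Pc a b c d =
    (a + b + 3, a*b + a + b, 0, 0, 0, 0, 0, 0, a*b, 4*a*b + 2*a + 2*b)"
| "invariants Pdd a b c d =
    (a + b + c + 3, a*b + a*c + b*c + a + c, a*b*c, 0, 0, 0, 0, 2*a*b*c, 3*a*b*c + a*c, 2*a*b + 4*a*c + 2*b*c +
        2*a + 2*c)"
| "invariants Pdc a b c d =
    (a + b + c + 4, a*b + a*c + b*c + 2*a + b + 2*c + 1, a*b*c + a*b + a*c, 0, 0, 0, a*b*c, 4*a*b*c + 2*a*b +
        4*a*c, 3*a*b*c + 3*a*b + 2*a*c + b*c + a + c, 2*a*b + 4*a*c + 4*b*c + 6*a + 2*b + 6*c + 2)"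
| "invariants Pcc a b c d =
    (a + b + c + 5, a*b + a*c + b*c + 3*a + 2*b + 3*c + 3, a*b*c + a*b + 2*a*c + b*c + a + b + c, 0, 0, 0,
        2*a*b*c + a*b + b*c, 6*a*b*c + 4*a*b + 8*a*c + 4*b*c + 4*a + 2*b + 4*c, 3*a*b*c + 4*a*b + 5*a*c + 4*b*c +
        3*a + 3*b + 3*c + 1, 4*a*b + 4*a*c + 4*b*c + 10*a + 4*b + 10*c + 8)"
| "invariants Tri a b c d =
    (a + b + c + 4, a*b + a*c + b*c + 2*a + 2*b + 2*c, a*b*c + a*b + a*c + b*c, 0, 0, 0, 4*a*b*c, 6*a*b*c + 2*a*b
        + 2*a*c + 2*b*c, 3*a*b*c + 4*a*b + 4*a*c + 4*b*c, 4*a*b + 4*a*c + 4*b*c + 4*a + 4*b + 4*c)"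
| "invariants Pddd a b c d =
    (a + b + c + d + 4, a*b + a*c + a*d + b*c + b*d + c*d + 2*a + b + c + 2*d + 1, a*b*c + a*b*d + a*c*d + b*c*d
        + a*b + a*d + c*d, a*b*c*d, 0, 2*a*b*c*d, 4*a*b*c*d + a*b*d + a*c*d, 2*a*b*c + 4*a*b*d + 4*a*c*d +
        2*b*c*d + 2*a*b + 4*a*d + 2*c*d, 3*a*b*c + 3*a*b*d + 3*a*c*d + 3*b*c*d + 3*a*b + a*c + 2*a*d + b*d +
        3*c*d + a + d, 2*a*b + 4*a*c + 4*a*d + 2*b*c + 4*b*d + 2*c*d + 6*a + 2*b + 2*c + 6*d + 2)"
| "invariants Pddc a b c d =
    (a + b + c + d + 5, a*b + a*c + a*d + b*c + b*d + c*d + 3*a + 2*b + 2*c + 3*d + 3, a*b*c + a*b*d + a*c*d +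
        b*c*d + 2*a*b + a*c + 2*a*d + b*c + b*d + c*d + a + c + d, a*b*c*d + a*b*c + a*b*d, a*b*c*d, 4*a*b*c*d +
        2*a*b*c + 4*a*b*d, 4*a*b*c*d + 4*a*b*c + 3*a*b*d + 2*a*c*d + b*c*d + a*b + a*c + c*d, 2*a*b*c + 4*a*b*d +
        6*a*c*d + 4*b*c*d + 6*a*b + 4*a*c + 8*a*d + 2*b*c + 4*b*d + 4*c*d + 4*a + 2*c + 4*d, 3*a*b*c + 3*a*b*d +
        3*a*c*d + 3*b*c*d + 6*a*b + 4*a*c + 5*a*d + 3*b*c + 2*b*d + 4*c*d + 3*a + b + 3*c + 3*d + 1, 2*a*b +
        4*a*c + 4*a*d + 2*b*c + 4*b*d + 4*c*d + 10*a + 6*b + 4*c + 10*d + 8)"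
| "invariants Pdcd a b c d =
    (a + b + c + d + 5, a*b + a*c + a*d + b*c + b*d + c*d + 3*a + 2*b + 2*c + 3*d + 3, a*b*c + a*b*d + a*c*d +
        b*c*d + 2*a*b + a*c + 2*a*d + b*d + 2*c*d + a + d, a*b*c*d + a*b*d + a*c*d, a*b*c*d, 4*a*b*c*d + 4*a*b*d
        + 4*a*c*d, 4*a*b*c*d + a*b*c + 3*a*b*d + 3*a*c*d + b*c*d + a*b + c*d, 4*a*b*c + 4*a*b*d + 4*a*c*d +
        4*b*c*d + 6*a*b + 4*a*c + 8*a*d + 4*b*d + 6*c*d + 4*a + 4*d, 3*a*b*c + 3*a*b*d + 3*a*c*d + 3*b*c*d +
        6*a*b + 2*a*c + 5*a*d + b*c + 2*b*d + 6*c*d + 3*a + b + c + 3*d + 1, 2*a*b + 4*a*c + 4*a*d + 4*b*c +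
        4*b*d + 2*c*d + 10*a + 6*b + 6*c + 10*d + 8)"
| "invariants Pcdc a b c d =
    (a + b + c + d + 6, a*b + a*c + a*d + b*c + b*d + c*d + 4*a + 3*b + 3*c + 4*d + 6, a*b*c + a*b*d + a*c*d +
        b*c*d + 2*a*b + 2*a*c + 3*a*d + 2*b*c + 2*b*d + 2*c*d + 3*a + 2*b + 2*c + 3*d + 1, a*b*c*d + a*b*c +
        a*b*d + a*c*d + b*c*d + a*c + a*d + b*c + b*d, 2*a*b*c*d + a*b*c + a*b*d + a*c*d + b*c*d, 6*a*b*c*d +
        4*a*b*c + 6*a*b*d + 6*a*c*d + 4*b*c*d + 4*a*c + 4*a*d + 2*b*c + 4*b*d, 4*a*b*c*d + 5*a*b*c + 4*a*b*d +
        4*a*c*d + 5*b*c*d + 3*a*b + 3*a*c + 4*a*d + 4*b*c + 3*b*d + 3*c*d + b + c, 4*a*b*c + 6*a*b*d + 6*a*c*d +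
        4*b*c*d + 10*a*b + 8*a*c + 14*a*d + 4*b*c + 8*b*d + 10*c*d + 12*a + 6*b + 6*c + 12*d + 4, 3*a*b*c +
        3*a*b*d + 3*a*c*d + 3*b*c*d + 7*a*b + 5*a*c + 8*a*d + 6*b*c + 5*b*d + 7*c*d + 8*a + 7*b + 7*c + 8*d + 4,
        4*a*b + 4*a*c + 4*a*d + 2*b*c + 4*b*d + 4*c*d + 14*a + 8*b + 8*c + 14*d + 18)"
| "invariants Pdcc a b c d =
    (a + b + c + d + 6, a*b + a*c + a*d + b*c + b*d + c*d + 4*a + 3*b + 3*c + 4*d + 6, a*b*c + a*b*d + a*c*d +
        b*c*d + 3*a*b + 2*a*c + 3*a*d + b*c + 2*b*d + 2*c*d + 3*a + b + 2*c + 3*d + 1, a*b*c*d + a*b*c + 2*a*b*d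
        + a*c*d + a*b + a*c + a*d, 2*a*b*c*d + a*b*c + a*c*d, 6*a*b*c*d + 4*a*b*c + 8*a*b*d + 6*a*c*d + 4*a*b +
        4*a*c + 4*a*d, 4*a*b*c*d + 5*a*b*c + 7*a*b*d + 4*a*c*d + 2*b*c*d + 4*a*b + 3*a*c + 4*a*d + b*c + 3*c*d +
        c, 4*a*b*c + 4*a*b*d + 6*a*c*d + 6*b*c*d + 10*a*b + 8*a*c + 14*a*d + 4*b*c + 8*b*d + 10*c*d + 12*a + 4*b
        + 6*c + 12*d + 4, 3*a*b*c + 3*a*b*d + 3*a*c*d + 3*b*c*d + 9*a*b + 5*a*c + 8*a*d + 4*b*c + 5*b*d + 7*c*d +
        8*a + 3*b + 7*c + 8*d + 4, 2*a*b + 4*a*c + 4*a*d + 4*b*c + 4*b*d + 4*c*d + 14*a + 10*b + 8*c + 14*d + 18)"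
| "invariants Pccc a b c d =
    (a + b + c + d + 7, a*b + a*c + a*d + b*c + b*d + c*d + 5*a + 4*b + 4*c + 5*d + 10, a*b*c + a*b*d + a*c*d +
        b*c*d + 3*a*b + 3*a*c + 4*a*d + 2*b*c + 3*b*d + 3*c*d + 6*a + 4*b + 4*c + 6*d + 4, a*b*c*d + a*b*c +
        2*a*b*d + 2*a*c*d + b*c*d + a*b + 2*a*c + 3*a*d + b*c + 2*b*d + c*d + a + b + c + d, 3*a*b*c*d + 2*a*b*c
        + 2*a*b*d + 2*a*c*d + 2*b*c*d + a*b + a*d + b*c + c*d, 8*a*b*c*d + 6*a*b*c + 12*a*b*d + 12*a*c*d +
        6*b*c*d + 6*a*b + 8*a*c + 16*a*d + 4*b*c + 8*b*d + 6*c*d + 4*a + 4*b + 4*c + 4*d, 4*a*b*c*d + 6*a*b*c +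
        8*a*b*d + 8*a*c*d + 6*b*c*d + 7*a*b + 7*a*c + 10*a*d + 6*b*c + 7*b*d + 7*c*d + 4*a + 4*b + 4*c + 4*d,
        6*a*b*c + 6*a*b*d + 6*a*c*d + 6*b*c*d + 16*a*b + 12*a*c + 20*a*d + 8*b*c + 12*b*d + 16*c*d + 26*a + 14*b
        + 14*c + 26*d + 16, 3*a*b*c + 3*a*b*d + 3*a*c*d + 3*b*c*d + 10*a*b + 8*a*c + 11*a*d + 7*b*c + 8*b*d +
        10*c*d + 16*a + 12*b + 12*c + 16*d + 12, 4*a*b + 4*a*c + 4*a*d + 4*b*c + 4*b*d + 4*c*d + 18*a + 12*b +
        12*c + 18*d + 32)"
| "invariants Sddd a b c d =
    (a + b + c + d + 4, a*b + a*c + a*d + b*c + b*d + c*d + 2*b + 2*c + 2*d, a*b*c + a*b*d + a*c*d + b*c*d + b*c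
        + b*d + c*d, a*b*c*d, 0, 2*a*b*c*d, 4*a*b*c*d + 4*b*c*d, 2*a*b*c + 2*a*b*d + 2*a*c*d + 6*b*c*d + 2*b*c +
        2*b*d + 2*c*d, 3*a*b*c + 3*a*b*d + 3*a*c*d + 3*b*c*d + 4*b*c + 4*b*d + 4*c*d, 2*a*b + 2*a*c + 2*a*d +
        4*b*c + 4*b*d + 4*c*d + 4*b + 4*c + 4*d)"
| "invariants Sddc a b c d =
    (a + b + c + d + 5, a*b + a*c + a*d + b*c + b*d + c*d + a + 3*b + 3*c + 3*d + 2, a*b*c + a*b*d + a*c*d +
        b*c*d + a*b + a*c + 2*b*c + 2*b*d + 2*c*d + b + c, a*b*c*d + a*b*c + b*c*d, a*b*c*d, 4*a*b*c*d + 2*a*b*c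
        + 6*b*c*d, 4*a*b*c*d + 4*a*b*c + a*b*d + a*c*d + 4*b*c*d + 4*b*c + b*d + c*d, 2*a*b*c + 4*a*b*d + 4*a*c*d
        + 6*b*c*d + 2*a*b + 2*a*c + 8*b*c + 8*b*d + 8*c*d + 2*b + 2*c, 3*a*b*c + 3*a*b*d + 3*a*c*d + 3*b*c*d +
        3*a*b + 3*a*c + a*d + 7*b*c + 5*b*d + 5*c*d + 4*b + 4*c + 2*d, 2*a*b + 2*a*c + 4*a*d + 4*b*c + 4*b*d +
        4*c*d + 2*a + 8*b + 8*c + 10*d + 4)"
| "invariants Sdcc a b c d =
    (a + b + c + d + 6, a*b + a*c + a*d + b*c + b*d + c*d + 2*a + 4*b + 4*c + 4*d + 5, a*b*c + a*b*d + a*c*d +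
        b*c*d + 2*a*b + a*c + a*d + 3*b*c + 3*b*d + 3*c*d + a + 3*b + 2*c + 2*d + 1, a*b*c*d + a*b*c + a*b*d +
        2*b*c*d + a*b + b*c + b*d, 2*a*b*c*d + a*b*c + a*b*d, 6*a*b*c*d + 4*a*b*c + 4*a*b*d + 12*b*c*d + 2*a*b +
        6*b*c + 6*b*d, 4*a*b*c*d + 5*a*b*c + 5*a*b*d + 2*a*c*d + 6*b*c*d + 4*a*b + a*c + a*d + 5*b*c + 5*b*d +
        2*c*d + 4*b + c + d, 4*a*b*c + 4*a*b*d + 6*a*c*d + 6*b*c*d + 4*a*b + 4*a*c + 4*a*d + 14*b*c + 14*b*d +
        14*c*d + 2*a + 10*b + 8*c + 8*d + 2, 3*a*b*c + 3*a*b*d + 3*a*c*d + 3*b*c*d + 6*a*b + 4*a*c + 4*a*d +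
        8*b*c + 8*b*d + 8*c*d + 3*a + 11*b + 7*c + 7*d + 4, 2*a*b + 4*a*c + 4*a*d + 4*b*c + 4*b*d + 4*c*d + 4*a +
        12*b + 14*c + 14*d + 12)"
| "invariants Sccc a b c d =
    (a + b + c + d + 7, a*b + a*c + a*d + b*c + b*d + c*d + 3*a + 5*b + 5*c + 5*d + 9, a*b*c + a*b*d + a*c*d +
        b*c*d + 2*a*b + 2*a*c + 2*a*d + 4*b*c + 4*b*d + 4*c*d + 3*a + 5*b + 5*c + 5*d + 4, a*b*c*d + a*b*c +
        a*b*d + a*c*d + 3*b*c*d + a*b + a*c + a*d + 2*b*c + 2*b*d + 2*c*d + a + b + c + d, 3*a*b*c*d + 2*a*b*c +
        2*a*b*d + 2*a*c*d + a*b + a*c + a*d, 8*a*b*c*d + 6*a*b*c + 6*a*b*d + 6*a*c*d + 18*b*c*d + 4*a*b + 4*a*c +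
        4*a*d + 12*b*c + 12*b*d + 12*c*d + 2*a + 6*b + 6*c + 6*d, 4*a*b*c*d + 6*a*b*c + 6*a*b*d + 6*a*c*d +
        10*b*c*d + 6*a*b + 6*a*c + 6*a*d + 8*b*c + 8*b*d + 8*c*d + 4*a + 6*b + 6*c + 6*d + 4, 6*a*b*c + 6*a*b*d +
        6*a*c*d + 6*b*c*d + 8*a*b + 8*a*c + 8*a*d + 20*b*c + 20*b*d + 20*c*d + 6*a + 22*b + 22*c + 22*d + 12,
        3*a*b*c + 3*a*b*d + 3*a*c*d + 3*b*c*d + 7*a*b + 7*a*c + 7*a*d + 11*b*c + 11*b*d + 11*c*d + 9*a + 15*b +
        15*c + 15*d + 15, 4*a*b + 4*a*c + 4*a*d + 4*b*c + 4*b*d + 4*c*d + 6*a + 18*b + 18*c + 18*d + 24)"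
| "invariants Td a b c d =
    (a + b + c + d + 5, a*b + a*c + a*d + b*c + b*d + c*d + 2*a + 3*b + 3*c + 3*d + 2, a*b*c + a*b*d + a*c*d +
        b*c*d + a*b + a*c + 2*a*d + 2*b*c + 2*b*d + 2*c*d + b + c, a*b*c*d + a*b*d + a*c*d + b*c*d, 4*a*b*c*d,
        6*a*b*c*d + 2*a*b*d + 2*a*c*d + 6*b*c*d, 4*a*b*c*d + 4*a*b*c + 5*a*b*d + 5*a*c*d + 4*b*c*d + 4*b*c + b*d
        + c*d, 6*a*b*c + 4*a*b*d + 4*a*c*d + 6*b*c*d + 2*a*b + 2*a*c + 4*a*d + 8*b*c + 8*b*d + 8*c*d + 2*b + 2*c,
        3*a*b*c + 3*a*b*d + 3*a*c*d + 3*b*c*d + 4*a*b + 4*a*c + 6*a*d + 7*b*c + 5*b*d + 5*c*d + 4*b + 4*c + 2*d,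
        4*a*b + 4*a*c + 2*a*d + 4*b*c + 4*b*d + 4*c*d + 4*a + 8*b + 8*c + 10*d + 4)"
| "invariants Tc a b c d =
    (a + b + c + d + 6, a*b + a*c + a*d + b*c + b*d + c*d + 3*a + 4*b + 4*c + 4*d + 5, a*b*c + a*b*d + a*c*d +
        b*c*d + 2*a*b + 2*a*c + 2*a*d + 3*b*c + 3*b*d + 3*c*d + 2*a + 3*b + 3*c + 2*d, a*b*c*d + a*b*c + a*b*d +
        a*c*d + 2*b*c*d + a*b + a*c + b*c + b*d + c*d, 5*a*b*c*d + 4*a*b*c + a*b*d + a*c*d + b*c*d, 8*a*b*c*d +
        6*a*b*c + 4*a*b*d + 4*a*c*d + 10*b*c*d + 2*a*b + 2*a*c + 6*b*c + 4*b*d + 4*c*d, 4*a*b*c*d + 8*a*b*c +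
        6*a*b*d + 6*a*c*d + 8*b*c*d + 5*a*b + 5*a*c + 2*a*d + 8*b*c + 3*b*d + 3*c*d + b + c, 6*a*b*c + 6*a*b*d +
        6*a*c*d + 6*b*c*d + 6*a*b + 6*a*c + 8*a*d + 14*b*c + 12*b*d + 12*c*d + 4*a + 10*b + 10*c + 8*d, 3*a*b*c +
        3*a*b*d + 3*a*c*d + 3*b*c*d + 7*a*b + 7*a*c + 7*a*d + 10*b*c + 8*b*d + 8*c*d + 6*a + 9*b + 9*c + 5*d + 2,
        4*a*b + 4*a*c + 4*a*d + 4*b*c + 4*b*d + 4*c*d + 6*a + 12*b + 12*c + 14*d + 14)"
| "invariants Q a b c d =
    (a + b + c + d + 5, a*b + a*c + a*d + b*c + b*d + c*d + 3*a + 3*b + 3*c + 3*d, a*b*c + a*b*d + a*c*d + b*c*d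
        + 2*a*b + 2*a*c + 2*a*d + 2*b*c + 2*b*d + 2*c*d, a*b*c*d + a*b*c + a*b*d + a*c*d + b*c*d, 9*a*b*c*d,
        8*a*b*c*d + 2*a*b*c + 2*a*b*d + 2*a*c*d + 2*b*c*d, 4*a*b*c*d + 8*a*b*c + 8*a*b*d + 8*a*c*d + 8*b*c*d,
        6*a*b*c + 6*a*b*d + 6*a*c*d + 6*b*c*d + 4*a*b + 4*a*c + 4*a*d + 4*b*c + 4*b*d + 4*c*d, 3*a*b*c + 3*a*b*d
        + 3*a*c*d + 3*b*c*d + 7*a*b + 7*a*c + 7*a*d + 7*b*c + 7*b*d + 7*c*d, 4*a*b + 4*a*c + 4*a*d + 4*b*c +
        4*b*d + 4*c*d + 6*a + 6*b + 6*c + 6*d)"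

lemmas walk_data_eval = invariants.simps walk_data.simps Let_def walk_count_def list.map sum_list.Cons sum_list.Nil
  leaf_walks_numeral core_walks_numeral(1) of_nat_push

section \<open>Certification of the tabulated invariants, shape by shape\<close>

lemma det_mat_1:
  fixes F :: "nat \<Rightarrow> nat \<Rightarrow> 'b :: comm_ring_1"
  shows "det (mat 1 1 (\<lambda>(i, j). F i j)) = F 0 0"
  by (simp add: eval_nat_numeral det_expand det_0 algebra_simps)

lemma det_mat_2:
  fixes F :: "nat \<Rightarrow> nat \<Rightarrow> 'b :: comm_ring_1"
  shows "det (mat 2 2 (\<lambda>(i, j). F i j)) = F 0 0 * F (Suc 0) (Suc 0) - F 0 (Suc 0) * F (Suc 0) 0"
  by (simp add: eval_nat_numeral det_expand det_0 algebra_simps)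

lemma det_mat_3:
  fixes F :: "nat \<Rightarrow> nat \<Rightarrow> 'b :: comm_ring_1"
  shows "det (mat 3 3 (\<lambda>(i, j). F i j)) = F 0 0 * F (Suc 0) (Suc 0) * F 2 2 - F 0 0 * F (Suc 0) 2 * F 2 (Suc 0) -
      F 0 (Suc 0) * F (Suc 0) 0 * F 2 2 + F 0 (Suc 0) * F (Suc 0) 2 * F 2 0 + F 0 2 * F (Suc 0) 0 * F 2 (Suc 0) -
      F 0 2 * F (Suc 0) (Suc 0) * F 2 0"
  by (simp add: eval_nat_numeral det_expand det_0 algebra_simps)

lemma det_mat_4:
  fixes F :: "nat \<Rightarrow> nat \<Rightarrow> 'b :: comm_ring_1"
  shows "det (mat 4 4 (\<lambda>(i, j). F i j)) = F 0 0 * F (Suc 0) (Suc 0) * F 2 2 * F 3 3 - F 0 0 * F (Suc 0) (Suc 0) *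
      F 2 3 * F 3 2 - F 0 0 * F (Suc 0) 2 * F 2 (Suc 0) * F 3 3 + F 0 0 * F (Suc 0) 2 * F 2 3 * F 3 (Suc 0) + F 0
      0 * F (Suc 0) 3 * F 2 (Suc 0) * F 3 2 - F 0 0 * F (Suc 0) 3 * F 2 2 * F 3 (Suc 0) - F 0 (Suc 0) * F (Suc 0)
      0 * F 2 2 * F 3 3 + F 0 (Suc 0) * F (Suc 0) 0 * F 2 3 * F 3 2 + F 0 (Suc 0) * F (Suc 0) 2 * F 2 0 * F 3 3 -
      F 0 (Suc 0) * F (Suc 0) 2 * F 2 3 * F 3 0 - F 0 (Suc 0) * F (Suc 0) 3 * F 2 0 * F 3 2 + F 0 (Suc 0) * F
      (Suc 0) 3 * F 2 2 * F 3 0 + F 0 2 * F (Suc 0) 0 * F 2 (Suc 0) * F 3 3 - F 0 2 * F (Suc 0) 0 * F 2 3 * F 3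
      (Suc 0) - F 0 2 * F (Suc 0) (Suc 0) * F 2 0 * F 3 3 + F 0 2 * F (Suc 0) (Suc 0) * F 2 3 * F 3 0 + F 0 2 * F
      (Suc 0) 3 * F 2 0 * F 3 (Suc 0) - F 0 2 * F (Suc 0) 3 * F 2 (Suc 0) * F 3 0 - F 0 3 * F (Suc 0) 0 * F 2
      (Suc 0) * F 3 2 + F 0 3 * F (Suc 0) 0 * F 2 2 * F 3 (Suc 0) + F 0 3 * F (Suc 0) (Suc 0) * F 2 0 * F 3 2 - F
      0 3 * F (Suc 0) (Suc 0) * F 2 2 * F 3 0 - F 0 3 * F (Suc 0) 2 * F 2 0 * F 3 (Suc 0) + F 0 3 * F (Suc 0) 2 *
      F 2 (Suc 0) * F 3 0"
  by (simp add: eval_nat_numeral det_expand det_0 algebra_simps)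

text \<open>The pattern of all \<open>walk_data\<close> lemmas: walks of length 1 to 4 become
  polynomials in the leaf counts, each length being computed from the preceding ones.
  \<open>R\<close> and \<open>l\<close> stay folded, so only these values are inserted, and
  polynomial identities over the integers remain.\<close>

lemma walk_data_Star: "walk_data 1 (sc []) (lv [a, 0, 0, 0]) (invariants Star a 0 0 0)"
proof -
  define R where "R = sc []"
  define l where "l = lv [a, 0, 0, 0]"
  let ?w = "core_walks 1 R l"
  note ev = R_def l_def sc_Nil sc_Cons lv_simps core_walks_numeral upt_rec
  have w1: "?w (Suc 0) 0 = a"
    by (simp_all add: ev)
  have w2: "?w 2 0 = a"
    by (simp_all add: ev algebra_simps power2_eq_square)
  have w3: "?w 3 0 = a^2"
    by (simp_all add: ev algebra_simps power2_eq_square)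
  have w4: "?w 4 0 = a^2"
    by (simp_all add: ev algebra_simps power2_eq_square)
  have l: "l 0 = a"
    by (simp_all add: l_def lv_simps)
  have u: "[0..<1] = [0]" by (simp add: upt_rec)
  show ?thesis unfolding R_def[symmetric] l_def[symmetric] walk_data_eval u w1 w2 w3 w4 l
    by (intro conjI; Groebner_Basis.algebra)
qed

text \<open>The pattern of all \<open>matching_data\<close> lemmas: once the entries of the Schur
  complement are inserted into the expanded determinant, one polynomial identity in \<open>x\<close>
  and the leaf counts remains.\<close>

lemma matching_data_Star: "matching_data 1 1 (sc []) (lv [a, 0, 0, 0]) (invariants Star a 0 0 0)"
proof -
  define R where "R = sc []"
  define l where "l = lv [a, 0, 0, 0]"
  let ?e = "schur_entry 1 1 R l"
  have e: "?e x 0 0 = x^2 - real a" for x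
    by (simp_all add: schur_entry_def R_def l_def sc_Nil sc_Cons lv_simps upt_rec)
  have c: "8 - 2 * 1 = (6 :: nat)" by simp
  show ?thesis unfolding R_def[symmetric] l_def[symmetric] invariants.simps matching_data.simps
      det_mat_1 e c of_nat_push
    by (rule allI, Groebner_Basis.algebra)
qed

lemma walk_data_Pd: "walk_data 2 (sc [(0, 1)]) (lv [a, b, 0, 0]) (invariants Pd a b 0 0)"
proof -
  define R where "R = sc [(0, 1)]"
  define l where "l = lv [a, b, 0, 0]"
  let ?w = "core_walks 2 R l"
  note ev = R_def l_def sc_Nil sc_Cons lv_simps core_walks_numeral upt_rec
  have w1: "?w (Suc 0) 0 = a + 1" "?w (Suc 0) (Suc 0) = b + 1"
    by (simp_all add: ev)
  have w2: "?w 2 0 = a + b + 1" "?w 2 (Suc 0) = a + b + 1"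
    by (simp_all add: ev algebra_simps power2_eq_square)
  have w3: "?w 3 0 = a^2 + 2*a + b + 1" "?w 3 (Suc 0) = b^2 + a + 2*b + 1"
    by (simp_all add: ev algebra_simps power2_eq_square)
  have w4: "?w 4 0 = a^2 + a*b + b^2 + 2*a + 2*b + 1" "?w 4 (Suc 0) = a^2 + a*b + b^2 + 2*a + 2*b + 1"
    by (simp_all add: ev algebra_simps power2_eq_square)
  have l: "l 0 = a" "l (Suc 0) = b"
    by (simp_all add: l_def lv_simps)
  have u: "[0..<2] = [0, (Suc 0)]" by (simp add: upt_rec)
  show ?thesis unfolding R_def[symmetric] l_def[symmetric] walk_data_eval u w1 w2 w3 w4 l
    by (intro conjI; Groebner_Basis.algebra)
qed

lemma matching_data_Pd: "matching_data 2 2 (sc [(0, 1)]) (lv [a, b, 0, 0]) (invariants Pd a b 0 0)"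
proof -
  define R where "R = sc [(0, 1)]"
  define l where "l = lv [a, b, 0, 0]"
  let ?e = "schur_entry 2 2 R l"
  have e: "?e x 0 0 = x^2 - real a" "?e x 0 (Suc 0) = - x" "?e x (Suc 0) 0 = - x"
      "?e x (Suc 0) (Suc 0) = x^2 - real b" for x
    by (simp_all add: schur_entry_def R_def l_def sc_Nil sc_Cons lv_simps upt_rec)
  have c: "8 - 2 * 2 = (4 :: nat)" by simp
  show ?thesis unfolding R_def[symmetric] l_def[symmetric] invariants.simps matching_data.simps
      det_mat_2 e c of_nat_push
    by (rule allI, Groebner_Basis.algebra)
qed

lemma walk_data_Pc: "walk_data 3 (sc [(0, 2), (1, 2)]) (lv [a, b, 0, 0]) (invariants Pc a b 0 0)"
proof -
  define R where "R = sc [(0, 2), (1, 2)]"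
  define l where "l = lv [a, b, 0, 0]"
  let ?w = "core_walks 3 R l"
  note ev = R_def l_def sc_Nil sc_Cons lv_simps core_walks_numeral upt_rec
  have w1: "?w (Suc 0) 0 = a + 1" "?w (Suc 0) (Suc 0) = b + 1" "?w (Suc 0) 2 = 2"
    by (simp_all add: ev)
  have w2: "?w 2 0 = a + 2" "?w 2 (Suc 0) = b + 2" "?w 2 2 = a + b + 2"
    by (simp_all add: ev algebra_simps power2_eq_square)
  have w3: "?w 3 0 = a^2 + 2*a + b + 2" "?w 3 (Suc 0) = b^2 + a + 2*b + 2" "?w 3 2 = a + b + 4"
    by (simp_all add: ev algebra_simps power2_eq_square)
  have w4: "?w 4 0 = a^2 + 3*a + b + 4" "?w 4 (Suc 0) = b^2 + a + 3*b + 4" "?w 4 2 = a^2 + b^2 + 3*a + 3*b + 4"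
    by (simp_all add: ev algebra_simps power2_eq_square)
  have l: "l 0 = a" "l (Suc 0) = b" "l 2 = 0"
    by (simp_all add: l_def lv_simps)
  have u: "[0..<3] = [0, (Suc 0), 2]" by (simp add: upt_rec)
  show ?thesis unfolding R_def[symmetric] l_def[symmetric] walk_data_eval u w1 w2 w3 w4 l
    by (intro conjI; Groebner_Basis.algebra)
qed

lemma matching_data_Pc: "matching_data 2 3 (sc [(0, 2), (1, 2)]) (lv [a, b, 0, 0]) (invariants Pc a b 0 0)"
proof -
  define R where "R = sc [(0, 2), (1, 2)]"
  define l where "l = lv [a, b, 0, 0]"
  let ?e = "schur_entry 2 3 R l"
  have e: "?e x 0 0 = x^2 - real a - 1" "?e x 0 (Suc 0) = - 1" "?e x (Suc 0) 0 = - 1"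
      "?e x (Suc 0) (Suc 0) = x^2 - real b - 1" for x
    by (simp_all add: schur_entry_def R_def l_def sc_Nil sc_Cons lv_simps upt_rec)
  have c: "8 - 2 * 2 = (4 :: nat)" by simp
  show ?thesis unfolding R_def[symmetric] l_def[symmetric] invariants.simps matching_data.simps
      det_mat_2 e c of_nat_push
    by (rule allI, Groebner_Basis.algebra)
qed

lemma walk_data_Pdd: "walk_data 3 (sc [(0, 1), (1, 2)]) (lv [a, b, c, 0]) (invariants Pdd a b c 0)"
proof -
  define R where "R = sc [(0, 1), (1, 2)]"
  define l where "l = lv [a, b, c, 0]"
  let ?w = "core_walks 3 R l"
  note ev = R_def l_def sc_Nil sc_Cons lv_simps core_walks_numeral upt_rec
  have w1: "?w (Suc 0) 0 = a + 1" "?w (Suc 0) (Suc 0) = b + 2" "?w (Suc 0) 2 = c + 1"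
    by (simp_all add: ev)
  have w2: "?w 2 0 = a + b + 2" "?w 2 (Suc 0) = a + b + c + 2" "?w 2 2 = b + c + 2"
    by (simp_all add: ev algebra_simps power2_eq_square)
  have w3: "?w 3 0 = a^2 + 2*a + b + c + 2" "?w 3 (Suc 0) = b^2 + a + 4*b + c + 4" "?w 3 2 = c^2 + a + b + 2*c + 2"
    by (simp_all add: ev algebra_simps power2_eq_square)
  have w4: "?w 4 0 = a^2 + a*b + b^2 + 3*a + 4*b + c + 4" "?w 4 (Suc 0) = a^2 + a*b + b^2 + b*c + c^2 + 3*a + 4*b
      + 3*c + 4" "?w 4 2 = b^2 + b*c + c^2 + a + 4*b + 3*c + 4"
    by (simp_all add: ev algebra_simps power2_eq_square)
  have l: "l 0 = a" "l (Suc 0) = b" "l 2 = c"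
    by (simp_all add: l_def lv_simps)
  have u: "[0..<3] = [0, (Suc 0), 2]" by (simp add: upt_rec)
  show ?thesis unfolding R_def[symmetric] l_def[symmetric] walk_data_eval u w1 w2 w3 w4 l
    by (intro conjI; Groebner_Basis.algebra)
qed

lemma matching_data_Pdd: "matching_data 3 3 (sc [(0, 1), (1, 2)]) (lv [a, b, c, 0]) (invariants Pdd a b c 0)"
proof -
  define R where "R = sc [(0, 1), (1, 2)]"
  define l where "l = lv [a, b, c, 0]"
  let ?e = "schur_entry 3 3 R l"
  have e: "?e x 0 0 = x^2 - real a" "?e x 0 (Suc 0) = - x" "?e x 0 2 = 0" "?e x (Suc 0) 0 = - x"
      "?e x (Suc 0) (Suc 0) = x^2 - real b" "?e x (Suc 0) 2 = - x" "?e x 2 0 = 0" "?e x 2 (Suc 0) = - x"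
      "?e x 2 2 = x^2 - real c" for x
    by (simp_all add: schur_entry_def R_def l_def sc_Nil sc_Cons lv_simps upt_rec)
  have c: "8 - 2 * 3 = (2 :: nat)" by simp
  show ?thesis unfolding R_def[symmetric] l_def[symmetric] invariants.simps matching_data.simps
      det_mat_3 e c of_nat_push
    by (rule allI, Groebner_Basis.algebra)
qed

lemma walk_data_Pdc: "walk_data 4 (sc [(0, 1), (1, 3), (2, 3)]) (lv [a, b, c, 0]) (invariants Pdc a b c 0)"
proof -
  define R where "R = sc [(0, 1), (1, 3), (2, 3)]"
  define l where "l = lv [a, b, c, 0]"
  let ?w = "core_walks 4 R l"
  note ev = R_def l_def sc_Nil sc_Cons lv_simps core_walks_numeral upt_rec
  have w1: "?w (Suc 0) 0 = a + 1" "?w (Suc 0) (Suc 0) = b + 2" "?w (Suc 0) 2 = c + 1" "?w (Suc 0) 3 = 2"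
    by (simp_all add: ev)
  have w2: "?w 2 0 = a + b + 2" "?w 2 (Suc 0) = a + b + 3" "?w 2 2 = c + 2" "?w 2 3 = b + c + 3"
    by (simp_all add: ev algebra_simps power2_eq_square)
  have w3: "?w 3 0 = a^2 + 2*a + b + 3" "?w 3 (Suc 0) = b^2 + a + 4*b + c + 5" "?w 3 2 = c^2 + b + 2*c + 3"
      "?w 3 3 = a + b + c + 5"
    by (simp_all add: ev algebra_simps power2_eq_square)
  have w4: "?w 4 0 = a^2 + a*b + b^2 + 3*a + 4*b + c + 5" "?w 4 (Suc 0) = a^2 + a*b + b^2 + 3*a + 5*b + c + 8"
      "?w 4 2 = c^2 + a + b + 3*c + 5" "?w 4 3 = b^2 + c^2 + a + 5*b + 3*c + 8"
    by (simp_all add: ev algebra_simps power2_eq_square)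
  have l: "l 0 = a" "l (Suc 0) = b" "l 2 = c" "l 3 = 0"
    by (simp_all add: l_def lv_simps)
  have u: "[0..<4] = [0, (Suc 0), 2, 3]" by (simp add: upt_rec)
  show ?thesis unfolding R_def[symmetric] l_def[symmetric] walk_data_eval u w1 w2 w3 w4 l
    by (intro conjI; Groebner_Basis.algebra)
qed

lemma matching_data_Pdc: "matching_data 3 4 (sc [(0, 1), (1, 3), (2, 3)]) (lv [a, b, c, 0]) (invariants Pdc a b c 0)"
proof -
  define R where "R = sc [(0, 1), (1, 3), (2, 3)]"
  define l where "l = lv [a, b, c, 0]"
  let ?e = "schur_entry 3 4 R l"
  have e: "?e x 0 0 = x^2 - real a" "?e x 0 (Suc 0) = - x" "?e x 0 2 = 0" "?e x (Suc 0) 0 = - x"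
      "?e x (Suc 0) (Suc 0) = x^2 - real b - 1" "?e x (Suc 0) 2 = - 1" "?e x 2 0 = 0" "?e x 2 (Suc 0) = - 1"
      "?e x 2 2 = x^2 - real c - 1" for x
    by (simp_all add: schur_entry_def R_def l_def sc_Nil sc_Cons lv_simps upt_rec)
  have c: "8 - 2 * 3 = (2 :: nat)" by simp
  show ?thesis unfolding R_def[symmetric] l_def[symmetric] invariants.simps matching_data.simps
      det_mat_3 e c of_nat_push
    by (rule allI, Groebner_Basis.algebra)
qed

lemma walk_data_Pcc: "walk_data 5 (sc [(0, 3), (1, 3), (1, 4), (2, 4)]) (lv [a, b, c, 0]) (invariants Pcc a b c 0)"
proof -
  define R where "R = sc [(0, 3), (1, 3), (1, 4), (2, 4)]"
  define l where "l = lv [a, b, c, 0]"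
  let ?w = "core_walks 5 R l"
  note ev = R_def l_def sc_Nil sc_Cons lv_simps core_walks_numeral upt_rec
  have w1: "?w (Suc 0) 0 = a + 1" "?w (Suc 0) (Suc 0) = b + 2" "?w (Suc 0) 2 = c + 1" "?w (Suc 0) 3 = 2"
      "?w (Suc 0) 4 = 2"
    by (simp_all add: ev)
  have w2: "?w 2 0 = a + 2" "?w 2 (Suc 0) = b + 4" "?w 2 2 = c + 2" "?w 2 3 = a + b + 3" "?w 2 4 = b + c + 3"
    by (simp_all add: ev algebra_simps power2_eq_square)
  have w3: "?w 3 0 = a^2 + 2*a + b + 3" "?w 3 (Suc 0) = b^2 + a + 4*b + c + 6" "?w 3 2 = c^2 + b + 2*c + 3"
      "?w 3 3 = a + b + 6" "?w 3 4 = b + c + 6"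
    by (simp_all add: ev algebra_simps power2_eq_square)
  have w4: "?w 4 0 = a^2 + 3*a + b + 6" "?w 4 (Suc 0) = b^2 + a + 6*b + c + 12" "?w 4 2 = c^2 + b + 3*c + 6"
      "?w 4 3 = a^2 + b^2 + 3*a + 5*b + c + 9" "?w 4 4 = b^2 + c^2 + a + 5*b + 3*c + 9"
    by (simp_all add: ev algebra_simps power2_eq_square)
  have l: "l 0 = a" "l (Suc 0) = b" "l 2 = c" "l 3 = 0" "l 4 = 0"
    by (simp_all add: l_def lv_simps)
  have u: "[0..<5] = [0, (Suc 0), 2, 3, 4]" by (simp add: upt_rec)
  show ?thesis unfolding R_def[symmetric] l_def[symmetric] walk_data_eval u w1 w2 w3 w4 l
    by (intro conjI; Groebner_Basis.algebra)
qed

lemma matching_data_Pcc: "matching_data 3 5 (sc [(0, 3), (1, 3), (1, 4), (2, 4)]) (lv [a, b, c, 0]) (invariants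
    Pcc a b c 0)"
proof -
  define R where "R = sc [(0, 3), (1, 3), (1, 4), (2, 4)]"
  define l where "l = lv [a, b, c, 0]"
  let ?e = "schur_entry 3 5 R l"
  have e: "?e x 0 0 = x^2 - real a - 1" "?e x 0 (Suc 0) = - 1" "?e x 0 2 = 0" "?e x (Suc 0) 0 = - 1"
      "?e x (Suc 0) (Suc 0) = x^2 - real b - 2" "?e x (Suc 0) 2 = - 1" "?e x 2 0 = 0" "?e x 2 (Suc 0) = - 1"
      "?e x 2 2 = x^2 - real c - 1" for x
    by (simp_all add: schur_entry_def R_def l_def sc_Nil sc_Cons lv_simps upt_rec)
  have c: "8 - 2 * 3 = (2 :: nat)" by simp
  show ?thesis unfolding R_def[symmetric] l_def[symmetric] invariants.simps matching_data.simps
      det_mat_3 e c of_nat_push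
    by (rule allI, Groebner_Basis.algebra)
qed

lemma walk_data_Tri: "walk_data 4 (sc [(0, 3), (1, 3), (2, 3)]) (lv [a, b, c, 0]) (invariants Tri a b c 0)"
proof -
  define R where "R = sc [(0, 3), (1, 3), (2, 3)]"
  define l where "l = lv [a, b, c, 0]"
  let ?w = "core_walks 4 R l"
  note ev = R_def l_def sc_Nil sc_Cons lv_simps core_walks_numeral upt_rec
  have w1: "?w (Suc 0) 0 = a + 1" "?w (Suc 0) (Suc 0) = b + 1" "?w (Suc 0) 2 = c + 1" "?w (Suc 0) 3 = 3"
    by (simp_all add: ev)
  have w2: "?w 2 0 = a + 3" "?w 2 (Suc 0) = b + 3" "?w 2 2 = c + 3" "?w 2 3 = a + b + c + 3"
    by (simp_all add: ev algebra_simps power2_eq_square)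
  have w3: "?w 3 0 = a^2 + 2*a + b + c + 3" "?w 3 (Suc 0) = b^2 + a + 2*b + c + 3"
      "?w 3 2 = c^2 + a + b + 2*c + 3" "?w 3 3 = a + b + c + 9"
    by (simp_all add: ev algebra_simps power2_eq_square)
  have w4: "?w 4 0 = a^2 + 4*a + b + c + 9" "?w 4 (Suc 0) = b^2 + a + 4*b + c + 9"
      "?w 4 2 = c^2 + a + b + 4*c + 9" "?w 4 3 = a^2 + b^2 + c^2 + 4*a + 4*b + 4*c + 9"
    by (simp_all add: ev algebra_simps power2_eq_square)
  have l: "l 0 = a" "l (Suc 0) = b" "l 2 = c" "l 3 = 0"
    by (simp_all add: l_def lv_simps)
  have u: "[0..<4] = [0, (Suc 0), 2, 3]" by (simp add: upt_rec)
  show ?thesis unfolding R_def[symmetric] l_def[symmetric] walk_data_eval u w1 w2 w3 w4 l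
    by (intro conjI; Groebner_Basis.algebra)
qed

lemma matching_data_Tri: "matching_data 3 4 (sc [(0, 3), (1, 3), (2, 3)]) (lv [a, b, c, 0]) (invariants Tri a b c 0)"
proof -
  define R where "R = sc [(0, 3), (1, 3), (2, 3)]"
  define l where "l = lv [a, b, c, 0]"
  let ?e = "schur_entry 3 4 R l"
  have e: "?e x 0 0 = x^2 - real a - 1" "?e x 0 (Suc 0) = - 1" "?e x 0 2 = - 1" "?e x (Suc 0) 0 = - 1"
      "?e x (Suc 0) (Suc 0) = x^2 - real b - 1" "?e x (Suc 0) 2 = - 1" "?e x 2 0 = - 1" "?e x 2 (Suc 0) = - 1"
      "?e x 2 2 = x^2 - real c - 1" for x
    by (simp_all add: schur_entry_def R_def l_def sc_Nil sc_Cons lv_simps upt_rec)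
  have c: "8 - 2 * 3 = (2 :: nat)" by simp
  show ?thesis unfolding R_def[symmetric] l_def[symmetric] invariants.simps matching_data.simps
      det_mat_3 e c of_nat_push
    by (rule allI, Groebner_Basis.algebra)
qed

lemma walk_data_Pddd: "walk_data 4 (sc [(0, 1), (1, 2), (2, 3)]) (lv [a, b, c, d]) (invariants Pddd a b c d)"
proof -
  define R where "R = sc [(0, 1), (1, 2), (2, 3)]"
  define l where "l = lv [a, b, c, d]"
  let ?w = "core_walks 4 R l"
  note ev = R_def l_def sc_Nil sc_Cons lv_simps core_walks_numeral upt_rec
  have w1: "?w (Suc 0) 0 = a + 1" "?w (Suc 0) (Suc 0) = b + 2" "?w (Suc 0) 2 = c + 2" "?w (Suc 0) 3 = d + 1"
    by (simp_all add: ev)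
  have w2: "?w 2 0 = a + b + 2" "?w 2 (Suc 0) = a + b + c + 3" "?w 2 2 = b + c + d + 3" "?w 2 3 = c + d + 2"
    by (simp_all add: ev algebra_simps power2_eq_square)
  have w3: "?w 3 0 = a^2 + 2*a + b + c + 3" "?w 3 (Suc 0) = b^2 + a + 4*b + c + d + 5"
      "?w 3 2 = c^2 + a + b + 4*c + d + 5" "?w 3 3 = d^2 + b + c + 2*d + 3"
    by (simp_all add: ev algebra_simps power2_eq_square)
  have w4: "?w 4 0 = a^2 + a*b + b^2 + 3*a + 4*b + c + d + 5" "?w 4 (Suc 0) = a^2 + a*b + b^2 + b*c + c^2 + 3*a +
      5*b + 5*c + d + 8" "?w 4 2 = b^2 + b*c + c^2 + c*d + d^2 + a + 5*b + 5*c + 3*d + 8"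
      "?w 4 3 = c^2 + c*d + d^2 + a + b + 4*c + 3*d + 5"
    by (simp_all add: ev algebra_simps power2_eq_square)
  have l: "l 0 = a" "l (Suc 0) = b" "l 2 = c" "l 3 = d"
    by (simp_all add: l_def lv_simps)
  have u: "[0..<4] = [0, (Suc 0), 2, 3]" by (simp add: upt_rec)
  show ?thesis unfolding R_def[symmetric] l_def[symmetric] walk_data_eval u w1 w2 w3 w4 l
    by (intro conjI; Groebner_Basis.algebra)
qed

lemma matching_data_Pddd: "matching_data 4 4 (sc [(0, 1), (1, 2), (2, 3)]) (lv [a, b, c, d]) (invariants Pddd a b c d)"
proof -
  define R where "R = sc [(0, 1), (1, 2), (2, 3)]"
  define l where "l = lv [a, b, c, d]"
  let ?e = "schur_entry 4 4 R l"
  have e: "?e x 0 0 = x^2 - real a" "?e x 0 (Suc 0) = - x" "?e x 0 2 = 0" "?e x 0 3 = 0" "?e x (Suc 0) 0 = - x"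
      "?e x (Suc 0) (Suc 0) = x^2 - real b" "?e x (Suc 0) 2 = - x" "?e x (Suc 0) 3 = 0" "?e x 2 0 = 0"
      "?e x 2 (Suc 0) = - x" "?e x 2 2 = x^2 - real c" "?e x 2 3 = - x" "?e x 3 0 = 0" "?e x 3 (Suc 0) = 0"
      "?e x 3 2 = - x" "?e x 3 3 = x^2 - real d" for x
    by (simp_all add: schur_entry_def R_def l_def sc_Nil sc_Cons lv_simps upt_rec)
  have c: "8 - 2 * 4 = (0 :: nat)" by simp
  show ?thesis unfolding R_def[symmetric] l_def[symmetric] invariants.simps matching_data.simps
      det_mat_4 e c of_nat_push
    by (rule allI, Groebner_Basis.algebra)
qed

lemma walk_data_Pddc: "walk_data 5 (sc [(0, 1), (1, 2), (2, 4), (3, 4)]) (lv [a, b, c, d]) (invariants Pddc a b c d)"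
proof -
  define R where "R = sc [(0, 1), (1, 2), (2, 4), (3, 4)]"
  define l where "l = lv [a, b, c, d]"
  let ?w = "core_walks 5 R l"
  note ev = R_def l_def sc_Nil sc_Cons lv_simps core_walks_numeral upt_rec
  have w1: "?w (Suc 0) 0 = a + 1" "?w (Suc 0) (Suc 0) = b + 2" "?w (Suc 0) 2 = c + 2" "?w (Suc 0) 3 = d + 1"
      "?w (Suc 0) 4 = 2"
    by (simp_all add: ev)
  have w2: "?w 2 0 = a + b + 2" "?w 2 (Suc 0) = a + b + c + 3" "?w 2 2 = b + c + 4" "?w 2 3 = d + 2"
      "?w 2 4 = c + d + 3"
    by (simp_all add: ev algebra_simps power2_eq_square)
  have w3: "?w 3 0 = a^2 + 2*a + b + c + 3" "?w 3 (Suc 0) = b^2 + a + 4*b + c + 6"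
      "?w 3 2 = c^2 + a + b + 4*c + d + 6" "?w 3 3 = d^2 + c + 2*d + 3" "?w 3 4 = b + c + d + 6"
    by (simp_all add: ev algebra_simps power2_eq_square)
  have w4: "?w 4 0 = a^2 + a*b + b^2 + 3*a + 4*b + c + 6" "?w 4 (Suc 0) = a^2 + a*b + b^2 + b*c + c^2 + 3*a + 5*b
      + 5*c + d + 9" "?w 4 2 = b^2 + b*c + c^2 + a + 5*b + 6*c + d + 12" "?w 4 3 = d^2 + b + c + 3*d + 6"
      "?w 4 4 = c^2 + d^2 + a + b + 5*c + 3*d + 9"
    by (simp_all add: ev algebra_simps power2_eq_square)
  have l: "l 0 = a" "l (Suc 0) = b" "l 2 = c" "l 3 = d" "l 4 = 0"
    by (simp_all add: l_def lv_simps)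
  have u: "[0..<5] = [0, (Suc 0), 2, 3, 4]" by (simp add: upt_rec)
  show ?thesis unfolding R_def[symmetric] l_def[symmetric] walk_data_eval u w1 w2 w3 w4 l
    by (intro conjI; Groebner_Basis.algebra)
qed

lemma matching_data_Pddc: "matching_data 4 5 (sc [(0, 1), (1, 2), (2, 4), (3, 4)]) (lv [a, b, c, d]) (invariants
    Pddc a b c d)"
proof -
  define R where "R = sc [(0, 1), (1, 2), (2, 4), (3, 4)]"
  define l where "l = lv [a, b, c, d]"
  let ?e = "schur_entry 4 5 R l"
  have e: "?e x 0 0 = x^2 - real a" "?e x 0 (Suc 0) = - x" "?e x 0 2 = 0" "?e x 0 3 = 0" "?e x (Suc 0) 0 = - x"
      "?e x (Suc 0) (Suc 0) = x^2 - real b" "?e x (Suc 0) 2 = - x" "?e x (Suc 0) 3 = 0" "?e x 2 0 = 0"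
      "?e x 2 (Suc 0) = - x" "?e x 2 2 = x^2 - real c - 1" "?e x 2 3 = - 1" "?e x 3 0 = 0" "?e x 3 (Suc 0) = 0"
      "?e x 3 2 = - 1" "?e x 3 3 = x^2 - real d - 1" for x
    by (simp_all add: schur_entry_def R_def l_def sc_Nil sc_Cons lv_simps upt_rec)
  have c: "8 - 2 * 4 = (0 :: nat)" by simp
  show ?thesis unfolding R_def[symmetric] l_def[symmetric] invariants.simps matching_data.simps
      det_mat_4 e c of_nat_push
    by (rule allI, Groebner_Basis.algebra)
qed

lemma walk_data_Pdcd: "walk_data 5 (sc [(0, 1), (2, 3), (1, 4), (2, 4)]) (lv [a, b, c, d]) (invariants Pdcd a b c d)"
proof -
  define R where "R = sc [(0, 1), (2, 3), (1, 4), (2, 4)]"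
  define l where "l = lv [a, b, c, d]"
  let ?w = "core_walks 5 R l"
  note ev = R_def l_def sc_Nil sc_Cons lv_simps core_walks_numeral upt_rec
  have w1: "?w (Suc 0) 0 = a + 1" "?w (Suc 0) (Suc 0) = b + 2" "?w (Suc 0) 2 = c + 2" "?w (Suc 0) 3 = d + 1"
      "?w (Suc 0) 4 = 2"
    by (simp_all add: ev)
  have w2: "?w 2 0 = a + b + 2" "?w 2 (Suc 0) = a + b + 3" "?w 2 2 = c + d + 3" "?w 2 3 = c + d + 2"
      "?w 2 4 = b + c + 4"
    by (simp_all add: ev algebra_simps power2_eq_square)
  have w3: "?w 3 0 = a^2 + 2*a + b + 3" "?w 3 (Suc 0) = b^2 + a + 4*b + c + 6" "?w 3 2 = c^2 + b + 4*c + d + 6"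
      "?w 3 3 = d^2 + c + 2*d + 3" "?w 3 4 = a + b + c + d + 6"
    by (simp_all add: ev algebra_simps power2_eq_square)
  have w4: "?w 4 0 = a^2 + a*b + b^2 + 3*a + 4*b + c + 6" "?w 4 (Suc 0) = a^2 + a*b + b^2 + 3*a + 5*b + c + d +
      9" "?w 4 2 = c^2 + c*d + d^2 + a + b + 5*c + 3*d + 9" "?w 4 3 = c^2 + c*d + d^2 + b + 4*c + 3*d + 6"
      "?w 4 4 = b^2 + c^2 + a + 5*b + 5*c + d + 12"
    by (simp_all add: ev algebra_simps power2_eq_square)
  have l: "l 0 = a" "l (Suc 0) = b" "l 2 = c" "l 3 = d" "l 4 = 0"
    by (simp_all add: l_def lv_simps)
  have u: "[0..<5] = [0, (Suc 0), 2, 3, 4]" by (simp add: upt_rec)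
  show ?thesis unfolding R_def[symmetric] l_def[symmetric] walk_data_eval u w1 w2 w3 w4 l
    by (intro conjI; Groebner_Basis.algebra)
qed

lemma matching_data_Pdcd: "matching_data 4 5 (sc [(0, 1), (2, 3), (1, 4), (2, 4)]) (lv [a, b, c, d]) (invariants
    Pdcd a b c d)"
proof -
  define R where "R = sc [(0, 1), (2, 3), (1, 4), (2, 4)]"
  define l where "l = lv [a, b, c, d]"
  let ?e = "schur_entry 4 5 R l"
  have e: "?e x 0 0 = x^2 - real a" "?e x 0 (Suc 0) = - x" "?e x 0 2 = 0" "?e x 0 3 = 0" "?e x (Suc 0) 0 = - x"
      "?e x (Suc 0) (Suc 0) = x^2 - real b - 1" "?e x (Suc 0) 2 = - 1" "?e x (Suc 0) 3 = 0" "?e x 2 0 = 0"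
      "?e x 2 (Suc 0) = - 1" "?e x 2 2 = x^2 - real c - 1" "?e x 2 3 = - x" "?e x 3 0 = 0" "?e x 3 (Suc 0) = 0"
      "?e x 3 2 = - x" "?e x 3 3 = x^2 - real d" for x
    by (simp_all add: schur_entry_def R_def l_def sc_Nil sc_Cons lv_simps upt_rec)
  have c: "8 - 2 * 4 = (0 :: nat)" by simp
  show ?thesis unfolding R_def[symmetric] l_def[symmetric] invariants.simps matching_data.simps
      det_mat_4 e c of_nat_push
    by (rule allI, Groebner_Basis.algebra)
qed

lemma walk_data_Pcdc: "walk_data 6 (sc [(1, 2), (0, 4), (1, 4), (2, 5), (3, 5)]) (lv [a, b, c, d]) (invariants
    Pcdc a b c d)"
proof -
  define R where "R = sc [(1, 2), (0, 4), (1, 4), (2, 5), (3, 5)]"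
  define l where "l = lv [a, b, c, d]"
  let ?w = "core_walks 6 R l"
  note ev = R_def l_def sc_Nil sc_Cons lv_simps core_walks_numeral upt_rec
  have w1: "?w (Suc 0) 0 = a + 1" "?w (Suc 0) (Suc 0) = b + 2" "?w (Suc 0) 2 = c + 2" "?w (Suc 0) 3 = d + 1"
      "?w (Suc 0) 4 = 2" "?w (Suc 0) 5 = 2"
    by (simp_all add: ev)
  have w2: "?w 2 0 = a + 2" "?w 2 (Suc 0) = b + c + 4" "?w 2 2 = b + c + 4" "?w 2 3 = d + 2"
      "?w 2 4 = a + b + 3" "?w 2 5 = c + d + 3"
    by (simp_all add: ev algebra_simps power2_eq_square)
  have w3: "?w 3 0 = a^2 + 2*a + b + 3" "?w 3 (Suc 0) = b^2 + a + 4*b + c + 7" "?w 3 2 = c^2 + b + 4*c + d + 7"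
      "?w 3 3 = d^2 + c + 2*d + 3" "?w 3 4 = a + b + c + 6" "?w 3 5 = b + c + d + 6"
    by (simp_all add: ev algebra_simps power2_eq_square)
  have w4: "?w 4 0 = a^2 + 3*a + b + c + 6" "?w 4 (Suc 0) = b^2 + b*c + c^2 + a + 6*b + 5*c + d + 13"
      "?w 4 2 = b^2 + b*c + c^2 + a + 5*b + 6*c + d + 13" "?w 4 3 = d^2 + b + c + 3*d + 6"
      "?w 4 4 = a^2 + b^2 + 3*a + 5*b + c + 10" "?w 4 5 = c^2 + d^2 + b + 5*c + 3*d + 10"
    by (simp_all add: ev algebra_simps power2_eq_square)
  have l: "l 0 = a" "l (Suc 0) = b" "l 2 = c" "l 3 = d" "l 4 = 0" "l 5 = 0"
    by (simp_all add: l_def lv_simps)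
  have u: "[0..<6] = [0, (Suc 0), 2, 3, 4, 5]" by (simp add: upt_rec)
  show ?thesis unfolding R_def[symmetric] l_def[symmetric] walk_data_eval u w1 w2 w3 w4 l
    by (intro conjI; Groebner_Basis.algebra)
qed

lemma matching_data_Pcdc: "matching_data 4 6 (sc [(1, 2), (0, 4), (1, 4), (2, 5), (3, 5)]) (lv [a, b, c, d])
    (invariants Pcdc a b c d)"
proof -
  define R where "R = sc [(1, 2), (0, 4), (1, 4), (2, 5), (3, 5)]"
  define l where "l = lv [a, b, c, d]"
  let ?e = "schur_entry 4 6 R l"
  have e: "?e x 0 0 = x^2 - real a - 1" "?e x 0 (Suc 0) = - 1" "?e x 0 2 = 0" "?e x 0 3 = 0"
      "?e x (Suc 0) 0 = - 1" "?e x (Suc 0) (Suc 0) = x^2 - real b - 1" "?e x (Suc 0) 2 = - x"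
      "?e x (Suc 0) 3 = 0" "?e x 2 0 = 0" "?e x 2 (Suc 0) = - x" "?e x 2 2 = x^2 - real c - 1" "?e x 2 3 = - 1"
      "?e x 3 0 = 0" "?e x 3 (Suc 0) = 0" "?e x 3 2 = - 1" "?e x 3 3 = x^2 - real d - 1" for x
    by (simp_all add: schur_entry_def R_def l_def sc_Nil sc_Cons lv_simps upt_rec)
  have c: "8 - 2 * 4 = (0 :: nat)" by simp
  show ?thesis unfolding R_def[symmetric] l_def[symmetric] invariants.simps matching_data.simps
      det_mat_4 e c of_nat_push
    by (rule allI, Groebner_Basis.algebra)
qed

lemma walk_data_Pdcc: "walk_data 6 (sc [(0, 1), (1, 4), (2, 4), (2, 5), (3, 5)]) (lv [a, b, c, d]) (invariants
    Pdcc a b c d)"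
proof -
  define R where "R = sc [(0, 1), (1, 4), (2, 4), (2, 5), (3, 5)]"
  define l where "l = lv [a, b, c, d]"
  let ?w = "core_walks 6 R l"
  note ev = R_def l_def sc_Nil sc_Cons lv_simps core_walks_numeral upt_rec
  have w1: "?w (Suc 0) 0 = a + 1" "?w (Suc 0) (Suc 0) = b + 2" "?w (Suc 0) 2 = c + 2" "?w (Suc 0) 3 = d + 1"
      "?w (Suc 0) 4 = 2" "?w (Suc 0) 5 = 2"
    by (simp_all add: ev)
  have w2: "?w 2 0 = a + b + 2" "?w 2 (Suc 0) = a + b + 3" "?w 2 2 = c + 4" "?w 2 3 = d + 2"
      "?w 2 4 = b + c + 4" "?w 2 5 = c + d + 3"
    by (simp_all add: ev algebra_simps power2_eq_square)
  have w3: "?w 3 0 = a^2 + 2*a + b + 3" "?w 3 (Suc 0) = b^2 + a + 4*b + c + 6" "?w 3 2 = c^2 + b + 4*c + d + 7"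
      "?w 3 3 = d^2 + c + 2*d + 3" "?w 3 4 = a + b + c + 7" "?w 3 5 = c + d + 6"
    by (simp_all add: ev algebra_simps power2_eq_square)
  have w4: "?w 4 0 = a^2 + a*b + b^2 + 3*a + 4*b + c + 6" "?w 4 (Suc 0) = a^2 + a*b + b^2 + 3*a + 5*b + c + 10"
      "?w 4 2 = c^2 + a + b + 6*c + d + 13" "?w 4 3 = d^2 + c + 3*d + 6"
      "?w 4 4 = b^2 + c^2 + a + 5*b + 5*c + d + 13" "?w 4 5 = c^2 + d^2 + b + 5*c + 3*d + 10"
    by (simp_all add: ev algebra_simps power2_eq_square)
  have l: "l 0 = a" "l (Suc 0) = b" "l 2 = c" "l 3 = d" "l 4 = 0" "l 5 = 0"
    by (simp_all add: l_def lv_simps)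
  have u: "[0..<6] = [0, (Suc 0), 2, 3, 4, 5]" by (simp add: upt_rec)
  show ?thesis unfolding R_def[symmetric] l_def[symmetric] walk_data_eval u w1 w2 w3 w4 l
    by (intro conjI; Groebner_Basis.algebra)
qed

lemma matching_data_Pdcc: "matching_data 4 6 (sc [(0, 1), (1, 4), (2, 4), (2, 5), (3, 5)]) (lv [a, b, c, d])
    (invariants Pdcc a b c d)"
proof -
  define R where "R = sc [(0, 1), (1, 4), (2, 4), (2, 5), (3, 5)]"
  define l where "l = lv [a, b, c, d]"
  let ?e = "schur_entry 4 6 R l"
  have e: "?e x 0 0 = x^2 - real a" "?e x 0 (Suc 0) = - x" "?e x 0 2 = 0" "?e x 0 3 = 0" "?e x (Suc 0) 0 = - x"
      "?e x (Suc 0) (Suc 0) = x^2 - real b - 1" "?e x (Suc 0) 2 = - 1" "?e x (Suc 0) 3 = 0" "?e x 2 0 = 0"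
      "?e x 2 (Suc 0) = - 1" "?e x 2 2 = x^2 - real c - 2" "?e x 2 3 = - 1" "?e x 3 0 = 0" "?e x 3 (Suc 0) = 0"
      "?e x 3 2 = - 1" "?e x 3 3 = x^2 - real d - 1" for x
    by (simp_all add: schur_entry_def R_def l_def sc_Nil sc_Cons lv_simps upt_rec)
  have c: "8 - 2 * 4 = (0 :: nat)" by simp
  show ?thesis unfolding R_def[symmetric] l_def[symmetric] invariants.simps matching_data.simps
      det_mat_4 e c of_nat_push
    by (rule allI, Groebner_Basis.algebra)
qed

lemma walk_data_Pccc: "walk_data 7 (sc [(0, 4), (1, 4), (1, 5), (2, 5), (2, 6), (3, 6)]) (lv [a, b, c, d])
    (invariants Pccc a b c d)"
proof -
  define R where "R = sc [(0, 4), (1, 4), (1, 5), (2, 5), (2, 6), (3, 6)]"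
  define l where "l = lv [a, b, c, d]"
  let ?w = "core_walks 7 R l"
  note ev = R_def l_def sc_Nil sc_Cons lv_simps core_walks_numeral upt_rec
  have w1: "?w (Suc 0) 0 = a + 1" "?w (Suc 0) (Suc 0) = b + 2" "?w (Suc 0) 2 = c + 2" "?w (Suc 0) 3 = d + 1"
      "?w (Suc 0) 4 = 2" "?w (Suc 0) 5 = 2" "?w (Suc 0) 6 = 2"
    by (simp_all add: ev)
  have w2: "?w 2 0 = a + 2" "?w 2 (Suc 0) = b + 4" "?w 2 2 = c + 4" "?w 2 3 = d + 2" "?w 2 4 = a + b + 3"
      "?w 2 5 = b + c + 4" "?w 2 6 = c + d + 3"
    by (simp_all add: ev algebra_simps power2_eq_square)
  have w3: "?w 3 0 = a^2 + 2*a + b + 3" "?w 3 (Suc 0) = b^2 + a + 4*b + c + 7" "?w 3 2 = c^2 + b + 4*c + d + 7"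
      "?w 3 3 = d^2 + c + 2*d + 3" "?w 3 4 = a + b + 6" "?w 3 5 = b + c + 8" "?w 3 6 = c + d + 6"
    by (simp_all add: ev algebra_simps power2_eq_square)
  have w4: "?w 4 0 = a^2 + 3*a + b + 6" "?w 4 (Suc 0) = b^2 + a + 6*b + c + 14"
      "?w 4 2 = c^2 + b + 6*c + d + 14" "?w 4 3 = d^2 + c + 3*d + 6" "?w 4 4 = a^2 + b^2 + 3*a + 5*b + c + 10"
      "?w 4 5 = b^2 + c^2 + a + 5*b + 5*c + d + 14" "?w 4 6 = c^2 + d^2 + b + 5*c + 3*d + 10"
    by (simp_all add: ev algebra_simps power2_eq_square)
  have l: "l 0 = a" "l (Suc 0) = b" "l 2 = c" "l 3 = d" "l 4 = 0" "l 5 = 0" "l 6 = 0"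
    by (simp_all add: l_def lv_simps)
  have u: "[0..<7] = [0, (Suc 0), 2, 3, 4, 5, 6]" by (simp add: upt_rec)
  show ?thesis unfolding R_def[symmetric] l_def[symmetric] walk_data_eval u w1 w2 w3 w4 l
    by (intro conjI; Groebner_Basis.algebra)
qed

lemma matching_data_Pccc: "matching_data 4 7 (sc [(0, 4), (1, 4), (1, 5), (2, 5), (2, 6), (3, 6)]) (lv [a, b, c,
    d]) (invariants Pccc a b c d)"
proof -
  define R where "R = sc [(0, 4), (1, 4), (1, 5), (2, 5), (2, 6), (3, 6)]"
  define l where "l = lv [a, b, c, d]"
  let ?e = "schur_entry 4 7 R l"
  have e: "?e x 0 0 = x^2 - real a - 1" "?e x 0 (Suc 0) = - 1" "?e x 0 2 = 0" "?e x 0 3 = 0"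
      "?e x (Suc 0) 0 = - 1" "?e x (Suc 0) (Suc 0) = x^2 - real b - 2" "?e x (Suc 0) 2 = - 1"
      "?e x (Suc 0) 3 = 0" "?e x 2 0 = 0" "?e x 2 (Suc 0) = - 1" "?e x 2 2 = x^2 - real c - 2" "?e x 2 3 = - 1"
      "?e x 3 0 = 0" "?e x 3 (Suc 0) = 0" "?e x 3 2 = - 1" "?e x 3 3 = x^2 - real d - 1" for x
    by (simp_all add: schur_entry_def R_def l_def sc_Nil sc_Cons lv_simps upt_rec)
  have c: "8 - 2 * 4 = (0 :: nat)" by simp
  show ?thesis unfolding R_def[symmetric] l_def[symmetric] invariants.simps matching_data.simps
      det_mat_4 e c of_nat_push
    by (rule allI, Groebner_Basis.algebra)
qed

lemma walk_data_Sddd: "walk_data 4 (sc [(0, 1), (0, 2), (0, 3)]) (lv [a, b, c, d]) (invariants Sddd a b c d)"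
proof -
  define R where "R = sc [(0, 1), (0, 2), (0, 3)]"
  define l where "l = lv [a, b, c, d]"
  let ?w = "core_walks 4 R l"
  note ev = R_def l_def sc_Nil sc_Cons lv_simps core_walks_numeral upt_rec
  have w1: "?w (Suc 0) 0 = a + 3" "?w (Suc 0) (Suc 0) = b + 1" "?w (Suc 0) 2 = c + 1" "?w (Suc 0) 3 = d + 1"
    by (simp_all add: ev)
  have w2: "?w 2 0 = a + b + c + d + 3" "?w 2 (Suc 0) = a + b + 3" "?w 2 2 = a + c + 3" "?w 2 3 = a + d + 3"
    by (simp_all add: ev algebra_simps power2_eq_square)
  have w3: "?w 3 0 = a^2 + 6*a + b + c + d + 9" "?w 3 (Suc 0) = b^2 + a + 2*b + c + d + 3"
      "?w 3 2 = c^2 + a + b + 2*c + d + 3" "?w 3 3 = d^2 + a + b + c + 2*d + 3"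
    by (simp_all add: ev algebra_simps power2_eq_square)
  have w4: "?w 4 0 = a^2 + a*b + a*c + a*d + b^2 + c^2 + d^2 + 6*a + 4*b + 4*c + 4*d + 9"
      "?w 4 (Suc 0) = a^2 + a*b + b^2 + 6*a + 4*b + c + d + 9"
      "?w 4 2 = a^2 + a*c + c^2 + 6*a + b + 4*c + d + 9" "?w 4 3 = a^2 + a*d + d^2 + 6*a + b + c + 4*d + 9"
    by (simp_all add: ev algebra_simps power2_eq_square)
  have l: "l 0 = a" "l (Suc 0) = b" "l 2 = c" "l 3 = d"
    by (simp_all add: l_def lv_simps)
  have u: "[0..<4] = [0, (Suc 0), 2, 3]" by (simp add: upt_rec)
  show ?thesis unfolding R_def[symmetric] l_def[symmetric] walk_data_eval u w1 w2 w3 w4 l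
    by (intro conjI; Groebner_Basis.algebra)
qed

lemma matching_data_Sddd: "matching_data 4 4 (sc [(0, 1), (0, 2), (0, 3)]) (lv [a, b, c, d]) (invariants Sddd a b c d)"
proof -
  define R where "R = sc [(0, 1), (0, 2), (0, 3)]"
  define l where "l = lv [a, b, c, d]"
  let ?e = "schur_entry 4 4 R l"
  have e: "?e x 0 0 = x^2 - real a" "?e x 0 (Suc 0) = - x" "?e x 0 2 = - x" "?e x 0 3 = - x"
      "?e x (Suc 0) 0 = - x" "?e x (Suc 0) (Suc 0) = x^2 - real b" "?e x (Suc 0) 2 = 0" "?e x (Suc 0) 3 = 0"
      "?e x 2 0 = - x" "?e x 2 (Suc 0) = 0" "?e x 2 2 = x^2 - real c" "?e x 2 3 = 0" "?e x 3 0 = - x"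
      "?e x 3 (Suc 0) = 0" "?e x 3 2 = 0" "?e x 3 3 = x^2 - real d" for x
    by (simp_all add: schur_entry_def R_def l_def sc_Nil sc_Cons lv_simps upt_rec)
  have c: "8 - 2 * 4 = (0 :: nat)" by simp
  show ?thesis unfolding R_def[symmetric] l_def[symmetric] invariants.simps matching_data.simps
      det_mat_4 e c of_nat_push
    by (rule allI, Groebner_Basis.algebra)
qed

lemma walk_data_Sddc: "walk_data 5 (sc [(0, 1), (0, 2), (0, 4), (3, 4)]) (lv [a, b, c, d]) (invariants Sddc a b c d)"
proof -
  define R where "R = sc [(0, 1), (0, 2), (0, 4), (3, 4)]"
  define l where "l = lv [a, b, c, d]"
  let ?w = "core_walks 5 R l"
  note ev = R_def l_def sc_Nil sc_Cons lv_simps core_walks_numeral upt_rec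
  have w1: "?w (Suc 0) 0 = a + 3" "?w (Suc 0) (Suc 0) = b + 1" "?w (Suc 0) 2 = c + 1" "?w (Suc 0) 3 = d + 1"
      "?w (Suc 0) 4 = 2"
    by (simp_all add: ev)
  have w2: "?w 2 0 = a + b + c + 4" "?w 2 (Suc 0) = a + b + 3" "?w 2 2 = a + c + 3" "?w 2 3 = d + 2"
      "?w 2 4 = a + d + 4"
    by (simp_all add: ev algebra_simps power2_eq_square)
  have w3: "?w 3 0 = a^2 + 6*a + b + c + d + 10" "?w 3 (Suc 0) = b^2 + a + 2*b + c + 4"
      "?w 3 2 = c^2 + a + b + 2*c + 4" "?w 3 3 = d^2 + a + 2*d + 4" "?w 3 4 = a + b + c + d + 6"
    by (simp_all add: ev algebra_simps power2_eq_square)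
  have w4: "?w 4 0 = a^2 + a*b + a*c + b^2 + c^2 + 7*a + 4*b + 4*c + d + 14"
      "?w 4 (Suc 0) = a^2 + a*b + b^2 + 6*a + 4*b + c + d + 10"
      "?w 4 2 = a^2 + a*c + c^2 + 6*a + b + 4*c + d + 10" "?w 4 3 = d^2 + a + b + c + 3*d + 6"
      "?w 4 4 = a^2 + d^2 + 7*a + b + c + 3*d + 14"
    by (simp_all add: ev algebra_simps power2_eq_square)
  have l: "l 0 = a" "l (Suc 0) = b" "l 2 = c" "l 3 = d" "l 4 = 0"
    by (simp_all add: l_def lv_simps)
  have u: "[0..<5] = [0, (Suc 0), 2, 3, 4]" by (simp add: upt_rec)
  show ?thesis unfolding R_def[symmetric] l_def[symmetric] walk_data_eval u w1 w2 w3 w4 l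
    by (intro conjI; Groebner_Basis.algebra)
qed

lemma matching_data_Sddc: "matching_data 4 5 (sc [(0, 1), (0, 2), (0, 4), (3, 4)]) (lv [a, b, c, d]) (invariants
    Sddc a b c d)"
proof -
  define R where "R = sc [(0, 1), (0, 2), (0, 4), (3, 4)]"
  define l where "l = lv [a, b, c, d]"
  let ?e = "schur_entry 4 5 R l"
  have e: "?e x 0 0 = x^2 - real a - 1" "?e x 0 (Suc 0) = - x" "?e x 0 2 = - x" "?e x 0 3 = - 1"
      "?e x (Suc 0) 0 = - x" "?e x (Suc 0) (Suc 0) = x^2 - real b" "?e x (Suc 0) 2 = 0" "?e x (Suc 0) 3 = 0"
      "?e x 2 0 = - x" "?e x 2 (Suc 0) = 0" "?e x 2 2 = x^2 - real c" "?e x 2 3 = 0" "?e x 3 0 = - 1"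
      "?e x 3 (Suc 0) = 0" "?e x 3 2 = 0" "?e x 3 3 = x^2 - real d - 1" for x
    by (simp_all add: schur_entry_def R_def l_def sc_Nil sc_Cons lv_simps upt_rec)
  have c: "8 - 2 * 4 = (0 :: nat)" by simp
  show ?thesis unfolding R_def[symmetric] l_def[symmetric] invariants.simps matching_data.simps
      det_mat_4 e c of_nat_push
    by (rule allI, Groebner_Basis.algebra)
qed

lemma walk_data_Sdcc: "walk_data 6 (sc [(0, 1), (0, 4), (2, 4), (0, 5), (3, 5)]) (lv [a, b, c, d]) (invariants
    Sdcc a b c d)"
proof -
  define R where "R = sc [(0, 1), (0, 4), (2, 4), (0, 5), (3, 5)]"
  define l where "l = lv [a, b, c, d]"
  let ?w = "core_walks 6 R l"
  note ev = R_def l_def sc_Nil sc_Cons lv_simps core_walks_numeral upt_rec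
  have w1: "?w (Suc 0) 0 = a + 3" "?w (Suc 0) (Suc 0) = b + 1" "?w (Suc 0) 2 = c + 1" "?w (Suc 0) 3 = d + 1"
      "?w (Suc 0) 4 = 2" "?w (Suc 0) 5 = 2"
    by (simp_all add: ev)
  have w2: "?w 2 0 = a + b + 5" "?w 2 (Suc 0) = a + b + 3" "?w 2 2 = c + 2" "?w 2 3 = d + 2"
      "?w 2 4 = a + c + 4" "?w 2 5 = a + d + 4"
    by (simp_all add: ev algebra_simps power2_eq_square)
  have w3: "?w 3 0 = a^2 + 6*a + b + c + d + 11" "?w 3 (Suc 0) = b^2 + a + 2*b + 5" "?w 3 2 = c^2 + a + 2*c + 4"
      "?w 3 3 = d^2 + a + 2*d + 4" "?w 3 4 = a + b + c + 7" "?w 3 5 = a + b + d + 7"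
    by (simp_all add: ev algebra_simps power2_eq_square)
  have w4: "?w 4 0 = a^2 + a*b + b^2 + 8*a + 4*b + c + d + 19"
      "?w 4 (Suc 0) = a^2 + a*b + b^2 + 6*a + 4*b + c + d + 11" "?w 4 2 = c^2 + a + b + 3*c + 7"
      "?w 4 3 = d^2 + a + b + 3*d + 7" "?w 4 4 = a^2 + c^2 + 7*a + b + 3*c + d + 15"
      "?w 4 5 = a^2 + d^2 + 7*a + b + c + 3*d + 15"
    by (simp_all add: ev algebra_simps power2_eq_square)
  have l: "l 0 = a" "l (Suc 0) = b" "l 2 = c" "l 3 = d" "l 4 = 0" "l 5 = 0"
    by (simp_all add: l_def lv_simps)
  have u: "[0..<6] = [0, (Suc 0), 2, 3, 4, 5]" by (simp add: upt_rec)
  show ?thesis unfolding R_def[symmetric] l_def[symmetric] walk_data_eval u w1 w2 w3 w4 l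
    by (intro conjI; Groebner_Basis.algebra)
qed

lemma matching_data_Sdcc: "matching_data 4 6 (sc [(0, 1), (0, 4), (2, 4), (0, 5), (3, 5)]) (lv [a, b, c, d])
    (invariants Sdcc a b c d)"
proof -
  define R where "R = sc [(0, 1), (0, 4), (2, 4), (0, 5), (3, 5)]"
  define l where "l = lv [a, b, c, d]"
  let ?e = "schur_entry 4 6 R l"
  have e: "?e x 0 0 = x^2 - real a - 2" "?e x 0 (Suc 0) = - x" "?e x 0 2 = - 1" "?e x 0 3 = - 1"
      "?e x (Suc 0) 0 = - x" "?e x (Suc 0) (Suc 0) = x^2 - real b" "?e x (Suc 0) 2 = 0" "?e x (Suc 0) 3 = 0"
      "?e x 2 0 = - 1" "?e x 2 (Suc 0) = 0" "?e x 2 2 = x^2 - real c - 1" "?e x 2 3 = 0" "?e x 3 0 = - 1"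
      "?e x 3 (Suc 0) = 0" "?e x 3 2 = 0" "?e x 3 3 = x^2 - real d - 1" for x
    by (simp_all add: schur_entry_def R_def l_def sc_Nil sc_Cons lv_simps upt_rec)
  have c: "8 - 2 * 4 = (0 :: nat)" by simp
  show ?thesis unfolding R_def[symmetric] l_def[symmetric] invariants.simps matching_data.simps
      det_mat_4 e c of_nat_push
    by (rule allI, Groebner_Basis.algebra)
qed

lemma walk_data_Sccc: "walk_data 7 (sc [(0, 4), (1, 4), (0, 5), (2, 5), (0, 6), (3, 6)]) (lv [a, b, c, d])
    (invariants Sccc a b c d)"
proof -
  define R where "R = sc [(0, 4), (1, 4), (0, 5), (2, 5), (0, 6), (3, 6)]"
  define l where "l = lv [a, b, c, d]"
  let ?w = "core_walks 7 R l"
  note ev = R_def l_def sc_Nil sc_Cons lv_simps core_walks_numeral upt_rec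
  have w1: "?w (Suc 0) 0 = a + 3" "?w (Suc 0) (Suc 0) = b + 1" "?w (Suc 0) 2 = c + 1" "?w (Suc 0) 3 = d + 1"
      "?w (Suc 0) 4 = 2" "?w (Suc 0) 5 = 2" "?w (Suc 0) 6 = 2"
    by (simp_all add: ev)
  have w2: "?w 2 0 = a + 6" "?w 2 (Suc 0) = b + 2" "?w 2 2 = c + 2" "?w 2 3 = d + 2" "?w 2 4 = a + b + 4"
      "?w 2 5 = a + c + 4" "?w 2 6 = a + d + 4"
    by (simp_all add: ev algebra_simps power2_eq_square)
  have w3: "?w 3 0 = a^2 + 6*a + b + c + d + 12" "?w 3 (Suc 0) = b^2 + a + 2*b + 4" "?w 3 2 = c^2 + a + 2*c + 4"
      "?w 3 3 = d^2 + a + 2*d + 4" "?w 3 4 = a + b + 8" "?w 3 5 = a + c + 8" "?w 3 6 = a + d + 8"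
    by (simp_all add: ev algebra_simps power2_eq_square)
  have w4: "?w 4 0 = a^2 + 9*a + b + c + d + 24" "?w 4 (Suc 0) = b^2 + a + 3*b + 8" "?w 4 2 = c^2 + a + 3*c + 8"
      "?w 4 3 = d^2 + a + 3*d + 8" "?w 4 4 = a^2 + b^2 + 7*a + 3*b + c + d + 16"
      "?w 4 5 = a^2 + c^2 + 7*a + b + 3*c + d + 16" "?w 4 6 = a^2 + d^2 + 7*a + b + c + 3*d + 16"
    by (simp_all add: ev algebra_simps power2_eq_square)
  have l: "l 0 = a" "l (Suc 0) = b" "l 2 = c" "l 3 = d" "l 4 = 0" "l 5 = 0" "l 6 = 0"
    by (simp_all add: l_def lv_simps)
  have u: "[0..<7] = [0, (Suc 0), 2, 3, 4, 5, 6]" by (simp add: upt_rec)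
  show ?thesis unfolding R_def[symmetric] l_def[symmetric] walk_data_eval u w1 w2 w3 w4 l
    by (intro conjI; Groebner_Basis.algebra)
qed

lemma matching_data_Sccc: "matching_data 4 7 (sc [(0, 4), (1, 4), (0, 5), (2, 5), (0, 6), (3, 6)]) (lv [a, b, c,
    d]) (invariants Sccc a b c d)"
proof -
  define R where "R = sc [(0, 4), (1, 4), (0, 5), (2, 5), (0, 6), (3, 6)]"
  define l where "l = lv [a, b, c, d]"
  let ?e = "schur_entry 4 7 R l"
  have e: "?e x 0 0 = x^2 - real a - 3" "?e x 0 (Suc 0) = - 1" "?e x 0 2 = - 1" "?e x 0 3 = - 1"
      "?e x (Suc 0) 0 = - 1" "?e x (Suc 0) (Suc 0) = x^2 - real b - 1" "?e x (Suc 0) 2 = 0" "?e x (Suc 0) 3 = 0"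
      "?e x 2 0 = - 1" "?e x 2 (Suc 0) = 0" "?e x 2 2 = x^2 - real c - 1" "?e x 2 3 = 0" "?e x 3 0 = - 1"
      "?e x 3 (Suc 0) = 0" "?e x 3 2 = 0" "?e x 3 3 = x^2 - real d - 1" for x
    by (simp_all add: schur_entry_def R_def l_def sc_Nil sc_Cons lv_simps upt_rec)
  have c: "8 - 2 * 4 = (0 :: nat)" by simp
  show ?thesis unfolding R_def[symmetric] l_def[symmetric] invariants.simps matching_data.simps
      det_mat_4 e c of_nat_push
    by (rule allI, Groebner_Basis.algebra)
qed

lemma walk_data_Td: "walk_data 5 (sc [(0, 3), (0, 4), (1, 4), (2, 4)]) (lv [a, b, c, d]) (invariants Td a b c d)"
proof -
  define R where "R = sc [(0, 3), (0, 4), (1, 4), (2, 4)]"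
  define l where "l = lv [a, b, c, d]"
  let ?w = "core_walks 5 R l"
  note ev = R_def l_def sc_Nil sc_Cons lv_simps core_walks_numeral upt_rec
  have w1: "?w (Suc 0) 0 = a + 2" "?w (Suc 0) (Suc 0) = b + 1" "?w (Suc 0) 2 = c + 1" "?w (Suc 0) 3 = d + 1"
      "?w (Suc 0) 4 = 3"
    by (simp_all add: ev)
  have w2: "?w 2 0 = a + d + 4" "?w 2 (Suc 0) = b + 3" "?w 2 2 = c + 3" "?w 2 3 = a + d + 2" "?w 2 4 = a + b + c + 4"
    by (simp_all add: ev algebra_simps power2_eq_square)
  have w3: "?w 3 0 = a^2 + 4*a + b + c + d + 6" "?w 3 (Suc 0) = b^2 + a + 2*b + c + 4"
      "?w 3 2 = c^2 + a + b + 2*c + 4" "?w 3 3 = d^2 + a + 2*d + 4" "?w 3 4 = a + b + c + d + 10"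
    by (simp_all add: ev algebra_simps power2_eq_square)
  have w4: "?w 4 0 = a^2 + a*d + d^2 + 6*a + b + c + 3*d + 14" "?w 4 (Suc 0) = b^2 + a + 4*b + c + d + 10"
      "?w 4 2 = c^2 + a + b + 4*c + d + 10" "?w 4 3 = a^2 + a*d + d^2 + 4*a + b + c + 3*d + 6"
      "?w 4 4 = a^2 + b^2 + c^2 + 6*a + 4*b + 4*c + d + 14"
    by (simp_all add: ev algebra_simps power2_eq_square)
  have l: "l 0 = a" "l (Suc 0) = b" "l 2 = c" "l 3 = d" "l 4 = 0"
    by (simp_all add: l_def lv_simps)
  have u: "[0..<5] = [0, (Suc 0), 2, 3, 4]" by (simp add: upt_rec)
  show ?thesis unfolding R_def[symmetric] l_def[symmetric] walk_data_eval u w1 w2 w3 w4 l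
    by (intro conjI; Groebner_Basis.algebra)
qed

lemma matching_data_Td: "matching_data 4 5 (sc [(0, 3), (0, 4), (1, 4), (2, 4)]) (lv [a, b, c, d]) (invariants Td
    a b c d)"
proof -
  define R where "R = sc [(0, 3), (0, 4), (1, 4), (2, 4)]"
  define l where "l = lv [a, b, c, d]"
  let ?e = "schur_entry 4 5 R l"
  have e: "?e x 0 0 = x^2 - real a - 1" "?e x 0 (Suc 0) = - 1" "?e x 0 2 = - 1" "?e x 0 3 = - x"
      "?e x (Suc 0) 0 = - 1" "?e x (Suc 0) (Suc 0) = x^2 - real b - 1" "?e x (Suc 0) 2 = - 1"
      "?e x (Suc 0) 3 = 0" "?e x 2 0 = - 1" "?e x 2 (Suc 0) = - 1" "?e x 2 2 = x^2 - real c - 1" "?e x 2 3 = 0"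
      "?e x 3 0 = - x" "?e x 3 (Suc 0) = 0" "?e x 3 2 = 0" "?e x 3 3 = x^2 - real d" for x
    by (simp_all add: schur_entry_def R_def l_def sc_Nil sc_Cons lv_simps upt_rec)
  have c: "8 - 2 * 4 = (0 :: nat)" by simp
  show ?thesis unfolding R_def[symmetric] l_def[symmetric] invariants.simps matching_data.simps
      det_mat_4 e c of_nat_push
    by (rule allI, Groebner_Basis.algebra)
qed

lemma walk_data_Tc: "walk_data 6 (sc [(0, 4), (1, 4), (2, 4), (0, 5), (3, 5)]) (lv [a, b, c, d]) (invariants Tc a
    b c d)"
proof -
  define R where "R = sc [(0, 4), (1, 4), (2, 4), (0, 5), (3, 5)]"
  define l where "l = lv [a, b, c, d]"
  let ?w = "core_walks 6 R l"
  note ev = R_def l_def sc_Nil sc_Cons lv_simps core_walks_numeral upt_rec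
  have w1: "?w (Suc 0) 0 = a + 2" "?w (Suc 0) (Suc 0) = b + 1" "?w (Suc 0) 2 = c + 1" "?w (Suc 0) 3 = d + 1"
      "?w (Suc 0) 4 = 3" "?w (Suc 0) 5 = 2"
    by (simp_all add: ev)
  have w2: "?w 2 0 = a + 5" "?w 2 (Suc 0) = b + 3" "?w 2 2 = c + 3" "?w 2 3 = d + 2" "?w 2 4 = a + b + c + 4"
      "?w 2 5 = a + d + 3"
    by (simp_all add: ev algebra_simps power2_eq_square)
  have w3: "?w 3 0 = a^2 + 4*a + b + c + d + 7" "?w 3 (Suc 0) = b^2 + a + 2*b + c + 4"
      "?w 3 2 = c^2 + a + b + 2*c + 4" "?w 3 3 = d^2 + a + 2*d + 3" "?w 3 4 = a + b + c + 11" "?w 3 5 = a + d + 7"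
    by (simp_all add: ev algebra_simps power2_eq_square)
  have w4: "?w 4 0 = a^2 + 7*a + b + c + d + 18" "?w 4 (Suc 0) = b^2 + a + 4*b + c + 11"
      "?w 4 2 = c^2 + a + b + 4*c + 11" "?w 4 3 = d^2 + a + 3*d + 7"
      "?w 4 4 = a^2 + b^2 + c^2 + 6*a + 4*b + 4*c + d + 15" "?w 4 5 = a^2 + d^2 + 5*a + b + c + 3*d + 10"
    by (simp_all add: ev algebra_simps power2_eq_square)
  have l: "l 0 = a" "l (Suc 0) = b" "l 2 = c" "l 3 = d" "l 4 = 0" "l 5 = 0"
    by (simp_all add: l_def lv_simps)
  have u: "[0..<6] = [0, (Suc 0), 2, 3, 4, 5]" by (simp add: upt_rec)
  show ?thesis unfolding R_def[symmetric] l_def[symmetric] walk_data_eval u w1 w2 w3 w4 l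
    by (intro conjI; Groebner_Basis.algebra)
qed

lemma matching_data_Tc: "matching_data 4 6 (sc [(0, 4), (1, 4), (2, 4), (0, 5), (3, 5)]) (lv [a, b, c, d])
    (invariants Tc a b c d)"
proof -
  define R where "R = sc [(0, 4), (1, 4), (2, 4), (0, 5), (3, 5)]"
  define l where "l = lv [a, b, c, d]"
  let ?e = "schur_entry 4 6 R l"
  have e: "?e x 0 0 = x^2 - real a - 2" "?e x 0 (Suc 0) = - 1" "?e x 0 2 = - 1" "?e x 0 3 = - 1"
      "?e x (Suc 0) 0 = - 1" "?e x (Suc 0) (Suc 0) = x^2 - real b - 1" "?e x (Suc 0) 2 = - 1"
      "?e x (Suc 0) 3 = 0" "?e x 2 0 = - 1" "?e x 2 (Suc 0) = - 1" "?e x 2 2 = x^2 - real c - 1" "?e x 2 3 = 0"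
      "?e x 3 0 = - 1" "?e x 3 (Suc 0) = 0" "?e x 3 2 = 0" "?e x 3 3 = x^2 - real d - 1" for x
    by (simp_all add: schur_entry_def R_def l_def sc_Nil sc_Cons lv_simps upt_rec)
  have c: "8 - 2 * 4 = (0 :: nat)" by simp
  show ?thesis unfolding R_def[symmetric] l_def[symmetric] invariants.simps matching_data.simps
      det_mat_4 e c of_nat_push
    by (rule allI, Groebner_Basis.algebra)
qed

lemma walk_data_Q: "walk_data 5 (sc [(0, 4), (1, 4), (2, 4), (3, 4)]) (lv [a, b, c, d]) (invariants Q a b c d)"
proof -
  define R where "R = sc [(0, 4), (1, 4), (2, 4), (3, 4)]"
  define l where "l = lv [a, b, c, d]"
  let ?w = "core_walks 5 R l"
  note ev = R_def l_def sc_Nil sc_Cons lv_simps core_walks_numeral upt_rec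
  have w1: "?w (Suc 0) 0 = a + 1" "?w (Suc 0) (Suc 0) = b + 1" "?w (Suc 0) 2 = c + 1" "?w (Suc 0) 3 = d + 1"
      "?w (Suc 0) 4 = 4"
    by (simp_all add: ev)
  have w2: "?w 2 0 = a + 4" "?w 2 (Suc 0) = b + 4" "?w 2 2 = c + 4" "?w 2 3 = d + 4" "?w 2 4 = a + b + c + d + 4"
    by (simp_all add: ev algebra_simps power2_eq_square)
  have w3: "?w 3 0 = a^2 + 2*a + b + c + d + 4" "?w 3 (Suc 0) = b^2 + a + 2*b + c + d + 4"
      "?w 3 2 = c^2 + a + b + 2*c + d + 4" "?w 3 3 = d^2 + a + b + c + 2*d + 4" "?w 3 4 = a + b + c + d + 16"
    by (simp_all add: ev algebra_simps power2_eq_square)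
  have w4: "?w 4 0 = a^2 + 5*a + b + c + d + 16" "?w 4 (Suc 0) = b^2 + a + 5*b + c + d + 16"
      "?w 4 2 = c^2 + a + b + 5*c + d + 16" "?w 4 3 = d^2 + a + b + c + 5*d + 16"
      "?w 4 4 = a^2 + b^2 + c^2 + d^2 + 5*a + 5*b + 5*c + 5*d + 16"
    by (simp_all add: ev algebra_simps power2_eq_square)
  have l: "l 0 = a" "l (Suc 0) = b" "l 2 = c" "l 3 = d" "l 4 = 0"
    by (simp_all add: l_def lv_simps)
  have u: "[0..<5] = [0, (Suc 0), 2, 3, 4]" by (simp add: upt_rec)
  show ?thesis unfolding R_def[symmetric] l_def[symmetric] walk_data_eval u w1 w2 w3 w4 l
    by (intro conjI; Groebner_Basis.algebra)
qed

lemma matching_data_Q: "matching_data 4 5 (sc [(0, 4), (1, 4), (2, 4), (3, 4)]) (lv [a, b, c, d]) (invariants Q a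
    b c d)"
proof -
  define R where "R = sc [(0, 4), (1, 4), (2, 4), (3, 4)]"
  define l where "l = lv [a, b, c, d]"
  let ?e = "schur_entry 4 5 R l"
  have e: "?e x 0 0 = x^2 - real a - 1" "?e x 0 (Suc 0) = - 1" "?e x 0 2 = - 1" "?e x 0 3 = - 1"
      "?e x (Suc 0) 0 = - 1" "?e x (Suc 0) (Suc 0) = x^2 - real b - 1" "?e x (Suc 0) 2 = - 1"
      "?e x (Suc 0) 3 = - 1" "?e x 2 0 = - 1" "?e x 2 (Suc 0) = - 1" "?e x 2 2 = x^2 - real c - 1"
      "?e x 2 3 = - 1" "?e x 3 0 = - 1" "?e x 3 (Suc 0) = - 1" "?e x 3 2 = - 1" "?e x 3 3 = x^2 - real d - 1" for x
    by (simp_all add: schur_entry_def R_def l_def sc_Nil sc_Cons lv_simps upt_rec)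
  have c: "8 - 2 * 4 = (0 :: nat)" by simp
  show ?thesis unfolding R_def[symmetric] l_def[symmetric] invariants.simps matching_data.simps
      det_mat_4 e c of_nat_push
    by (rule allI, Groebner_Basis.algebra)
qed

section \<open>Growing a shape\<close>

fun valid :: "shape \<Rightarrow> nat \<Rightarrow> nat \<Rightarrow> nat \<Rightarrow> nat \<Rightarrow> bool" where
"valid Star a b c d \<longleftrightarrow> a > 0 \<and> b = 0 \<and> c = 0 \<and> d = 0"
| "valid Pd a b c d \<longleftrightarrow> a > 0 \<and> b > 0 \<and> c = 0 \<and> d = 0"
| "valid Pc a b c d \<longleftrightarrow> a > 0 \<and> b > 0 \<and> c = 0 \<and> d = 0"
| "valid Pdd a b c d \<longleftrightarrow> a > 0 \<and> b > 0 \<and> c > 0 \<and> d = 0"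
| "valid Pdc a b c d \<longleftrightarrow> a > 0 \<and> c > 0 \<and> d = 0"
| "valid Pcc a b c d \<longleftrightarrow> a > 0 \<and> c > 0 \<and> d = 0"
| "valid Tri a b c d \<longleftrightarrow> a > 0 \<and> b > 0 \<and> c > 0 \<and> d = 0"
| "valid Pddd a b c d \<longleftrightarrow> a > 0 \<and> b > 0 \<and> c > 0 \<and> d > 0"
| "valid Pddc a b c d \<longleftrightarrow> a > 0 \<and> b > 0 \<and> d > 0"
| "valid Pdcd a b c d \<longleftrightarrow> a > 0 \<and> b > 0 \<and> c > 0 \<and> d > 0"
| "valid Pcdc a b c d \<longleftrightarrow> a > 0 \<and> b > 0 \<and> c > 0 \<and> d > 0"
| "valid Pdcc a b c d \<longleftrightarrow> a > 0 \<and> d > 0"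
| "valid Pccc a b c d \<longleftrightarrow> a > 0 \<and> d > 0"
| "valid Sddd a b c d \<longleftrightarrow> a > 0 \<and> b > 0 \<and> c > 0 \<and> d > 0"
| "valid Sddc a b c d \<longleftrightarrow> a > 0 \<and> b > 0 \<and> c > 0 \<and> d > 0"
| "valid Sdcc a b c d \<longleftrightarrow> b > 0 \<and> c > 0 \<and> d > 0"
| "valid Sccc a b c d \<longleftrightarrow> b > 0 \<and> c > 0 \<and> d > 0"
| "valid Td a b c d \<longleftrightarrow> b > 0 \<and> c > 0 \<and> d > 0"
| "valid Tc a b c d \<longleftrightarrow> b > 0 \<and> c > 0 \<and> d > 0"
| "valid Q a b c d \<longleftrightarrow> a > 0 \<and> b > 0 \<and> c > 0 \<and> d > 0"

definition has_shape :: "'a set \<Rightarrow> 'a rel \<Rightarrow> shape \<Rightarrow> nat \<Rightarrow> nat \<Rightarrow> nat \<Rightarrow> nat \<Rightarrow> bool" where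
  "has_shape V E s a b c d \<longleftrightarrow> model V E (core_size s) (sc (core_edges s)) (lv [a, b, c, d])"

text \<open>The hypotheses of \<open>model_relabel\<close> in a form that can be checked by
  evaluation: \<open>q ! i\<close> is the old core vertex that plays the role of vertex
  \<open>i\<close> of \<open>s\<close>. It serves both to identify a grown core with a shape and to
  express automorphisms of a core.\<close>

definition relabels :: "nat \<Rightarrow> (nat \<times> nat) list \<Rightarrow> (nat \<Rightarrow> nat) \<Rightarrow> nat list \<Rightarrow> shape \<Rightarrow> nat list \<Rightarrow> bool" where
  "relabels k es l q s p \<longleftrightarrow> core_size s = k \<and> length q = k \<and> distinct q \<and> (\<forall>i\<in>set q. i < k) \<and>
     (\<forall>(i, j)\<in>set (core_edges s). i < k \<and> j < k \<and> ((q ! i, q ! j) \<in> set es \<or> (q ! j, q ! i) \<in> set es)) \<and>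
     length es = length (core_edges s) \<and>
     (\<forall>(i, j)\<in>set es. (i, j) \<in> set (map (\<lambda>(i, j). (q ! i, q ! j)) (core_edges s)) \<or>
        (j, i) \<in> set (map (\<lambda>(i, j). (q ! i, q ! j)) (core_edges s))) \<and>
     map (lv p) [0..<k] = map (\<lambda>i. l (q ! i)) [0..<k]"

lemma relabels_has_shape:
  assumes M: "model V E k (sc es) l" and r: "relabels k es l q s [a, b, c, d]"
  shows "has_shape V E s a b c d"
proof -
  define p where "p i = (if i < k then q ! i else i)" for i
  have q: "length q = k" "distinct q" "\<And>i. i \<in> set q \<Longrightarrow> i < k" and k: "core_size s = k"
    using r by (auto simp: relabels_def)
  have qk: "q ! i < k" if "i < k" for i using q that by auto
  have inj: "q ! i = q ! j \<longleftrightarrow> i = j" if "i < k" "j < k" for i j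
    using q that by (auto simp: nth_eq_iff_index_eq)
  have "inj_on p {..<k}" by (auto simp: inj_on_def p_def inj)
  moreover have "p ` {..<k} \<subseteq> {..<k}" by (auto simp: p_def qk)
  ultimately have "bij_betw p {..<k} {..<k}" by (simp add: bij_betw_def endo_inj_surj)
  then have p: "p permutes {..<k}" by (rule bij_imp_permutes) (simp add: p_def)
  have es1: "i < k \<and> j < k \<and> ((q ! i, q ! j) \<in> set es \<or> (q ! j, q ! i) \<in> set es)" if "(i, j) \<in> set (core_edges
      s)" for i j
    using r that by (auto simp: relabels_def)
  have es2: "\<exists>x y. (x, y) \<in> set (core_edges s) \<and> ((i, j) = (q ! x, q ! y) \<or> (j, i) = (q ! x, q ! y))" if "(i, j)
      \<in> set es" for i j
    using r that by (fastforce simp: relabels_def)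
  have "(i, j) \<in> sc (core_edges s) \<longleftrightarrow> i < k \<and> j < k \<and> (p i, p j) \<in> sc es" for i j
  proof
    assume "(i, j) \<in> sc (core_edges s)"
    then show "i < k \<and> j < k \<and> (p i, p j) \<in> sc es" using es1 by (auto simp: sc_def p_def)
  next
    assume a: "i < k \<and> j < k \<and> (p i, p j) \<in> sc es"
    then have "(q ! i, q ! j) \<in> set es \<or> (q ! j, q ! i) \<in> set es" by (auto simp: sc_def p_def)
    then obtain x y where xy: "(x, y) \<in> set (core_edges s)" "(q ! i, q ! j) = (q ! x, q ! y) \<or> (q ! j, q ! i) =
        (q ! x, q ! y)"
      using es2 by blast
    then have "(i, j) = (x, y) \<or> (j, i) = (x, y)" using es1[OF xy(1)] a by (auto simp: inj)
    then show "(i, j) \<in> sc (core_edges s)" using xy(1) by (auto simp: sc_def)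
  qed
  moreover have "lv [a, b, c, d] i = l (p i)" if "i < k" for i
    using r that by (auto simp: relabels_def p_def)
  ultimately show ?thesis
    unfolding has_shape_def k using M p by (intro model_relabel[OF M p]) auto
qed

definition shaped :: "'a set \<Rightarrow> 'a rel \<Rightarrow> nat \<Rightarrow> bool" where
  "shaped V E n \<longleftrightarrow> (\<exists>s a b c d. cover_size s = n \<and> valid s a b c d \<and> has_shape V E s a b c d)"

lemma shapedI:
  assumes "model V E k (sc es) l" "relabels k es l q s [a, b, c, d]" "valid s a b c d" "cover_size s = n"
  shows "shaped V E n"
  using assms relabels_has_shape unfolding shaped_def by blast

lemmas relabel_simps = relabels_def lv_simps upt_rec

abbreviation grown_core :: "'a set \<Rightarrow> 'a rel \<Rightarrow> shape \<Rightarrow> nat \<Rightarrow> nat list \<Rightarrow> nat \<Rightarrow> bool" where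
  "grown_core V E s i p m \<equiv>
     model V E (Suc (core_size s)) (sc ((i, core_size s) # core_edges s)) ((lv p)(core_size s := m))"

text \<open>The promoted leaf gets index \<open>core_size s\<close> and no leaves, while vertex
  \<open>i\<close> loses one; the centre of the new star gets the index after that.\<close>

abbreviation grown_leaf :: "'a set \<Rightarrow> 'a rel \<Rightarrow> shape \<Rightarrow> nat \<Rightarrow> nat list \<Rightarrow> nat \<Rightarrow> bool" where
  "grown_leaf V E s i p m \<equiv>
     model V E (Suc (Suc (core_size s))) (sc ((core_size s, Suc (core_size s)) # (i, core_size s) # core_edges s))
       ((lv p)(i := lv p i - 1, core_size s := 0, Suc (core_size s) := m))"

section \<open>All ways of attaching one star to a shape with at most three cover vertices\<close>

lemma grow_Star_core_0:
  assumes M: "grown_core V E Star 0 [a, b, c, d] m"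
    and v: "valid Star a b c d" "0 < m"
  shows "shaped V E (Suc (cover_size Star))"
  by (rule shapedI[OF M, of "[0, 1]" Pd a m 0 0]) (use v in \<open>auto simp: relabel_simps\<close>)

text \<open>For \<open>a = 1\<close> the old centre would be left without leaves. That tree is a
  single edge, and \<open>grow_shaped\<close> avoids the case by exchanging its ends.\<close>

lemma grow_Star_leaf_0:
  assumes M: "grown_leaf V E Star 0 [a, b, c, d] m"
    and v: "valid Star a b c d" "0 < m" "0 < lv [a, b, c, d] 0" "1 < a"
  shows "shaped V E (Suc (cover_size Star))"
  by (rule shapedI[OF M, of "[0, 2, 1]" Pc "(a - 1)" m 0 0]) (use v in \<open>auto simp: relabel_simps\<close>)

lemma grow_Pd_core_0:
  assumes M: "grown_core V E Pd 0 [a, b, c, d] m"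
    and v: "valid Pd a b c d" "0 < m"
  shows "shaped V E (Suc (cover_size Pd))"
  by (rule shapedI[OF M, of "[1, 0, 2]" Pdd b a m 0]) (use v in \<open>auto simp: relabel_simps\<close>)

lemma grow_Pd_core_1:
  assumes M: "grown_core V E Pd 1 [a, b, c, d] m"
    and v: "valid Pd a b c d" "0 < m"
  shows "shaped V E (Suc (cover_size Pd))"
  by (rule shapedI[OF M, of "[0, 1, 2]" Pdd a b m 0]) (use v in \<open>auto simp: relabel_simps\<close>)

lemma grow_Pd_leaf_0:
  assumes M: "grown_leaf V E Pd 0 [a, b, c, d] m"
    and v: "valid Pd a b c d" "0 < m" "0 < lv [a, b, c, d] 0"
  shows "shaped V E (Suc (cover_size Pd))"
  by (rule shapedI[OF M, of "[1, 0, 3, 2]" Pdc b "(a - 1)" m 0]) (use v in \<open>auto simp: relabel_simps\<close>)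

lemma grow_Pd_leaf_1:
  assumes M: "grown_leaf V E Pd 1 [a, b, c, d] m"
    and v: "valid Pd a b c d" "0 < m" "0 < lv [a, b, c, d] 1"
  shows "shaped V E (Suc (cover_size Pd))"
  by (rule shapedI[OF M, of "[0, 1, 3, 2]" Pdc a "(b - 1)" m 0]) (use v in \<open>auto simp: relabel_simps\<close>)

lemma grow_Pc_core_0:
  assumes M: "grown_core V E Pc 0 [a, b, c, d] m"
    and v: "valid Pc a b c d" "0 < m"
  shows "shaped V E (Suc (cover_size Pc))"
  by (rule shapedI[OF M, of "[3, 0, 1, 2]" Pdc m a b 0]) (use v in \<open>auto simp: relabel_simps\<close>)

lemma grow_Pc_core_1:
  assumes M: "grown_core V E Pc 1 [a, b, c, d] m"
    and v: "valid Pc a b c d" "0 < m"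
  shows "shaped V E (Suc (cover_size Pc))"
  by (rule shapedI[OF M, of "[3, 1, 0, 2]" Pdc m b a 0]) (use v in \<open>auto simp: relabel_simps\<close>)

lemma grow_Pc_core_2:
  assumes M: "grown_core V E Pc 2 [a, b, c, d] m"
    and v: "valid Pc a b c d" "0 < m"
  shows "shaped V E (Suc (cover_size Pc))"
  by (rule shapedI[OF M, of "[0, 1, 3, 2]" Tri a b m 0]) (use v in \<open>auto simp: relabel_simps\<close>)

lemma grow_Pc_leaf_0:
  assumes M: "grown_leaf V E Pc 0 [a, b, c, d] m"
    and v: "valid Pc a b c d" "0 < m" "0 < lv [a, b, c, d] 0"
  shows "shaped V E (Suc (cover_size Pc))"
  by (rule shapedI[OF M, of "[1, 0, 4, 2, 3]" Pcc b "(a - 1)" m 0]) (use v in \<open>auto simp: relabel_simps\<close>)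

lemma grow_Pc_leaf_1:
  assumes M: "grown_leaf V E Pc 1 [a, b, c, d] m"
    and v: "valid Pc a b c d" "0 < m" "0 < lv [a, b, c, d] 1"
  shows "shaped V E (Suc (cover_size Pc))"
  by (rule shapedI[OF M, of "[0, 1, 4, 2, 3]" Pcc a "(b - 1)" m 0]) (use v in \<open>auto simp: relabel_simps\<close>)

lemma grow_Pdd_core_0:
  assumes M: "grown_core V E Pdd 0 [a, b, c, d] m"
    and v: "valid Pdd a b c d" "0 < m"
  shows "shaped V E (Suc (cover_size Pdd))"
  by (rule shapedI[OF M, of "[2, 1, 0, 3]" Pddd c b a m]) (use v in \<open>auto simp: relabel_simps\<close>)

lemma grow_Pdd_core_1:
  assumes M: "grown_core V E Pdd 1 [a, b, c, d] m"
    and v: "valid Pdd a b c d" "0 < m"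
  shows "shaped V E (Suc (cover_size Pdd))"
  by (rule shapedI[OF M, of "[1, 0, 2, 3]" Sddd b a c m]) (use v in \<open>auto simp: relabel_simps\<close>)

lemma grow_Pdd_core_2:
  assumes M: "grown_core V E Pdd 2 [a, b, c, d] m"
    and v: "valid Pdd a b c d" "0 < m"
  shows "shaped V E (Suc (cover_size Pdd))"
  by (rule shapedI[OF M, of "[0, 1, 2, 3]" Pddd a b c m]) (use v in \<open>auto simp: relabel_simps\<close>)

lemma grow_Pdd_leaf_0:
  assumes M: "grown_leaf V E Pdd 0 [a, b, c, d] m"
    and v: "valid Pdd a b c d" "0 < m" "0 < lv [a, b, c, d] 0"
  shows "shaped V E (Suc (cover_size Pdd))"
  by (rule shapedI[OF M, of "[2, 1, 0, 4, 3]" Pddc c b "(a - 1)" m]) (use v in \<open>auto simp: relabel_simps\<close>)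

lemma grow_Pdd_leaf_1:
  assumes M: "grown_leaf V E Pdd 1 [a, b, c, d] m"
    and v: "valid Pdd a b c d" "0 < m" "0 < lv [a, b, c, d] 1"
  shows "shaped V E (Suc (cover_size Pdd))"
proof -
  consider "b - 1 = 0" | "b - 1 > 0" by linarith
  then show ?thesis
  proof cases
    case 1
    \<comment> \<open>The old centre has lost its only leaf. It becomes the connector of
      \<open>Td\<close>, and the promoted leaf becomes the leafless cover vertex.\<close>
    show ?thesis by (rule shapedI[OF M, of "[3, 0, 2, 4, 1]" Td 0 a c m]) (use v 1 in \<open>auto simp: relabel_simps\<close>)
  next
    case 2
    show ?thesis by (rule shapedI[OF M, of "[1, 0, 2, 4, 3]" Sddc "(b - 1)" a c m]) (use v 2 in \<open>auto simp:
        relabel_simps\<close>)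
  qed
qed

lemma grow_Pdd_leaf_2:
  assumes M: "grown_leaf V E Pdd 2 [a, b, c, d] m"
    and v: "valid Pdd a b c d" "0 < m" "0 < lv [a, b, c, d] 2"
  shows "shaped V E (Suc (cover_size Pdd))"
  by (rule shapedI[OF M, of "[0, 1, 2, 4, 3]" Pddc a b "(c - 1)" m]) (use v in \<open>auto simp: relabel_simps\<close>)

lemma grow_Pdc_core_0:
  assumes M: "grown_core V E Pdc 0 [a, b, c, d] m"
    and v: "valid Pdc a b c d" "0 < m"
  shows "shaped V E (Suc (cover_size Pdc))"
  by (rule shapedI[OF M, of "[4, 0, 1, 2, 3]" Pddc m a b c]) (use v in \<open>auto simp: relabel_simps\<close>)

lemma grow_Pdc_core_1:
  assumes M: "grown_core V E Pdc 1 [a, b, c, d] m"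
    and v: "valid Pdc a b c d" "0 < m"
  shows "shaped V E (Suc (cover_size Pdc))"
proof -
  consider "b = 0" | "b > 0" by linarith
  then show ?thesis
  proof cases
    case 1
    \<comment> \<open>Vertex 1 and the connector 3 are both leafless and exchange their roles:
      vertex 1 is the connector of \<open>Td\<close>.\<close>
    show ?thesis by (rule shapedI[OF M, of "[3, 0, 4, 2, 1]" Td 0 a m c]) (use v 1 in \<open>auto simp: relabel_simps\<close>)
  next
    case 2
    show ?thesis by (rule shapedI[OF M, of "[1, 0, 4, 2, 3]" Sddc b a m c]) (use v 2 in \<open>auto simp: relabel_simps\<close>)
  qed
qed

lemma grow_Pdc_core_2:
  assumes M: "grown_core V E Pdc 2 [a, b, c, d] m"
    and v: "valid Pdc a b c d" "0 < m"
  shows "shaped V E (Suc (cover_size Pdc))"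
proof -
  consider "b = 0" | "b > 0" by linarith
  then show ?thesis
  proof cases
    case 1
    \<comment> \<open>The path is read from its new end. The old connector becomes a leafless cover
      vertex, and vertex 1 becomes the connector.\<close>
    show ?thesis by (rule shapedI[OF M, of "[4, 2, 3, 0, 1]" Pddc m c 0 a]) (use v 1 in \<open>auto simp: relabel_simps\<close>)
  next
    case 2
    show ?thesis by (rule shapedI[OF M, of "[0, 1, 2, 4, 3]" Pdcd a b c m]) (use v 2 in \<open>auto simp: relabel_simps\<close>)
  qed
qed

lemma grow_Pdc_core_3:
  assumes M: "grown_core V E Pdc 3 [a, b, c, d] m"
    and v: "valid Pdc a b c d" "0 < m"
  shows "shaped V E (Suc (cover_size Pdc))"
  by (rule shapedI[OF M, of "[1, 2, 4, 0, 3]" Td b c m a]) (use v in \<open>auto simp: relabel_simps\<close>)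

lemma grow_Pdc_leaf_0:
  assumes M: "grown_leaf V E Pdc 0 [a, b, c, d] m"
    and v: "valid Pdc a b c d" "0 < m" "0 < lv [a, b, c, d] 0"
  shows "shaped V E (Suc (cover_size Pdc))"
proof -
  consider "a - 1 = 0" | "a - 1 > 0" "b = 0" | "a - 1 > 0" "b > 0" by linarith
  then show ?thesis
  proof cases
    case 1
    \<comment> \<open>Vertex 0 has lost its only leaf and becomes a connector; the promoted leaf
      becomes a leafless cover vertex.\<close>
    show ?thesis by (rule shapedI[OF M, of "[5, 4, 1, 2, 0, 3]" Pdcc m 0 b c]) (use v 1 in \<open>auto simp: relabel_simps\<close>)
  next
    case 2
    \<comment> \<open>The leafless vertex 1 becomes a connector and the old connector a leafless
      cover vertex; the promoted leaf is the second connector.\<close>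
    show ?thesis by (rule shapedI[OF M, of "[2, 3, 0, 5, 1, 4]" Pdcc c 0 "(a - 1)" m]) (use v 2 in \<open>auto simp:
        relabel_simps\<close>)
  next
    case 3
    show ?thesis by (rule shapedI[OF M, of "[2, 1, 0, 5, 3, 4]" Pcdc c b "(a - 1)" m]) (use v 3 in \<open>auto simp:
        relabel_simps\<close>)
  qed
qed

lemma grow_Pdc_leaf_1:
  assumes M: "grown_leaf V E Pdc 1 [a, b, c, d] m"
    and v: "valid Pdc a b c d" "0 < m" "0 < lv [a, b, c, d] 1"
  shows "shaped V E (Suc (cover_size Pdc))"
  by (rule shapedI[OF M, of "[1, 0, 2, 5, 3, 4]" Sdcc "(b - 1)" a c m]) (use v in \<open>auto simp: relabel_simps\<close>)

lemma grow_Pdc_leaf_2: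
  assumes M: "grown_leaf V E Pdc 2 [a, b, c, d] m"
    and v: "valid Pdc a b c d" "0 < m" "0 < lv [a, b, c, d] 2"
  shows "shaped V E (Suc (cover_size Pdc))"
  by (rule shapedI[OF M, of "[0, 1, 2, 5, 3, 4]" Pdcc a b "(c - 1)" m]) (use v in \<open>auto simp: relabel_simps\<close>)

lemma grow_Pcc_core_0:
  assumes M: "grown_core V E Pcc 0 [a, b, c, d] m"
    and v: "valid Pcc a b c d" "0 < m"
  shows "shaped V E (Suc (cover_size Pcc))"
  by (rule shapedI[OF M, of "[5, 0, 1, 2, 3, 4]" Pdcc m a b c]) (use v in \<open>auto simp: relabel_simps\<close>)

lemma grow_Pcc_core_1:
  assumes M: "grown_core V E Pcc 1 [a, b, c, d] m"
    and v: "valid Pcc a b c d" "0 < m"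
  shows "shaped V E (Suc (cover_size Pcc))"
  by (rule shapedI[OF M, of "[1, 5, 0, 2, 3, 4]" Sdcc b m a c]) (use v in \<open>auto simp: relabel_simps\<close>)

lemma grow_Pcc_core_2:
  assumes M: "grown_core V E Pcc 2 [a, b, c, d] m"
    and v: "valid Pcc a b c d" "0 < m"
  shows "shaped V E (Suc (cover_size Pcc))"
  by (rule shapedI[OF M, of "[5, 2, 1, 0, 4, 3]" Pdcc m c b a]) (use v in \<open>auto simp: relabel_simps\<close>)

lemma grow_Pcc_core_3:
  assumes M: "grown_core V E Pcc 3 [a, b, c, d] m"
    and v: "valid Pcc a b c d" "0 < m"
  shows "shaped V E (Suc (cover_size Pcc))"
  by (rule shapedI[OF M, of "[1, 0, 5, 2, 3, 4]" Tc b a m c]) (use v in \<open>auto simp: relabel_simps\<close>)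

lemma grow_Pcc_core_4:
  assumes M: "grown_core V E Pcc 4 [a, b, c, d] m"
    and v: "valid Pcc a b c d" "0 < m"
  shows "shaped V E (Suc (cover_size Pcc))"
  by (rule shapedI[OF M, of "[1, 2, 5, 0, 4, 3]" Tc b c m a]) (use v in \<open>auto simp: relabel_simps\<close>)

lemma grow_Pcc_leaf_0:
  assumes M: "grown_leaf V E Pcc 0 [a, b, c, d] m"
    and v: "valid Pcc a b c d" "0 < m" "0 < lv [a, b, c, d] 0"
  shows "shaped V E (Suc (cover_size Pcc))"
  by (rule shapedI[OF M, of "[2, 1, 0, 6, 4, 3, 5]" Pccc c b "(a - 1)" m]) (use v in \<open>auto simp: relabel_simps\<close>)

lemma grow_Pcc_leaf_1:
  assumes M: "grown_leaf V E Pcc 1 [a, b, c, d] m"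
    and v: "valid Pcc a b c d" "0 < m" "0 < lv [a, b, c, d] 1"
  shows "shaped V E (Suc (cover_size Pcc))"
  by (rule shapedI[OF M, of "[1, 0, 2, 6, 3, 4, 5]" Sccc "(b - 1)" a c m]) (use v in \<open>auto simp: relabel_simps\<close>)

lemma grow_Pcc_leaf_2:
  assumes M: "grown_leaf V E Pcc 2 [a, b, c, d] m"
    and v: "valid Pcc a b c d" "0 < m" "0 < lv [a, b, c, d] 2"
  shows "shaped V E (Suc (cover_size Pcc))"
  by (rule shapedI[OF M, of "[0, 1, 2, 6, 3, 4, 5]" Pccc a b "(c - 1)" m]) (use v in \<open>auto simp: relabel_simps\<close>)

lemma grow_Tri_core_0:
  assumes M: "grown_core V E Tri 0 [a, b, c, d] m"
    and v: "valid Tri a b c d" "0 < m"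
  shows "shaped V E (Suc (cover_size Tri))"
  by (rule shapedI[OF M, of "[0, 1, 2, 4, 3]" Td a b c m]) (use v in \<open>auto simp: relabel_simps\<close>)

lemma grow_Tri_core_1:
  assumes M: "grown_core V E Tri 1 [a, b, c, d] m"
    and v: "valid Tri a b c d" "0 < m"
  shows "shaped V E (Suc (cover_size Tri))"
  by (rule shapedI[OF M, of "[1, 0, 2, 4, 3]" Td b a c m]) (use v in \<open>auto simp: relabel_simps\<close>)

lemma grow_Tri_core_2:
  assumes M: "grown_core V E Tri 2 [a, b, c, d] m"
    and v: "valid Tri a b c d" "0 < m"
  shows "shaped V E (Suc (cover_size Tri))"
  by (rule shapedI[OF M, of "[2, 0, 1, 4, 3]" Td c a b m]) (use v in \<open>auto simp: relabel_simps\<close>)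

lemma grow_Tri_core_3:
  assumes M: "grown_core V E Tri 3 [a, b, c, d] m"
    and v: "valid Tri a b c d" "0 < m"
  shows "shaped V E (Suc (cover_size Tri))"
  by (rule shapedI[OF M, of "[0, 1, 2, 4, 3]" Q a b c m]) (use v in \<open>auto simp: relabel_simps\<close>)

lemma grow_Tri_leaf_0:
  assumes M: "grown_leaf V E Tri 0 [a, b, c, d] m"
    and v: "valid Tri a b c d" "0 < m" "0 < lv [a, b, c, d] 0"
  shows "shaped V E (Suc (cover_size Tri))"
  by (rule shapedI[OF M, of "[0, 1, 2, 5, 3, 4]" Tc "(a - 1)" b c m]) (use v in \<open>auto simp: relabel_simps\<close>)

lemma grow_Tri_leaf_1:
  assumes M: "grown_leaf V E Tri 1 [a, b, c, d] m"
    and v: "valid Tri a b c d" "0 < m" "0 < lv [a, b, c, d] 1"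
  shows "shaped V E (Suc (cover_size Tri))"
  by (rule shapedI[OF M, of "[1, 0, 2, 5, 3, 4]" Tc "(b - 1)" a c m]) (use v in \<open>auto simp: relabel_simps\<close>)

lemma grow_Tri_leaf_2:
  assumes M: "grown_leaf V E Tri 2 [a, b, c, d] m"
    and v: "valid Tri a b c d" "0 < m" "0 < lv [a, b, c, d] 2"
  shows "shaped V E (Suc (cover_size Tri))"
  by (rule shapedI[OF M, of "[2, 0, 1, 5, 3, 4]" Tc "(c - 1)" a b m]) (use v in \<open>auto simp: relabel_simps\<close>)

lemma grow_core:
  assumes M: "grown_core V E s i [a, b, c, d] m"
    and v: "valid s a b c d" "0 < m" "cover_size s < 4" and i: "i < core_size s"
  shows "shaped V E (Suc (cover_size s))"
proof (cases s)
  case Star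
  then have "i = 0" using i by auto
  then show ?thesis
  proof -
    assume "i = 0"
    then show ?thesis using grow_Star_core_0[of V E a b c d m] M v i Star by simp
  qed
next
  case Pd
  then have "i = 0 \<or> i = 1" using i by auto
  then show ?thesis
  proof (elim disjE)
    assume "i = 0"
    then show ?thesis using grow_Pd_core_0[of V E a b c d m] M v i Pd by simp
  next
    assume "i = 1"
    then show ?thesis using grow_Pd_core_1[of V E a b c d m] M v i Pd by simp
  qed
next
  case Pc
  then have "i = 0 \<or> i = 1 \<or> i = 2" using i by auto
  then show ?thesis
  proof (elim disjE)
    assume "i = 0"
    then show ?thesis using grow_Pc_core_0[of V E a b c d m] M v i Pc by simp
  next
    assume "i = 1"
    then show ?thesis using grow_Pc_core_1[of V E a b c d m] M v i Pc by simp
  next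
    assume "i = 2"
    then show ?thesis using grow_Pc_core_2[of V E a b c d m] M v i Pc by simp
  qed
next
  case Pdd
  then have "i = 0 \<or> i = 1 \<or> i = 2" using i by auto
  then show ?thesis
  proof (elim disjE)
    assume "i = 0"
    then show ?thesis using grow_Pdd_core_0[of V E a b c d m] M v i Pdd by simp
  next
    assume "i = 1"
    then show ?thesis using grow_Pdd_core_1[of V E a b c d m] M v i Pdd by simp
  next
    assume "i = 2"
    then show ?thesis using grow_Pdd_core_2[of V E a b c d m] M v i Pdd by simp
  qed
next
  case Pdc
  then have "i = 0 \<or> i = 1 \<or> i = 2 \<or> i = 3" using i by auto
  then show ?thesis
  proof (elim disjE)
    assume "i = 0"
    then show ?thesis using grow_Pdc_core_0[of V E a b c d m] M v i Pdc by simp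
  next
    assume "i = 1"
    then show ?thesis using grow_Pdc_core_1[of V E a b c d m] M v i Pdc by simp
  next
    assume "i = 2"
    then show ?thesis using grow_Pdc_core_2[of V E a b c d m] M v i Pdc by simp
  next
    assume "i = 3"
    then show ?thesis using grow_Pdc_core_3[of V E a b c d m] M v i Pdc by simp
  qed
next
  case Pcc
  then have "i = 0 \<or> i = 1 \<or> i = 2 \<or> i = 3 \<or> i = 4" using i by auto
  then show ?thesis
  proof (elim disjE)
    assume "i = 0"
    then show ?thesis using grow_Pcc_core_0[of V E a b c d m] M v i Pcc by simp
  next
    assume "i = 1"
    then show ?thesis using grow_Pcc_core_1[of V E a b c d m] M v i Pcc by simp
  next
    assume "i = 2"
    then show ?thesis using grow_Pcc_core_2[of V E a b c d m] M v i Pcc by simp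
  next
    assume "i = 3"
    then show ?thesis using grow_Pcc_core_3[of V E a b c d m] M v i Pcc by simp
  next
    assume "i = 4"
    then show ?thesis using grow_Pcc_core_4[of V E a b c d m] M v i Pcc by simp
  qed
next
  case Tri
  then have "i = 0 \<or> i = 1 \<or> i = 2 \<or> i = 3" using i by auto
  then show ?thesis
  proof (elim disjE)
    assume "i = 0"
    then show ?thesis using grow_Tri_core_0[of V E a b c d m] M v i Tri by simp
  next
    assume "i = 1"
    then show ?thesis using grow_Tri_core_1[of V E a b c d m] M v i Tri by simp
  next
    assume "i = 2"
    then show ?thesis using grow_Tri_core_2[of V E a b c d m] M v i Tri by simp
  next
    assume "i = 3"
    then show ?thesis using grow_Tri_core_3[of V E a b c d m] M v i Tri by simp
  qed
qed (use v in simp_all)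

lemma grow_leaf:
  assumes M: "grown_leaf V E s i [a, b, c, d] m"
    and v: "valid s a b c d" "0 < m" "cover_size s < 4" and i: "0 < lv [a, b, c, d] i" and S: "s = Star \<Longrightarrow> 1 < a"
  shows "shaped V E (Suc (cover_size s))"
proof (cases s)
  case Star
  then have "i = 0" using i v by (auto simp: lv_def nth_Cons split: if_splits nat.splits)
  then show ?thesis
  proof -
    assume "i = 0"
    then show ?thesis using grow_Star_leaf_0[of V E a b c d m] M v i S Star by simp
  qed
next
  case Pd
  then have "i = 0 \<or> i = 1" using i v by (auto simp: lv_def nth_Cons split: if_splits nat.splits)
  then show ?thesis
  proof (elim disjE)
    assume "i = 0"
    then show ?thesis using grow_Pd_leaf_0[of V E a b c d m] M v i Pd by simp
  next
    assume "i = 1"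
    then show ?thesis using grow_Pd_leaf_1[of V E a b c d m] M v i Pd by simp
  qed
next
  case Pc
  then have "i = 0 \<or> i = 1" using i v by (auto simp: lv_def nth_Cons split: if_splits nat.splits)
  then show ?thesis
  proof (elim disjE)
    assume "i = 0"
    then show ?thesis using grow_Pc_leaf_0[of V E a b c d m] M v i Pc by simp
  next
    assume "i = 1"
    then show ?thesis using grow_Pc_leaf_1[of V E a b c d m] M v i Pc by simp
  qed
next
  case Pdd
  then have "i = 0 \<or> i = 1 \<or> i = 2" using i v by (auto simp: lv_def nth_Cons split: if_splits nat.splits)
  then show ?thesis
  proof (elim disjE)
    assume "i = 0"
    then show ?thesis using grow_Pdd_leaf_0[of V E a b c d m] M v i Pdd by simp
  next
    assume "i = 1"
    then show ?thesis using grow_Pdd_leaf_1[of V E a b c d m] M v i Pdd by simp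
  next
    assume "i = 2"
    then show ?thesis using grow_Pdd_leaf_2[of V E a b c d m] M v i Pdd by simp
  qed
next
  case Pdc
  then have "i = 0 \<or> i = 1 \<or> i = 2" using i v by (auto simp: lv_def nth_Cons split: if_splits nat.splits)
  then show ?thesis
  proof (elim disjE)
    assume "i = 0"
    then show ?thesis using grow_Pdc_leaf_0[of V E a b c d m] M v i Pdc by simp
  next
    assume "i = 1"
    then show ?thesis using grow_Pdc_leaf_1[of V E a b c d m] M v i Pdc by simp
  next
    assume "i = 2"
    then show ?thesis using grow_Pdc_leaf_2[of V E a b c d m] M v i Pdc by simp
  qed
next
  case Pcc
  then have "i = 0 \<or> i = 1 \<or> i = 2" using i v by (auto simp: lv_def nth_Cons split: if_splits nat.splits)
  then show ?thesis
  proof (elim disjE)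
    assume "i = 0"
    then show ?thesis using grow_Pcc_leaf_0[of V E a b c d m] M v i Pcc by simp
  next
    assume "i = 1"
    then show ?thesis using grow_Pcc_leaf_1[of V E a b c d m] M v i Pcc by simp
  next
    assume "i = 2"
    then show ?thesis using grow_Pcc_leaf_2[of V E a b c d m] M v i Pcc by simp
  qed
next
  case Tri
  then have "i = 0 \<or> i = 1 \<or> i = 2" using i v by (auto simp: lv_def nth_Cons split: if_splits nat.splits)
  then show ?thesis
  proof (elim disjE)
    assume "i = 0"
    then show ?thesis using grow_Tri_leaf_0[of V E a b c d m] M v i Tri by simp
  next
    assume "i = 1"
    then show ?thesis using grow_Tri_leaf_1[of V E a b c d m] M v i Tri by simp
  next
    assume "i = 2"
    then show ?thesis using grow_Tri_leaf_2[of V E a b c d m] M v i Tri by simp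
  qed
qed (use v in simp_all)

lemma model_cong:
  assumes "model V E k R l" and "\<And>i. i < k \<Longrightarrow> l i = l' i"
  shows "model V E k R l'"
  using assms unfolding model_def modelled_def by auto

lemma sc_insert: "sc es \<union> {(i, j), (j, i)} = sc ((i, j) # es)"
  by (auto simp: sc_def)

lemma grow_shaped:
  assumes H: "has_shape V E s a b c d" and v: "valid s a b c d" and c4: "cover_size s < 4"
    and A: "attach_star V E u w L V' E'"
  shows "shaped V' E' (Suc (cover_size s))"
proof -
  let ?k = "core_size s" and ?l = "lv [a, b, c, d]" and ?R = "sc (core_edges s)"
  obtain f g where M: "modelled V E ?k ?R ?l f g" using H by (auto simp: has_shape_def model_def)
  have m: "0 < card L" and u: "u \<in> V" using A by (auto simp: attach_star_def card_gt_0_iff)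
  have core: ?thesis if i: "i < ?k" and Mi: "modelled V E ?k ?R ?l f' g'" and fi: "u = f' i" for i f' g'
  proof -
    have "model V' E' (Suc ?k) (?R \<union> {(i, ?k), (?k, i)}) (?l(?k := card L))"
      using modelled_grow_core[OF Mi i A[unfolded fi]] unfolding model_def by blast
    then show ?thesis unfolding sc_insert by (rule grow_core[OF _ v m c4 i])
  qed
  show ?thesis
  proof (cases "u \<in> f ` {..<?k}")
    case True
    then show ?thesis using core M by blast
  next
    case False
    then have uW: "u \<in> V - f ` {..<?k}" using u by blast
    define i where "i = g u"
    have ik: "i < ?k" and card: "card {x \<in> V - f ` {..<?k}. g x = i} = ?l i" and fin: "finite V"
      using M uW by (auto simp: modelled_def i_def)
    have li: "0 < ?l i"
      unfolding card[symmetric] using fin uW by (auto simp: card_gt_0_iff i_def)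
    show ?thesis
    proof (cases "s = Star \<and> a = 1")
      case True
      then have s: "s = Star" and k: "?k = 1" and l0: "?l 0 = 1" by (auto simp: lv_simps)
      have i0: "i = 0" using ik k by simp
      have im: "f ` {..<?k} = {f 0}" unfolding k by (simp add: lessThan_Suc)
      have g0: "g x = 0" if "x \<in> V - {f 0}" for x
      proof -
        have "g ` (V - f ` {..<?k}) \<subseteq> {..<?k}" using M by (simp add: modelled_def)
        then have "g x < ?k" using that unfolding im by blast
        then show ?thesis using k by simp
      qed
      then have "{x \<in> V - f ` {..<?k}. g x = i} = V - {f 0}" unfolding im i0 by blast
      then have "card (V - {f 0}) = 1" using card l0 i0 by simp
      then obtain y where "V - {f 0} = {y}" by (auto simp: card_1_singleton_iff)
      moreover have uf: "u \<in> V - {f 0}" using uW unfolding im .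
      ultimately have V: "V - {f 0} = {u}" by simp
      have "f ` {..<?k} \<subseteq> V" using M by (simp add: modelled_def)
      then have f0: "f 0 \<in> V" "f 0 \<noteq> u" using uf unfolding im by auto
      have gu: "g u = 0" using uf by (rule g0)
      have "V = {f 0, u}" using V f0 by auto
      moreover have "E = (\<lambda>(i, j). (f i, f j)) ` ?R \<union> (\<lambda>x. (x, f (g x))) ` (V - f ` {..<?k}) \<union>
          (\<lambda>x. (f (g x), x)) ` (V - f ` {..<?k})"
        using M unfolding modelled_def by blast
      then have "E = {(f 0, u), (u, f 0)}"
        unfolding im V by (simp add: s sc_def gu insert_commute)
      \<comment> \<open>A single edge is a star with either end as centre. Choosing \<open>u\<close>
        as the centre, the new star is attached to a core vertex.\<close>
      ultimately have "modelled V E 1 {} (\<lambda>_. card V - 1) (\<lambda>_. u) (\<lambda>_. 0)"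
        using f0 by (intro model_star) auto
      moreover have "card V = 2" using \<open>V = {f 0, u}\<close> f0 by simp
      ultimately have "modelled V E ?k ?R ?l (\<lambda>_. u) (\<lambda>_. 0)"
        unfolding k using l0 by (simp add: modelled_def s sc_def)
      then show ?thesis using core[of 0] k by simp
    next
      case False
      then have S: "s = Star \<Longrightarrow> 1 < a" using v by auto
      have "modelled V' E' (Suc (Suc ?k)) (?R \<union> {(i, ?k), (?k, i)} \<union> {(?k, Suc ?k), (Suc ?k, ?k)})
          ((?l(i := ?l i - 1, ?k := 0))(Suc ?k := card L)) (f(?k := u, Suc ?k := w))
          (\<lambda>x. if x \<in> L then Suc ?k else g x)"
        by (rule modelled_grow_core[OF modelled_promote_leaf[OF M uW i_def]]) (use A in auto)
      then have "model V' E' (Suc (Suc ?k)) (sc ((?k, Suc ?k) # (i, ?k) # core_edges s))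
          (?l(i := ?l i - 1, ?k := 0, Suc ?k := card L))"
        unfolding sc_insert model_def by blast
      then show ?thesis by (rule grow_leaf[OF _ v m c4 li S])
    qed
  qed
qed

section \<open>A matching with as many edges as there are cover vertices\<close>

definition edge_matching :: "'a rel \<Rightarrow> 'a set set \<Rightarrow> bool" where
  "edge_matching E M \<longleftrightarrow> M \<subseteq> {{u, v} | u v. (u, v) \<in> E} \<and> pairwise disjnt M"

lemma edge_matching_mono: "edge_matching E0 M \<Longrightarrow> E0 \<subseteq> E \<Longrightarrow> edge_matching E M"
  unfolding edge_matching_def by blast

lemma shaped_star:
  assumes "finite V" "r \<in> V" "E = {r} \<times> (V - {r}) \<union> (V - {r}) \<times> {r}" "V - {r} \<noteq> {}"
  shows "shaped V E 1"
proof -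
  have "card (V - {r}) > 0" unfolding card_gt_0_iff using assms by blast
  then have n: "card V - 1 > 0" by (simp only: card_Diff_singleton[OF assms(2)])
  have "model V E 1 {} (\<lambda>_. card V - 1)"
    using model_star[OF assms(1-3)] unfolding model_def by blast
  then have "model V E 1 {} (lv [card V - 1, 0, 0, 0])"
    by (rule model_cong) (simp add: lv_simps)
  then have "has_shape V E Star (card V - 1) 0 0 0" by (simp add: has_shape_def sc_def)
  then show ?thesis using n unfolding shaped_def
    by (intro exI[of _ Star] exI[of _ "card V - 1"] exI[of _ 0]) simp
qed

text \<open>Shape and matching are built together. Every attached star adds one cover vertex and one
  edge that avoids the old tree, so a star attached to a shape with four cover vertices already
  yields five disjoint edges. From then on only the matching is carried along, and no larger shapes
  have to be classified.\<close>

lemma rooted_shaped: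
  assumes "rooted V E r par dep" and "2 \<le> card V"
  shows "(\<exists>M. edge_matching E M \<and> finite M \<and> 5 \<le> card M) \<or>
    (\<exists>c M. c \<le> 4 \<and> edge_matching E M \<and> finite M \<and> card M = c \<and> shaped V E c)"
  using assms
proof (induction "card V" arbitrary: V E rule: less_induct)
  case less
  have fin: "finite V" and r: "r \<in> V" using less(2) by (auto simp: rooted_def)
  have single: "(\<exists>c M. c \<le> 4 \<and> edge_matching E M \<and> finite M \<and> card M = c \<and> shaped V E c)"
    if "shaped V E 1" "(x, y) \<in> E" for x y
    using that by (intro exI[of _ 1] exI[of _ "{{x, y}}"]) (auto simp: edge_matching_def)
  from less(2) show ?case
  proof (cases rule: rooted_cases)
    case 1
    then have "V = {r}" using r by auto
    then show ?thesis using less(3) by simp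
  next
    case 2
    then obtain x where "(r, x) \<in> E" by auto
    then show ?thesis using single shaped_star[OF fin r 2] by blast
  next
    case (3 V0 E0 u v L)
    have u: "u \<in> V0" and L: "finite L" "L \<noteq> {}" "v \<notin> V0" "v \<notin> L" "L \<inter> V0 = {}" and V: "V = insert v (V0 \<union> L)"
      and E: "E = E0 \<union> {(u, v), (v, u)} \<union> {v} \<times> L \<union> L \<times> {v}"
      using 3(2) by (auto simp: attach_star_def)
    have EE: "E0 \<subseteq> E" unfolding E by auto
    have fin0: "finite V0" and E0: "E0 \<subseteq> V0 \<times> V0" using 3(1) by (auto simp: rooted_def)
    have lt: "card V0 < card V" unfolding V using L fin0 by (intro psubset_card_mono) auto
    show ?thesis
    proof (cases "card V0 = 1")
      case True
      \<comment> \<open>A single vertex has no shape, so the induction hypothesis does not apply.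
        Together with the star it is just one more leaf of \<open>v\<close>.\<close>
      then have V0: "V0 = {u}" using u by (auto simp: card_1_singleton_iff)
      then have "E0 = {}" using 3(1) by (auto simp: rooted_def)
      then have "E = {v} \<times> (V - {v}) \<union> (V - {v}) \<times> {v}" "V - {v} \<noteq> {}"
        using E V V0 L by auto
      then have "shaped V E 1" using fin V by (intro shaped_star) auto
      then show ?thesis using single[of u v] E by blast
    next
      case False
      moreover have "card V0 \<noteq> 0" using fin0 u by auto
      ultimately have "2 \<le> card V0" by simp
      from less(1)[OF lt 3(1) this] show ?thesis
      proof (elim disjE exE conjE)
        fix M assume "edge_matching E0 M" "finite M" "5 \<le> card M"
        moreover from this have "edge_matching E M" by (intro edge_matching_mono[OF _ EE])
        ultimately show ?thesis by blast
      next
        fix c M assume c: "c \<le> 4" and M: "edge_matching E0 M" "finite M" "card M = c" and sh: "shaped V0 E0 c"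
        obtain x where x: "x \<in> L" using L by blast
        have sub: "e \<subseteq> V0" if "e \<in> M" for e using M(1) E0 that by (auto simp: edge_matching_def)
        have new: "{v, x} \<notin> M" using sub L(3) by blast
        have "edge_matching E (insert {v, x} M)"
          unfolding edge_matching_def pairwise_insert
        proof (intro conjI)
          show "insert {v, x} M \<subseteq> {{u, v} |u v. (u, v) \<in> E}"
          proof -
            have "(v, x) \<in> E" using x unfolding E by auto
            moreover have "M \<subseteq> {{u, v} |u v. (u, v) \<in> E}"
              using edge_matching_mono[OF M(1) EE] by (simp add: edge_matching_def)
            ultimately show ?thesis by blast
          qed
          have "disjnt {v, x} e" if "e \<in> M" for e using sub[OF that] L x by (auto simp: disjnt_def)
          then show "\<forall>y. y \<in> M \<and> y \<noteq> {v, x} \<longrightarrow> disjnt {v, x} y \<and> disjnt y {v, x}"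
            by (simp add: disjnt_sym)
        qed (use M(1) in \<open>simp add: edge_matching_def\<close>)
        then have M': "edge_matching E (insert {v, x} M)" "finite (insert {v, x} M)" "card (insert {v, x} M) = Suc c"
          using M new by auto
        show ?thesis
        proof (cases "c = 4")
          case True
          then show ?thesis using M' by (metis Suc_numeral le_refl semiring_norm(5))
        next
          case False
          then have "c < 4" using c by simp
          moreover from this sh obtain s a b c' d where "cover_size s = c" "valid s a b c' d"
              "has_shape V0 E0 s a b c' d"
            by (auto simp: shaped_def)
          ultimately have "shaped V E (Suc c)" using grow_shaped 3(2) by metis
          then show ?thesis using M' \<open>c < 4\<close> by (metis Suc_leI)
        qed
      qed
    qed
  qed
qed

section \<open>Separating the shapes\<close>

fun functional :: "int list \<Rightarrow> invariant_tuple \<Rightarrow> int" where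
  "functional cs (n, m2, m3, m4, g0, h1, h2, g3, g4, h5) =
     sum_list (map2 (\<lambda>x y. x * int y) cs [n, m2, m3, m4, g0, h1, h2, g3, g4, h5])"

text \<open>\<open>Pdcc0\<close> means \<open>b = 0\<close>, and \<open>Td0\<close>,
  \<open>Tc0\<close> mean \<open>a = 0\<close>. For \<open>Sdcc\<close> the digits describe
  \<open>a\<close> and \<open>b\<close>: \<open>Sdcc01\<close> is \<open>a = 0\<close> and
  \<open>b = 1\<close>, \<open>Sdcc02\<close> is \<open>a = 0\<close> and \<open>b > 1\<close>, and
  \<open>Sdcc11\<close> is \<open>a > 0\<close> and \<open>b = 1\<close>.\<close>

datatype kind = Plain shape | Pdcc0 | Sdcc01 | Sdcc02 | Sdcc11 | Td0 | Tc0

fun shape_of :: "kind \<Rightarrow> shape" where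
  "shape_of (Plain s) = s"
| "shape_of Pdcc0 = Pdcc"
| "shape_of Sdcc01 = Sdcc"
| "shape_of Sdcc02 = Sdcc"
| "shape_of Sdcc11 = Sdcc"
| "shape_of Td0 = Td"
| "shape_of Tc0 = Tc"

definition kind_of :: "shape \<Rightarrow> nat \<Rightarrow> nat \<Rightarrow> kind" where
  "kind_of s a b = (if s = Pdcc \<and> b = 0 then Pdcc0
     else if s = Sdcc \<and> a = 0 then (if b = 1 then Sdcc01 else Sdcc02)
     else if s = Sdcc \<and> b = 1 then Sdcc11 else if s = Td \<and> a = 0 then Td0 else if s = Tc \<and> a = 0 then Tc0
     else Plain s)"

lemma shape_of_kind_of: "shape_of (kind_of s a b) = s"
  by (simp add: kind_of_def)

lemma pos_SucE: "a > 0 \<Longrightarrow> (\<And>m. a = Suc m \<Longrightarrow> P) \<Longrightarrow> P" for a :: nat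
  by (cases a) auto

text \<open>
  The functionals below come from linear programming: after substituting the least admissible leaf counts,
  every nonconstant coefficient is nonnegative on \<open>A\<close> and nonpositive on \<open>B\<close>. To make this possible, some
  shapes are split according to small leaf counts; \<open>Plain s\<close> is the generic part.
\<close>

definition separates :: "int list \<Rightarrow> int \<Rightarrow> kind set \<Rightarrow> kind set \<Rightarrow> bool" where
  "separates cs \<kappa> A B \<longleftrightarrow> (\<forall>s a b c d. valid s a b c d \<longrightarrow>
     (kind_of s a b \<in> A \<longrightarrow> \<kappa> \<le> functional cs (invariants s a b c d)) \<and>
     (kind_of s a b \<in> B \<longrightarrow> functional cs (invariants s a b c d) \<le> \<kappa> - 1))"

lemma separatesD:
  assumes "separates cs \<kappa> A B" "valid s a b c d" "valid t a' b' c' d'"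
    and "invariants s a b c d = invariants t a' b' c' d'"
  shows "\<not> (kind_of s a b \<in> A \<and> kind_of t a' b' \<in> B)" "\<not> (kind_of s a b \<in> B \<and> kind_of t a' b' \<in> A)"
  using assms unfolding separates_def by (smt (verit))+

lemma separatesI:
  assumes "\<And>s a b c d. valid s a b c d \<Longrightarrow>
     (kind_of s a b \<in> A \<longrightarrow> \<kappa> \<le> functional cs (invariants s a b c d)) \<and>
     (kind_of s a b \<in> B \<longrightarrow> functional cs (invariants s a b c d) \<le> \<kappa> - 1)"
  shows "separates cs \<kappa> A B"
  using assms unfolding separates_def by blast

text \<open>\<open>m4\<close> counts the matchings of size four, so it is positive exactly for four
  cover vertices. In the same way \<open>m3\<close> and \<open>m2\<close> split the remaining sizes
  in the next two lemmas.\<close>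

lemma separates_1: "separates [0, 0, 0, 1, 0, 0, 0, 0, 0, 0] 1
  {Plain Pddd, Plain Pddc, Plain Pdcd, Plain Pcdc, Pdcc0, Plain Pdcc, Plain Pccc, Plain Sddd, Plain Sddc, Sdcc01,
      Sdcc02, Sdcc11, Plain Sdcc, Plain Sccc, Td0, Plain Td, Tc0, Plain Tc, Plain Q}
  {Plain Star, Plain Pd, Plain Pc, Plain Pdd, Plain Pdc, Plain Pcc, Plain Tri}"
  by (rule separatesI, case_tac s) (auto elim!: pos_SucE simp: kind_of_def algebra_simps)

lemma separates_2: "separates [0, 0, 1, 0, 0, 0, 0, 0, 0, 0] 1
  {Plain Pdd, Plain Pdc, Plain Pcc, Plain Tri}
  {Plain Star, Plain Pd, Plain Pc}"
  by (rule separatesI, case_tac s) (auto elim!: pos_SucE simp: kind_of_def algebra_simps)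

lemma separates_3: "separates [0, 1, 0, 0, 0, 0, 0, 0, 0, 0] 1
  {Plain Pd, Plain Pc}
  {Plain Star}"
  by (rule separatesI, case_tac s) (auto elim!: pos_SucE simp: kind_of_def algebra_simps)

lemma separates_4: "separates [0, 0, 0, 0, 0, 0, 0, 0, 1, 0] 1
  {Plain Pc}
  {Plain Pd}"
  by (rule separatesI, case_tac s) (auto elim!: pos_SucE simp: kind_of_def algebra_simps)

lemma separates_5: "separates [0, 0, 0, 0, 0, 0, 0, -3, 2, 0] 2
  {Plain Pdd}
  {Plain Pdc, Plain Pcc, Plain Tri}"
  by (rule separatesI, case_tac s) (auto elim!: pos_SucE simp: kind_of_def algebra_simps)

lemma separates_6: "separates [0, 0, 0, 0, 0, 0, 3, -1, 0, 0] 0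
  {Plain Tri}
  {Plain Pdc, Plain Pcc}"
  by (rule separatesI, case_tac s) (auto elim!: pos_SucE simp: kind_of_def algebra_simps)

lemma separates_7: "separates [0, -3, 3, 0, 0, 0, 1, -1, 0, 1] (-1)
  {Plain Pdc}
  {Plain Pcc}"
  by (rule separatesI, case_tac s) (auto elim!: pos_SucE simp: kind_of_def algebra_simps)

text \<open>From here on all kinds have four cover vertices. Each functional separates two whole
  families at once; a pair of kinds is settled by any functional that has them on opposite
  sides.\<close>

lemma separates_8: "separates [0, 2, 0, 31, -18, -8, 5, 1, -3, 0] 5
  {Plain Pddc, Plain Sddc, Td0, Tc0, Plain Pddd, Plain Pdcd, Plain Sddd}
  {Sdcc11, Plain Pccc, Plain Sccc, Plain Pcdc, Sdcc02, Plain Sdcc, Sdcc01}"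
  by (rule separatesI, case_tac s) (auto elim!: pos_SucE simp: kind_of_def algebra_simps)

lemma separates_9: "separates [0, 2, -8, 10, 2, -1, -2, 1, 2, -1] (-4)
  {Plain Tc, Pdcc0, Plain Pccc, Plain Q, Plain Pdcc}
  {Sdcc02, Sdcc11, Plain Sccc, Sdcc01, Plain Sdcc, Plain Sddc, Td0}"
  by (rule separatesI, case_tac s) (auto elim!: pos_SucE simp: kind_of_def algebra_simps)

lemma separates_10: "separates [-2, 4, -4, -40, -2, 10, 0, 1, 0, -1] (-4)
  {Tc0, Pdcc0, Plain Pdcc, Plain Tc, Td0}
  {Plain Sddd, Plain Pddc, Plain Pdcd, Plain Pddd}"
  by (rule separatesI, case_tac s) (auto elim!: pos_SucE simp: kind_of_def algebra_simps)

lemma separates_11: "separates [-56, 42, -6, -8, -8, 2, 4, 2, -6, -5] (-196)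
  {Plain Pdcc, Pdcc0, Plain Pccc, Plain Pcdc, Sdcc01}
  {Plain Tc, Plain Td, Plain Q}"
  by (rule separatesI, case_tac s) (auto elim!: pos_SucE simp: kind_of_def algebra_simps)

lemma separates_12: "separates [0, -2, 6, 16, 16, -8, 0, 0, -2, 1] 4
  {Plain Td, Plain Pddd, Plain Q}
  {Plain Pdcd, Plain Sddd, Plain Pddc, Tc0, Sdcc11, Plain Sdcc, Sdcc02}"
  by (rule separatesI, case_tac s) (auto elim!: pos_SucE simp: kind_of_def algebra_simps)

lemma separates_13: "separates [0, 0, -17, 40, 0, 5, -35, 0, 29, -14] (-138)
  {Pdcc0, Sdcc01, Sdcc02}
  {Plain Pcdc, Plain Sccc, Tc0}"
  by (rule separatesI, case_tac s) (auto elim!: pos_SucE simp: kind_of_def algebra_simps)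

lemma separates_14: "separates [0, 0, -2, 12, 4, -2, -2, 1, 0, 0] 2
  {Plain Pddd, Plain Pdcd, Plain Pddc}
  {Plain Sddc, Plain Sddd}"
  by (rule separatesI, case_tac s) (auto elim!: pos_SucE simp: kind_of_def algebra_simps)

lemma separates_15: "separates [-120, 56, 72, -46, -22, 9, 16, -12, -24, 0] (-476)
  {Plain Pddd, Plain Sccc, Plain Sddc, Tc0}
  {Plain Q, Plain Td, Td0, Sdcc11}"
  by (rule separatesI, case_tac s) (auto elim!: pos_SucE simp: kind_of_def algebra_simps)

lemma separates_16: "separates [-12, 12, 58, -86, -22, 11, 16, -5, -18, 0] (-26)
  {Plain Pccc, Sdcc11, Plain Sdcc, Plain Sccc}
  {Plain Pcdc, Pdcc0}"
  by (rule separatesI, case_tac s) (auto elim!: pos_SucE simp: kind_of_def algebra_simps)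

lemma separates_17: "separates [0, 0, 0, 2, 1, -1, 0, 0, 0, 0] 3
  {Plain Q}
  {Plain Td, Plain Tc}"
  by (rule separatesI, case_tac s) (auto elim!: pos_SucE simp: kind_of_def algebra_simps)

lemma separates_18: "separates [0, 0, 0, -4, -2, 1, 0, 0, 0, 0] 2
  {Tc0}
  {Plain Pdcc, Plain Sddc}"
  by (rule separatesI, case_tac s) (auto elim!: pos_SucE simp: kind_of_def algebra_simps)

lemma separates_19: "separates [30, -6, 0, 10, 0, -3, 2, 1, -2, 0] 144
  {Plain Pdcc}
  {Plain Pccc}"
  by (rule separatesI, case_tac s) (auto elim!: pos_SucE simp: kind_of_def algebra_simps)

lemma separates_20: "separates [0, -10, 2, -8, 0, 2, 0, -2, 2, 3] 0
  {Plain Pdcd}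
  {Plain Pddc}"
  by (rule separatesI, case_tac s) (auto elim!: pos_SucE simp: kind_of_def algebra_simps)

lemma separates_21: "separates [0, 2, 3, -8, -3, 1, 2, 0, -2, 0] 9
  {Plain Pdcc}
  {Plain Pcdc}"
  by (rule separatesI, case_tac s) (auto elim!: pos_SucE simp: kind_of_def algebra_simps)

lemma separates_22: "separates [0, -16, 0, 18, 0, -3, 0, 0, 0, 4] (-64)
  {Plain Sdcc}
  {Plain Sccc}"
  by (rule separatesI, case_tac s) (auto elim!: pos_SucE simp: kind_of_def algebra_simps)

lemma separates_23: "separates [0, 0, 0, 0, -1, 0, 0, 0, 0, 0] 0
  {Plain Sddd}
  {Plain Sddc}"
  by (rule separatesI, case_tac s) (auto elim!: pos_SucE simp: kind_of_def algebra_simps)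

lemmas separating = separates_1 separates_2 separates_3 separates_4 separates_5 separates_6 separates_7
    separates_8 separates_9 separates_10 separates_11 separates_12 separates_13 separates_14 separates_15
    separates_16 separates_17 separates_18 separates_19 separates_20 separates_21 separates_22 separates_23

lemma kind_cases:
  "x \<in> Plain ` {Star, Pd, Pc, Pdd, Pdc, Pcc, Tri, Pddd, Pddc, Pdcd, Pcdc, Pdcc, Pccc, Sddd, Sddc, Sdcc, Sccc, Td, Tc, Q}
     \<union> {Pdcc0, Sdcc01, Sdcc02, Sdcc11, Td0, Tc0}"
proof (cases x)
  case (Plain s)
  then show ?thesis by (cases s) simp_all
qed simp_all

lemma invariants_shape_or:
  assumes v: "valid s a b c d" "valid t a' b' c' d'"
    and eq: "invariants s a b c d = invariants t a' b' c' d'"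
  shows "s = t \<or> (s = Td \<and> t = Tc \<and> a > 0) \<or> (s = Tc \<and> t = Td \<and> a' > 0)"
proof -
  define x y where "x = kind_of s a b" and "y = kind_of t a' b'"
  note sep = separating[THEN separatesD(1), OF v eq, folded x_def y_def]
    separating[THEN separatesD(2), OF v eq, folded x_def y_def]
  \<comment> \<open>Any two kinds of different shapes are on opposite sides of some functional, with
    the exception of \<open>Plain Td\<close> and \<open>Plain Tc\<close>.\<close>
  have "shape_of x = shape_of y \<or> (x = Plain Td \<and> y = Plain Tc) \<or> (x = Plain Tc \<and> y = Plain Td)"
    using kind_cases[of x, unfolded image_insert image_empty Un_insert_left Un_empty_left] sep kind_cases[of y]
    by (elim insertE emptyE) (simp_all, (elim disjE; simp only: shape_of.simps simp_thms)+)
  moreover have "kind_of Td i j = Plain Td \<longleftrightarrow> i > 0" for i j by (simp add: kind_of_def)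
  moreover have "s = shape_of x" "t = shape_of y" by (simp_all add: shape_of_kind_of x_def y_def)
  ultimately show ?thesis unfolding x_def y_def by (metis shape_of.simps(1) shape_of_kind_of)
qed


text \<open>The pair left open by the separating functionals. The functionals behind the first two
  equations are constant on \<open>Td\<close>, so they constrain only the leaf counts of
  \<open>Tc\<close>. After division by \<open>z\<close>, eliminating \<open>x * y\<close> leaves
  \<open>(w - 1)^2 = 0\<close>. With \<open>w = 1\<close> the third equation becomes
  \<open>a * d + z = d\<close>, which is impossible for positive \<open>a\<close> and
  \<open>z\<close>.\<close>

lemma invariants_Td_Tc:
  assumes v: "valid Td a b c d" "valid Tc w x y z" and a: "a > 0"
    and eq: "invariants Td a b c d = invariants Tc w x y z"
  shows False
proof -
  have 1: "x * y * z + z = w * z + x * z + y * z"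
    by (rule int_int_eq[THEN iffD1]) (use arg_cong[OF eq, of "functional [32, -18, -14, 12, 4, -2, -4, 2, 6, 1]"]
        in \<open>simp add: algebra_simps del: of_nat_eq_iff\<close>)
  have 2: "w * x * y * z + z = w * x * z + w * y * z + w * z"
    by (rule int_int_eq[THEN iffD1]) (use arg_cong[OF eq, of "functional [-96, 78, -62, 36, 4, -6, -4, 10, 6,
        -15]"] in \<open>simp add: algebra_simps del: of_nat_eq_iff\<close>)
  have 3: "a * d + z + 1 = d + w"
    by (rule int_int_eq[THEN iffD1]) (use arg_cong[OF eq, of "functional [-4, 4, 0, 0, 0, 0, 0, 0, 0, -1]"] in
        \<open>simp add: algebra_simps del: of_nat_eq_iff\<close>)
  have "x * y + 1 = w + x + y"
  proof -
    have "z * (x * y + 1) = z * (w + x + y)" using 1 by (simp add: algebra_simps)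
    then show ?thesis unfolding mult_cancel1 using v(2) by simp
  qed
  moreover have "w * (x * y) + 1 = w * (x + y + 1)"
  proof -
    have "z * (w * (x * y) + 1) = z * (w * (x + y + 1))" using 2 by (simp add: algebra_simps)
    then show ?thesis unfolding mult_cancel1 using v(2) by simp
  qed
  ultimately have "int w * (int w - 2) + 1 = 0"
  proof -
    assume A: "x * y + 1 = w + x + y" and B: "w * (x * y) + 1 = w * (x + y + 1)"
    have A': "int x * int y = int w + int x + int y - 1" using arg_cong[OF A, of int] by simp
    have "int w * (int x * int y) + 1 = int w * (int x + int y + 1)" using arg_cong[OF B, of int] by (simp add:
        algebra_simps)
    then show ?thesis unfolding A' by (simp add: algebra_simps)
  qed
  then have "(int w - 1)\<^sup>2 = 0" by (simp add: power2_eq_square algebra_simps)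
  then have "w = 1" by simp
  with 3 have "a * d + z = d" by simp
  moreover have "d \<le> a * d" using a by simp
  moreover have "z > 0" using v(2) by simp
  ultimately show False by linarith
qed


lemma invariants_shape:
  assumes "valid s a b c d" "valid t a' b' c' d'"
    and "invariants s a b c d = invariants t a' b' c' d'"
  shows "s = t"
proof -
  from invariants_shape_or[OF assms] consider "s = t" | "s = Td" "t = Tc" "a > 0" | "s = Tc" "t = Td" "a' > 0"
    by blast
  then show ?thesis
  proof cases
    case 2
    with invariants_Td_Tc assms show ?thesis by blast
  next
    case 3
    from assms(3) have "invariants t a' b' c' d' = invariants s a b c d" by (rule sym)
    then have False using invariants_Td_Tc[of a' b' c' d' a b c d] assms(1,2) unfolding 3 using 3(3) by blast
    then show ?thesis ..
  qed
qed

section \<open>Recovering the leaf counts\<close>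

lemma sum_prod_pair:
  fixes a b :: nat
  assumes "a + b = a' + b'" "a * b = a' * b'"
  shows "(a = a' \<and> b = b') \<or> (a = b' \<and> b = a')"
proof -
  have "int a' + int b' = int a + int b" "int a' * int b' = int a * int b"
    using assms[symmetric] by (simp_all only: of_nat_add[symmetric] of_nat_mult[symmetric])
  then have "(int a' - int a) * (int a' - int b) = 0" by Groebner_Basis.algebra
  then show ?thesis using assms(1) by auto
qed

text \<open>To be used with \<open>P\<close> saying that a tree has a given shape with these leaf
  counts. An automorphism of the core makes \<open>P\<close> symmetric, and then elementary
  symmetric functions of the leaf counts suffice. The next two lemmas do the same for three and four
  arguments.\<close>

lemma symmetric_pair:
  fixes a b :: nat
  assumes "P a' b'" "a + b = a' + b'" "a * b = a' * b'" "\<And>x y. P x y \<Longrightarrow> P y x"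
  shows "P a b"
  using sum_prod_pair[OF assms(2,3)] assms(1,4) by blast

lemma symmetric_triple:
  fixes a b c :: nat
  assumes P: "P a' b' c'" and e: "a + b + c = a' + b' + c'" "a * b + a * c + b * c = a' * b' + a' * c' + b' * c'"
    "a * b * c = a' * b' * c'"
    and s: "\<And>x y z. P x y z \<Longrightarrow> P y x z" "\<And>x y z. P x y z \<Longrightarrow> P x z y"
  shows "P a b c"
proof -
  have *: "P x b c" if "P x y z" "x + b + c = x + y + z" "x * b + x * c + b * c = x * y + x * z + y * z" for x y z
  proof (rule symmetric_pair[of "P x", OF that(1)])
    show "b + c = y + z" using that(2) by simp
    then have "x * b + x * c = x * y + x * z" by (simp only: distrib_left[symmetric])
    with that(3) show "b * c = y * z" by simp
  qed (rule s)
  have "int a + int b + int c = int a' + int b' + int c'"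
    "int a * int b + int a * int c + int b * int c = int a' * int b' + int a' * int c' + int b' * int c'"
    "int a * int b * int c = int a' * int b' * int c'"
    using e by (simp_all only: of_nat_add[symmetric] of_nat_mult[symmetric])
  \<comment> \<open>\<open>a\<close> is a root of the cubic with roots \<open>a', b', c'\<close>;
    after cancelling it, a pair is left.\<close>
  then have "(int a - int a') * ((int a - int b') * (int a - int c')) = 0" by Groebner_Basis.algebra
  then consider "a = a'" | "a = b'" | "a = c'" by auto
  then show ?thesis
  proof cases
    case 1
    show ?thesis unfolding 1 using *[of a' b' c'] P e unfolding 1 by simp
  next
    case 2
    show ?thesis unfolding 2 using *[of b' a' c'] s(1)[OF P] e unfolding 2 by (simp add: ac_simps)
  next
    case 3
    show ?thesis unfolding 3 using *[of c' a' b'] s(1)[OF s(2)[OF P]] e unfolding 3 by (simp add: ac_simps)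
  qed
qed

lemma symmetric_quadruple:
  fixes a b c d :: nat
  assumes P: "P a' b' c' d'" and e: "a + b + c + d = a' + b' + c' + d'"
    "a * b + a * c + a * d + b * c + b * d + c * d = a' * b' + a' * c' + a' * d' + b' * c' + b' * d' + c' * d'"
    "a * b * c + a * b * d + a * c * d + b * c * d = a' * b' * c' + a' * b' * d' + a' * c' * d' + b' * c' * d'"
    "a * b * c * d = a' * b' * c' * d'"
    and s: "\<And>x y z w. P x y z w \<Longrightarrow> P y x z w" "\<And>x y z w. P x y z w \<Longrightarrow> P x z y w" "\<And>x y z w. P x y z w \<Longrightarrow> P x y w z"
  shows "P a b c d"
proof -
  have ei: "int a + int b + int c + int d = int a' + int b' + int c' + int d'"
    "int a * int b + int a * int c + int a * int d + int b * int c + int b * int d + int c * int d =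
     int a' * int b' + int a' * int c' + int a' * int d' + int b' * int c' + int b' * int d' + int c' * int d'"
    "int a * int b * int c + int a * int b * int d + int a * int c * int d + int b * int c * int d =
     int a' * int b' * int c' + int a' * int b' * int d' + int a' * int c' * int d' + int b' * int c' * int d'"
    "int a * int b * int c * int d = int a' * int b' * int c' * int d'"
    using e by (simp_all only: of_nat_add[symmetric] of_nat_mult[symmetric])
  have *: "P a b c d" if P: "P a y z w"
    and eq: "int b + int c + int d = int y + int z + int w"
    "int b * int c + int b * int d + int c * int d = int y * int z + int y * int w + int z * int w"
    "int b * int c * int d = int y * int z * int w" for y z w
  proof (rule symmetric_triple[of "P a", OF P])
    show "b + c + d = y + z + w" "b * c + b * d + c * d = y * z + y * w + z * w" "b * c * d = y * z * w"
      using eq by (simp_all only: of_nat_add[symmetric] of_nat_mult[symmetric] of_nat_eq_iff)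
  qed (fact s)+
  have "(int a - int a') * ((int a - int b') * ((int a - int c') * (int a - int d'))) = 0"
    using ei by Groebner_Basis.algebra
  then consider "a = a'" | "a = b'" | "a = c'" | "a = d'" by auto
  then show ?thesis
  proof cases
    case 1
    show ?thesis by (rule *[of b' c' d']) (use P ei in \<open>simp_all only: 1, Groebner_Basis.algebra+\<close>)
  next
    case 2
    show ?thesis by (rule *[of a' c' d']) (use s(1)[OF P] ei in \<open>simp_all only: 2, Groebner_Basis.algebra+\<close>)
  next
    case 3
    show ?thesis by (rule *[of a' b' d']) (use s(1)[OF s(2)[OF P]] ei in \<open>simp_all only: 3, Groebner_Basis.algebra+\<close>)
  next
    case 4
    show ?thesis by (rule *[of a' b' c']) (use s(1)[OF s(2)[OF s(3)[OF P]]] ei in \<open>simp_all only: 4,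
        Groebner_Basis.algebra+\<close>)
  qed
qed

text \<open>Meant for paths, whose only symmetry is the reversal. The sums and products fix the
  pairs \<open>a, d\<close> and \<open>b, c\<close> up to two independent exchanges. The mixed sum
  \<open>a * c + b * d\<close> rules out exchanging just one pair: this would require
  \<open>(a - d) * (b - c) = 0\<close>, and then the exchange is trivial for one of the
  pairs.\<close>

lemma symmetric_reversal:
  fixes a b c d :: nat
  assumes P: "P a' b' c' d'" and e: "a + d = a' + d'" "a * d = a' * d'" "b + c = b' + c'" "b * c = b' * c'"
    "a * c + b * d = a' * c' + b' * d'" and s: "\<And>x y z w. P x y z w \<Longrightarrow> P w z y x"
  shows "P a b c d"
proof -
  have x: "a = d \<or> b = c" if "a * c + b * d = a * b + c * d"
  proof -
    have "int (a * c + b * d) = int (a * b + c * d)" using that by (rule arg_cong)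
    then have "(int a - int d) * (int b - int c) = 0" by (simp add: algebra_simps)
    then show ?thesis by auto
  qed
  from sum_prod_pair[OF e(1,2)] sum_prod_pair[OF e(3,4)] x e(5) P s[OF P] show ?thesis
    by (elim disjE conjE) (simp_all add: ac_simps, auto simp: ac_simps)
qed

lemma nat_cancel: "x = x' \<Longrightarrow> x * y = x' * y' \<Longrightarrow> 0 < x \<Longrightarrow> y = y'" for x y :: nat
  by simp

lemma has_shape_relabel:
  "has_shape V E s a b c d \<Longrightarrow> relabels (core_size s) (core_edges s) (lv [a, b, c, d]) q t [a', b', c', d'] \<Longrightarrow>
     has_shape V E t a' b' c' d'"
  unfolding has_shape_def[of V E s] by (rule relabels_has_shape)

section \<open>Leaf counts of each shape, up to the automorphisms of its core\<close>

lemma has_shape_unique_Star: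
  assumes v: "valid Star a b c d" "valid Star a' b' c' d'"
    and eq: "invariants Star a b c d = invariants Star a' b' c' d'" and H: "has_shape V E Star a' b' c' d'"
  shows "has_shape V E Star a b c d"
proof -
  have z: "b = 0" "b' = 0" "c = 0" "c' = 0" "d = 0" "d' = 0" using v by auto
  \<comment> \<open>Here and below, the coefficient list makes the functional collapse on this shape
    to the displayed expression, up to a constant factor and an additive constant.\<close>
  have e: "a = a'"
    by (rule int_int_eq[THEN iffD1]) (use arg_cong[OF eq, of "functional [1, 0, 0, 0, 0, 0, 0, 0, 0, 0]"] in
        \<open>simp add: algebra_simps del: of_nat_eq_iff\<close>)
  then show ?thesis using H by (simp add: z)
qed

lemma swap_Pd: "has_shape V E Pd a b c d \<Longrightarrow> has_shape V E Pd b a c d"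
  by (erule has_shape_relabel[of _ _ _ _ _ _ _ "[1, 0]"]) (auto simp: relabel_simps)

lemma swap_Pc: "has_shape V E Pc a b c d \<Longrightarrow> has_shape V E Pc b a c d"
  by (erule has_shape_relabel[of _ _ _ _ _ _ _ "[1, 0, 2]"]) (auto simp: relabel_simps)

lemma has_shape_unique_Pd:
  assumes v: "valid Pd a b c d" "valid Pd a' b' c' d'"
    and eq: "invariants Pd a b c d = invariants Pd a' b' c' d'" and H: "has_shape V E Pd a' b' c' d'"
  shows "has_shape V E Pd a b c d"
proof -
  have z: "c = 0" "c' = 0" "d = 0" "d' = 0" using v by auto
  have e1: "a + b = a' + b'"
    by (rule int_int_eq[THEN iffD1]) (use arg_cong[OF eq, of "functional [1, 0, 0, 0, 0, 0, 0, 0, 0, 0]"] in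
        \<open>simp add: algebra_simps del: of_nat_eq_iff\<close>)
  have e2: "a * b = a' * b'"
    by (rule int_int_eq[THEN iffD1]) (use arg_cong[OF eq, of "functional [0, 1, 0, 0, 0, 0, 0, 0, 0, 0]"] in
        \<open>simp add: algebra_simps del: of_nat_eq_iff\<close>)
  show ?thesis unfolding z
    by (rule symmetric_pair[of "\<lambda>x y. has_shape V E Pd x y 0 0", OF H[unfolded z] e1 e2]) (rule swap_Pd)
qed

lemma has_shape_unique_Pc:
  assumes v: "valid Pc a b c d" "valid Pc a' b' c' d'"
    and eq: "invariants Pc a b c d = invariants Pc a' b' c' d'" and H: "has_shape V E Pc a' b' c' d'"
  shows "has_shape V E Pc a b c d"
proof -
  have z: "c = 0" "c' = 0" "d = 0" "d' = 0" using v by auto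
  have e1: "a + b = a' + b'"
    by (rule int_int_eq[THEN iffD1]) (use arg_cong[OF eq, of "functional [1, 0, 0, 0, 0, 0, 0, 0, 0, 0]"] in
        \<open>simp add: algebra_simps del: of_nat_eq_iff\<close>)
  have e2: "a * b = a' * b'"
    by (rule int_int_eq[THEN iffD1]) (use arg_cong[OF eq, of "functional [0, 0, 0, 0, 0, 0, 0, 0, 1, 0]"] in
        \<open>simp add: algebra_simps del: of_nat_eq_iff\<close>)
  show ?thesis unfolding z
    by (rule symmetric_pair[of "\<lambda>x y. has_shape V E Pc x y 0 0", OF H[unfolded z] e1 e2]) (rule swap_Pc)
qed

lemma swap_Pdd: "has_shape V E Pdd a b c d \<Longrightarrow> has_shape V E Pdd c b a d"
  by (erule has_shape_relabel[of _ _ _ _ _ _ _ "[2, 1, 0]"]) (auto simp: relabel_simps)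

lemma has_shape_unique_Pdd:
  assumes v: "valid Pdd a b c d" "valid Pdd a' b' c' d'"
    and eq: "invariants Pdd a b c d = invariants Pdd a' b' c' d'" and H: "has_shape V E Pdd a' b' c' d'"
  shows "has_shape V E Pdd a b c d"
proof -
  have z: "d = 0" "d' = 0" using v by auto
  have s: "a + b + c = a' + b' + c'"
    by (rule int_int_eq[THEN iffD1]) (use arg_cong[OF eq, of "functional [1, 0, 0, 0, 0, 0, 0, 0, 0, 0]"] in
        \<open>simp add: algebra_simps del: of_nat_eq_iff\<close>)
  have e2: "a * c = a' * c'"
    by (rule int_int_eq[THEN iffD1]) (use arg_cong[OF eq, of "functional [0, -2, 0, 0, 0, 0, 0, 0, 0, 1]"] in
        \<open>simp add: algebra_simps del: of_nat_eq_iff\<close>)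
  have p: "a * c * b = a' * c' * b'"
    by (rule int_int_eq[THEN iffD1]) (use arg_cong[OF eq, of "functional [0, 0, 1, 0, 0, 0, 0, 0, 0, 0]"] in
        \<open>simp add: algebra_simps del: of_nat_eq_iff\<close>)
  have b: "b = b'" using nat_cancel[OF e2 p] v by simp
  with s have e1: "a + c = a' + c'" by simp
  show ?thesis unfolding z b
    by (rule symmetric_pair[of "\<lambda>x y. has_shape V E Pdd x b' y 0", OF H[unfolded z] e1 e2]) (rule swap_Pdd)
qed

text \<open>If \<open>b = 0\<close>, the core is a path whose two inner vertices are both leafless;
  it can then be reversed, with the middle cover vertex and the connector changing roles.\<close>

lemma swap_Pdc: "has_shape V E Pdc a 0 c 0 \<Longrightarrow> has_shape V E Pdc c 0 a 0"
  by (erule has_shape_relabel[of _ _ _ _ _ _ _ "[2, 3, 0, 1]"]) (auto simp: relabel_simps)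

lemma has_shape_unique_Pdc:
  assumes v: "valid Pdc a b c d" "valid Pdc a' b' c' d'"
    and eq: "invariants Pdc a b c d = invariants Pdc a' b' c' d'" and H: "has_shape V E Pdc a' b' c' d'"
  shows "has_shape V E Pdc a b c d"
proof -
  have z: "d = 0" "d' = 0" using v by auto
  have s: "a + b + c = a' + b' + c'"
    by (rule int_int_eq[THEN iffD1]) (use arg_cong[OF eq, of "functional [1, 0, 0, 0, 0, 0, 0, 0, 0, 0]"] in
        \<open>simp add: algebra_simps del: of_nat_eq_iff\<close>)
  have e2: "a * c = a' * c'"
    by (rule int_int_eq[THEN iffD1]) (use arg_cong[OF eq, of "functional [0, 0, -2, 0, 0, 0, -2, 1, 0, 0]"] in
        \<open>simp add: algebra_simps del: of_nat_eq_iff\<close>)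
  have p: "a * b = a' * b'"
    by (rule int_int_eq[THEN iffD1]) (use arg_cong[OF eq, of "functional [0, 0, 4, 0, 0, 0, 0, -1, 0, 0]"] in
        \<open>simp add: algebra_simps del: of_nat_eq_iff\<close>)
  have q: "a * b * c = a' * b' * c'"
    by (rule int_int_eq[THEN iffD1]) (use arg_cong[OF eq, of "functional [0, 0, 0, 0, 0, 0, 1, 0, 0, 0]"] in
        \<open>simp add: algebra_simps del: of_nat_eq_iff\<close>)
  show ?thesis
  proof (cases "b = 0")
    case True
    with p v have b': "b' = 0" by simp
    with s True have e1: "a + c = a' + c'" by simp
    show ?thesis unfolding z True
      by (rule symmetric_pair[of "\<lambda>x y. has_shape V E Pdc x 0 y 0", OF H[unfolded z b'] e1 e2]) (rule swap_Pdc)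
  next
    case False
    have c: "c = c'" using nat_cancel[OF p q] v False by simp
    with e2 v have a: "a = a'" by simp
    with p v have "b = b'" by simp
    with a c H show ?thesis by (simp add: z)
  qed
qed

lemma swap_Pcc: "has_shape V E Pcc a b c 0 \<Longrightarrow> has_shape V E Pcc c b a 0"
  by (erule has_shape_relabel[of _ _ _ _ _ _ _ "[2, 1, 0, 4, 3]"]) (auto simp: relabel_simps)

lemma has_shape_unique_Pcc:
  assumes v: "valid Pcc a b c d" "valid Pcc a' b' c' d'"
    and eq: "invariants Pcc a b c d = invariants Pcc a' b' c' d'" and H: "has_shape V E Pcc a' b' c' d'"
  shows "has_shape V E Pcc a b c d"
proof -
  have z: "d = 0" "d' = 0" using v by auto
  have b: "b = b'"
    by (rule int_int_eq[THEN iffD1]) (use arg_cong[OF eq, of "functional [-2, 4, 0, 0, 0, 0, 0, 0, 0, -1]"] in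
        \<open>simp add: algebra_simps del: of_nat_eq_iff\<close>)
  have e1: "a + c = a' + c'"
    by (rule int_int_eq[THEN iffD1]) (use arg_cong[OF eq, of "functional [4, -4, 0, 0, 0, 0, 0, 0, 0, 1]"] in
        \<open>simp add: algebra_simps del: of_nat_eq_iff\<close>)
  have e2: "a * c = a' * c'"
    by (rule int_int_eq[THEN iffD1]) (use arg_cong[OF eq, of "functional [-2, 0, 5, 0, 0, 0, -1, 0, -1, 0]"] in
        \<open>simp add: algebra_simps del: of_nat_eq_iff\<close>)
  show ?thesis unfolding z b
    by (rule symmetric_pair[of "\<lambda>x y. has_shape V E Pcc x b' y 0", OF H[unfolded z] e1 e2]) (rule swap_Pcc)
qed

lemma swap_Tri_0: "has_shape V E Tri a b c d \<Longrightarrow> has_shape V E Tri b a c d"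
  by (erule has_shape_relabel[of _ _ _ _ _ _ _ "[1, 0, 2, 3]"]) (auto simp: relabel_simps)

lemma swap_Tri_1: "has_shape V E Tri a b c d \<Longrightarrow> has_shape V E Tri a c b d"
  by (erule has_shape_relabel[of _ _ _ _ _ _ _ "[0, 2, 1, 3]"]) (auto simp: relabel_simps)

lemma has_shape_unique_Tri:
  assumes v: "valid Tri a b c d" "valid Tri a' b' c' d'"
    and eq: "invariants Tri a b c d = invariants Tri a' b' c' d'" and H: "has_shape V E Tri a' b' c' d'"
  shows "has_shape V E Tri a b c d"
proof -
  have z: "d = 0" "d' = 0" using v by auto
  have e1: "a + b + c = a' + b' + c'"
    by (rule int_int_eq[THEN iffD1]) (use arg_cong[OF eq, of "functional [1, 0, 0, 0, 0, 0, 0, 0, 0, 0]"] in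
        \<open>simp add: algebra_simps del: of_nat_eq_iff\<close>)
  have e2: "a * b + a * c + b * c = a' * b' + a' * c' + b' * c'"
    by (rule int_int_eq[THEN iffD1]) (use arg_cong[OF eq, of "functional [-2, 1, 0, 0, 0, 0, 0, 0, 0, 0]"] in
        \<open>simp add: algebra_simps del: of_nat_eq_iff\<close>)
  have e3: "a * b * c = a' * b' * c'"
    by (rule int_int_eq[THEN iffD1]) (use arg_cong[OF eq, of "functional [0, 0, 0, 0, 0, 0, 1, 0, 0, 0]"] in
        \<open>simp add: algebra_simps del: of_nat_eq_iff\<close>)
  show ?thesis unfolding z
    by (rule symmetric_triple[of "\<lambda>x y w. has_shape V E Tri x y w 0", OF H[unfolded z] e1 e2 e3])
      (fact swap_Tri_0 swap_Tri_1)+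
qed

lemma swap_Pddd: "has_shape V E Pddd a b c d \<Longrightarrow> has_shape V E Pddd d c b a"
  by (erule has_shape_relabel[of _ _ _ _ _ _ _ "[3, 2, 1, 0]"]) (auto simp: relabel_simps)

lemma swap_Pdcd: "has_shape V E Pdcd a b c d \<Longrightarrow> has_shape V E Pdcd d c b a"
  by (erule has_shape_relabel[of _ _ _ _ _ _ _ "[3, 2, 1, 0, 4]"]) (auto simp: relabel_simps)

lemma swap_Pcdc: "has_shape V E Pcdc a b c d \<Longrightarrow> has_shape V E Pcdc d c b a"
  by (erule has_shape_relabel[of _ _ _ _ _ _ _ "[3, 2, 1, 0, 5, 4]"]) (auto simp: relabel_simps)

lemma swap_Pccc: "has_shape V E Pccc a b c d \<Longrightarrow> has_shape V E Pccc d c b a"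
  by (erule has_shape_relabel[of _ _ _ _ _ _ _ "[3, 2, 1, 0, 6, 5, 4]"]) (auto simp: relabel_simps)

lemma has_shape_unique_Pddd:
  assumes v: "valid Pddd a b c d" "valid Pddd a' b' c' d'"
    and eq: "invariants Pddd a b c d = invariants Pddd a' b' c' d'" and H: "has_shape V E Pddd a' b' c' d'"
  shows "has_shape V E Pddd a b c d"
proof -
  have s: "a + b + c + d = a' + b' + c' + d'"
    by (rule int_int_eq[THEN iffD1]) (use arg_cong[OF eq, of "functional [1, 0, 0, 0, 0, 0, 0, 0, 0, 0]"] in
        \<open>simp add: algebra_simps del: of_nat_eq_iff\<close>)
  have e2: "a * d = a' * d'"
    by (rule int_int_eq[THEN iffD1]) (use arg_cong[OF eq, of "functional [0, -2, 6, 0, 0, 0, 0, 0, -2, 1]"] in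
        \<open>simp add: algebra_simps del: of_nat_eq_iff\<close>)
  have p: "a * d * (b + c) = a' * d' * (b' + c')"
    by (rule int_int_eq[THEN iffD1]) (use arg_cong[OF eq, of "functional [0, 0, 0, -4, 0, 0, 1, 0, 0, 0]"] in
        \<open>simp add: algebra_simps del: of_nat_eq_iff\<close>)
  have q: "a * d * (b * c) = a' * d' * (b' * c')"
    by (rule int_int_eq[THEN iffD1]) (use arg_cong[OF eq, of "functional [0, 0, 0, 1, 0, 0, 0, 0, 0, 0]"] in
        \<open>simp add: algebra_simps del: of_nat_eq_iff\<close>)
  \<comment> \<open>The functional yields the mixed sum diminished by \<open>b + c\<close>, which
    \<open>e3\<close> corrects. The integers avoid truncated subtraction.\<close>
  have f: "int a * int c + int b * int d - int b - int c = int a' * int c' + int b' * int d' - int b' - int c'"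
    using arg_cong[OF eq, of "functional [-4, -2, -6, 0, 0, 0, 0, 0, 2, 1]"] by (simp add: algebra_simps)
  have e3: "b + c = b' + c'" using nat_cancel[OF e2 p] v by simp
  with s have e1: "a + d = a' + d'" by simp
  have e4: "b * c = b' * c'" using nat_cancel[OF e2 q] v by simp
  have e5: "a * c + b * d = a' * c' + b' * d'"
    by (rule int_int_eq[THEN iffD1]) (use f arg_cong[OF e3, of int] in simp)
  show ?thesis
    by (rule symmetric_reversal[of "\<lambda>x y z w. has_shape V E Pddd x y z w", OF H e1 e2 e3 e4 e5]) (rule swap_Pddd)
qed

lemma has_shape_unique_Pdcd:
  assumes v: "valid Pdcd a b c d" "valid Pdcd a' b' c' d'"
    and eq: "invariants Pdcd a b c d = invariants Pdcd a' b' c' d'" and H: "has_shape V E Pdcd a' b' c' d'"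
  shows "has_shape V E Pdcd a b c d"
proof -
  have s: "a + b + c + d = a' + b' + c' + d'"
    by (rule int_int_eq[THEN iffD1]) (use arg_cong[OF eq, of "functional [1, 0, 0, 0, 0, 0, 0, 0, 0, 0]"] in
        \<open>simp add: algebra_simps del: of_nat_eq_iff\<close>)
  have e2: "a * d = a' * d'"
    by (rule int_int_eq[THEN iffD1]) (use arg_cong[OF eq, of "functional [2, -2, -6, 8, 8, 0, -4, 1, 2, 0]"] in
        \<open>simp add: algebra_simps del: of_nat_eq_iff\<close>)
  have p: "a * d * (b + c) = a' * d' * (b' + c')"
    by (rule int_int_eq[THEN iffD1]) (use arg_cong[OF eq, of "functional [0, 0, 0, 1, -1, 0, 0, 0, 0, 0]"] in
        \<open>simp add: algebra_simps del: of_nat_eq_iff\<close>)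
  have e4: "b * c = b' * c'"
    by (rule int_int_eq[THEN iffD1]) (use arg_cong[OF eq, of "functional [-6, 2, -10, 0, 0, 0, 0, 1, 2, 0]"] in
        \<open>simp add: algebra_simps del: of_nat_eq_iff\<close>)
  have f: "int a * int c + int b * int d - int b - int c = int a' * int c' + int b' * int d' - int b' - int c'"
    using arg_cong[OF eq, of "functional [-2, 1, 2, -2, -2, 0, 1, 0, -1, 0]"] by (simp add: algebra_simps)
  have e3: "b + c = b' + c'" using nat_cancel[OF e2 p] v by simp
  with s have e1: "a + d = a' + d'" by simp
  have e5: "a * c + b * d = a' * c' + b' * d'"
    by (rule int_int_eq[THEN iffD1]) (use f arg_cong[OF e3, of int] in simp)
  show ?thesis
    by (rule symmetric_reversal[of "\<lambda>x y z w. has_shape V E Pdcd x y z w", OF H e1 e2 e3 e4 e5]) (rule swap_Pdcd)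
qed

lemma has_shape_unique_Pcdc:
  assumes v: "valid Pcdc a b c d" "valid Pcdc a' b' c' d'"
    and eq: "invariants Pcdc a b c d = invariants Pcdc a' b' c' d'" and H: "has_shape V E Pcdc a' b' c' d'"
  shows "has_shape V E Pcdc a b c d"
proof -
  have s: "a + b + c + d = a' + b' + c' + d'"
    by (rule int_int_eq[THEN iffD1]) (use arg_cong[OF eq, of "functional [1, 0, 0, 0, 0, 0, 0, 0, 0, 0]"] in
        \<open>simp add: algebra_simps del: of_nat_eq_iff\<close>)
  have p: "b * c + b + c = b' * c' + b' + c'"
    by (rule int_int_eq[THEN iffD1]) (use arg_cong[OF eq, of "functional [-2, 4, 0, 0, 0, 0, 0, 0, 0, -1]"] in
        \<open>simp add: algebra_simps del: of_nat_eq_iff\<close>)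
  have k: "int a * int d - int b - int c = int a' * int d' - int b' - int c'"
    using arg_cong[OF eq, of "functional [1, -4, 5, 4, 5, -1, -2, 0, 0, 0]"] by (simp add: algebra_simps)
  have q: "a * d * (b + c) + 2 * (b + c) = a' * d' * (b' + c') + 2 * (b' + c')"
    by (rule int_int_eq[THEN iffD1]) (use arg_cong[OF eq, of "functional [8, -6, -10, 8, 0, 0, -2, 0, 4, 1]"] in
        \<open>simp add: algebra_simps del: of_nat_eq_iff\<close>)
  have f: "int a * int c + int b * int d - int b - int c = int a' * int c' + int b' * int d' - int b' - int c'"
    using arg_cong[OF eq, of "functional [-4, -6, -10, 8, -4, 0, 0, 0, 2, 3]"] by (simp add: algebra_simps)
  \<comment> \<open>Put \<open>x = a * d\<close> and \<open>y = b + c\<close>. The invariants give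
    \<open>x - y\<close> and \<open>x * y + 2 * y\<close>; for a fixed difference the latter grows
    strictly with \<open>y\<close>, so both numbers are determined.\<close>
  have mono: "\<not> y < y'" if "int x - int y = int x' - int y'" "x * y + 2 * y = x' * y' + 2 * y'" for x y x' y' :: nat
  proof
    assume "y < y'"
    with that(1) have "x \<le> x'" "y \<le> y'" "y < y'" by linarith+
    then have "x * y \<le> x' * y'" by (intro mult_mono) simp_all
    with that(2) \<open>y < y'\<close> show False by linarith
  qed
  have k': "int (a * d) - int (b + c) = int (a' * d') - int (b' + c')" using k by simp
  have e3: "b + c = b' + c'" using mono[OF k' q] mono[OF k'[symmetric] q[symmetric]] by linarith
  with s p have e1: "a + d = a' + d'" and e4: "b * c = b' * c'" by linarith+
  have e2: "a * d = a' * d'" by (rule int_int_eq[THEN iffD1]) (use k' e3 in linarith)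
  have e5: "a * c + b * d = a' * c' + b' * d'"
    by (rule int_int_eq[THEN iffD1]) (use f arg_cong[OF e3, of int] in simp)
  show ?thesis
    by (rule symmetric_reversal[of "\<lambda>x y z w. has_shape V E Pcdc x y z w", OF H e1 e2 e3 e4 e5]) (rule swap_Pcdc)
qed

lemma has_shape_unique_Pccc:
  assumes v: "valid Pccc a b c d" "valid Pccc a' b' c' d'"
    and eq: "invariants Pccc a b c d = invariants Pccc a' b' c' d'" and H: "has_shape V E Pccc a' b' c' d'"
  shows "has_shape V E Pccc a b c d"
proof -
  have e1: "a + d = a' + d'"
    by (rule int_int_eq[THEN iffD1]) (use arg_cong[OF eq, of "functional [4, -4, 0, 0, 0, 0, 0, 0, 0, 1]"] in
        \<open>simp add: algebra_simps del: of_nat_eq_iff\<close>)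
  have e2: "a * d = a' * d'"
    by (rule int_int_eq[THEN iffD1]) (use arg_cong[OF eq, of "functional [178, -64, -230, 360, 64, -42, -54, 25,
        56, 0]"] in \<open>simp add: algebra_simps del: of_nat_eq_iff\<close>)
  have e3: "b + c = b' + c'"
    by (rule int_int_eq[THEN iffD1]) (use arg_cong[OF eq, of "functional [-2, 4, 0, 0, 0, 0, 0, 0, 0, -1]"] in
        \<open>simp add: algebra_simps del: of_nat_eq_iff\<close>)
  have e4: "b * c = b' * c'"
    by (rule int_int_eq[THEN iffD1]) (use arg_cong[OF eq, of "functional [-62, 64, -342, 424, 64, -58, -38, 33,
        56, 0]"] in \<open>simp add: algebra_simps del: of_nat_eq_iff\<close>)
  have e5: "a * c + b * d = a' * c' + b' * d'"
    by (rule int_int_eq[THEN iffD1]) (use arg_cong[OF eq, of "functional [-18, 0, 46, -48, -8, 6, 6, -5, -8, 0]"]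
        in \<open>simp add: algebra_simps del: of_nat_eq_iff\<close>)
  show ?thesis
    by (rule symmetric_reversal[of "\<lambda>x y z w. has_shape V E Pccc x y z w", OF H e1 e2 e3 e4 e5]) (rule swap_Pccc)
qed

text \<open>Reversing this path would put the leaves of vertex 1 onto the connector. As
  \<open>b > 0\<close>, no such exchange is available, and all four leaf counts are recovered
  individually.\<close>

lemma has_shape_unique_Pddc:
  assumes v: "valid Pddc a b c d" "valid Pddc a' b' c' d'"
    and eq: "invariants Pddc a b c d = invariants Pddc a' b' c' d'" and H: "has_shape V E Pddc a' b' c' d'"
  shows "has_shape V E Pddc a b c d"
proof -
  have s: "a + b + c + d = a' + b' + c' + d'"
    by (rule int_int_eq[THEN iffD1]) (use arg_cong[OF eq, of "functional [1, 0, 0, 0, 0, 0, 0, 0, 0, 0]"] in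
        \<open>simp add: algebra_simps del: of_nat_eq_iff\<close>)
  have e2: "a * d = a' * d'"
    by (rule int_int_eq[THEN iffD1]) (use arg_cong[OF eq, of "functional [0, 2, -10, 24, 8, -4, -4, 2, 2, -1]"]
        in \<open>simp add: algebra_simps del: of_nat_eq_iff\<close>)
  have p: "a * d * b = a' * d' * b'"
    by (rule int_int_eq[THEN iffD1]) (use arg_cong[OF eq, of "functional [0, 0, 0, -2, -2, 1, 0, 0, 0, 0]"] in
        \<open>simp add: algebra_simps del: of_nat_eq_iff\<close>)
  have q: "a * d * c = a' * d' * c'"
    by (rule int_int_eq[THEN iffD1]) (use arg_cong[OF eq, of "functional [-2, 4, -4, 4, 0, -1, 0, 1, 0, -1]"] in
        \<open>simp add: algebra_simps del: of_nat_eq_iff\<close>)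
  have f: "int b * int d - int b - int c = int b' * int d' - int b' - int c'"
    using arg_cong[OF eq, of "functional [-2, -2, 8, -12, -4, 2, 2, -1, -2, 1]"] by (simp add: algebra_simps)
  have b: "b = b'" using nat_cancel[OF e2 p] v by simp
  have c: "c = c'" using nat_cancel[OF e2 q] v by simp
  have e1: "a + d = a' + d'" using s b c by simp
  have "int b * int d = int b * int d'" using f b c by simp
  then have "d = d'" using v by simp
  with e1 b c H show ?thesis by simp
qed

text \<open>For \<open>Pdcc\<close>, with \<open>D = a * d\<close>, the invariants give
  \<open>D\<close>, \<open>D * b\<close>, \<open>D * c\<close> and \<open>D * b * c\<close> only up
  to a common unknown shift \<open>k\<close>, of opposite sign for \<open>D * c\<close>. If
  \<open>k > 0\<close>, comparing \<open>D * b\<close> with \<open>D' * b'\<close> forces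
  \<open>b' <= b\<close>. Then \<open>D' * b' * c' <= b * (D * c - k)\<close>, which is at most
  \<open>D * b * c\<close> and so contradicts the increase by \<open>k\<close>.\<close>

lemma Pdcc_product_mono:
  fixes D b c D' b' c' k :: int
  assumes "0 < D" "0 \<le> b" "0 \<le> b'" "0 \<le> c'" "0 < k" and e: "D' = D + k" "D' * b' = D * b + k"
    "D' * c' = D * c - k" "D' * b' * c' = D * b * c + k"
  shows False
proof -
  have "b' \<le> b"
  proof (rule ccontr)
    assume "\<not> b' \<le> b"
    then have "D' * (b + 1) \<le> D' * b'" using assms by (intro mult_left_mono) auto
    moreover have "D' * (b + 1) = D * b + k + (D + k * b)" unfolding e(1) by Groebner_Basis.algebra
    moreover have "0 \<le> k * b" using assms by simp
    ultimately show False using e(2) assms(1) by linarith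
  qed
  moreover have "0 \<le> D' * c'" using assms(1,4,5) unfolding e(1) by simp
  ultimately have "b' * (D' * c') \<le> b * (D' * c')" by (rule mult_right_mono)
  also have "b * (D' * c') = D * b * c - k * b" unfolding e(3) by Groebner_Basis.algebra
  also have "b' * (D' * c') = D * b * c + k" using e(4) by Groebner_Basis.algebra
  finally have "k + k * b \<le> 0" by simp
  moreover have "0 \<le> k * b" using assms by simp
  ultimately show False using assms(5) by linarith
qed

text \<open>For \<open>b = c = 0\<close> the core is a path with six vertices and leaves at its two
  ends only, so it can be reversed.\<close>

lemma swap_Pdcc: "has_shape V E Pdcc a 0 0 d \<Longrightarrow> has_shape V E Pdcc d 0 0 a"
  by (erule has_shape_relabel[of _ _ _ _ _ _ _ "[3, 5, 4, 0, 2, 1]"]) (auto simp: relabel_simps)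

lemma has_shape_unique_Pdcc:
  assumes v: "valid Pdcc a b c d" "valid Pdcc a' b' c' d'"
    and eq: "invariants Pdcc a b c d = invariants Pdcc a' b' c' d'" and H: "has_shape V E Pdcc a' b' c' d'"
  shows "has_shape V E Pdcc a b c d"
proof -
  have s: "a + b + c + d = a' + b' + c' + d'"
    by (rule int_int_eq[THEN iffD1]) (use arg_cong[OF eq, of "functional [1, 0, 0, 0, 0, 0, 0, 0, 0, 0]"] in
        \<open>simp add: algebra_simps del: of_nat_eq_iff\<close>)
  have h1: "int a * int d - (int b * int d - int b - int c) = int a' * int d' - (int b' * int d' - int b' - int c')"
    using arg_cong[OF eq, of "functional [-28, 42, -34, 48, 8, -8, -4, 6, 2, -9]"] by (simp add: algebra_simps)
  have h2: "int a * int d * int b - (int b * int d - int b - int c) = int a' * int d' * int b' - (int b' * int d'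
      - int b' - int c')"
    using arg_cong[OF eq, of "functional [-6, 10, -6, 6, 0, -1, 0, 1, 0, -2]"] by (simp add: algebra_simps)
  have h3: "int a * int d * int c + (int b * int d - int b - int c) = int a' * int d' * int c' + (int b' * int d'
      - int b' - int c')"
    using arg_cong[OF eq, of "functional [36, -46, 18, -28, -4, 6, 0, -4, 2, 9]"] by (simp add: algebra_simps)
  have h4: "int a * int d * int b * int c - (int b * int d - int b - int c) = int a' * int d' * int b' * int c' -
      (int b' * int d' - int b' - int c')"
    using arg_cong[OF eq, of "functional [-36, 46, -18, 20, 4, -4, 0, 4, -2, -9]"] by (simp add: algebra_simps)
  have p: "a * b + c = a' * b' + c'"
    by (rule int_int_eq[THEN iffD1]) (use arg_cong[OF eq, of "functional [-2, 4, 0, 0, 0, 0, 0, 0, 0, -1]"] in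
        \<open>simp add: algebra_simps del: of_nat_eq_iff\<close>)
  have q: "c * (b + 1) * d = c' * (b' + 1) * d'"
    by (rule int_int_eq[THEN iffD1]) (use arg_cong[OF eq, of "functional [-6, 6, 4, -10, -2, 1, 2, 0, -2, -1]"]
        in \<open>simp add: algebra_simps del: of_nat_eq_iff\<close>)
  \<comment> \<open>This expression is the common shift in \<open>h1\<close> to \<open>h4\<close>.
    If it differed between the two trees, \<open>Pdcc_product_mono\<close> would apply in one
    direction or the other.\<close>
  have X: "int b * int d - int b - int c = int b' * int d' - int b' - int c'" (is "?X = ?X'")
  proof (rule linorder_cases[of ?X ?X'])
    assume "?X < ?X'"
    then have False using Pdcc_product_mono[of "int a * int d" "int b" "int b'" "int c'" "?X' - ?X"
        "int a' * int d'" "int c"]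
      using v h1 h2 h3 h4 by simp
    then show ?thesis ..
  next
    assume "?X > ?X'"
    then have False using Pdcc_product_mono[of "int a' * int d'" "int b'" "int b" "int c" "?X - ?X'"
        "int a * int d" "int c'"]
      using v h1 h2 h3 h4 by simp
    then show ?thesis ..
  qed
  have e2: "a * d = a' * d'" "a * d * b = a' * d' * b'" "a * d * c = a' * d' * c'"
    using h1 h2 h3 X by (simp_all flip: of_nat_mult of_nat_add)
  have b: "b = b'" using nat_cancel[OF e2(1,2)] v by simp
  have c: "c = c'" using nat_cancel[OF e2(1,3)] v by simp
  have "a + d = a' + d'" using s b c by simp
  from sum_prod_pair[OF this e2(1)] show ?thesis
  proof
    assume "a = a' \<and> d = d'"
    with H b c show ?thesis by simp
  next
    assume ad: "a = d' \<and> d = a'"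
    \<comment> \<open>Exchanging \<open>a\<close> and \<open>d\<close> is a symmetry if
      \<open>b = c = 0\<close>. Otherwise the exchange is trivial: \<open>p\<close> gives
      \<open>a = d\<close> if \<open>b > 0\<close>, and \<open>q\<close> does so if
      \<open>b = 0\<close> and \<open>c > 0\<close>.\<close>
    show ?thesis
    proof (cases "b = 0 \<and> c = 0")
      case True
      with b c H have "has_shape V E Pdcc a' 0 0 d'" by simp
      from swap_Pdcc[OF this] show ?thesis using True ad by simp
    next
      case False
      have "a = d"
      proof (cases "b = 0")
        case True
        then have "c * d = c * d'" using q b c by simp
        then show ?thesis using True False ad by simp
      next
        case False
        then show ?thesis using p b c ad by simp
      qed
      with ad have "a = a'" "d = d'" by simp_all
      with H b c show ?thesis by simp
    qed
  qed
qed

lemma swap_Sddd_0: "has_shape V E Sddd a b c d \<Longrightarrow> has_shape V E Sddd a c b d"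
  by (erule has_shape_relabel[of _ _ _ _ _ _ _ "[0, 2, 1, 3]"]) (auto simp: relabel_simps)

lemma swap_Sddd_1: "has_shape V E Sddd a b c d \<Longrightarrow> has_shape V E Sddd a b d c"
  by (erule has_shape_relabel[of _ _ _ _ _ _ _ "[0, 1, 3, 2]"]) (auto simp: relabel_simps)

lemma swap_Sccc_0: "has_shape V E Sccc a b c d \<Longrightarrow> has_shape V E Sccc a c b d"
  by (erule has_shape_relabel[of _ _ _ _ _ _ _ "[0, 2, 1, 3, 5, 4, 6]"]) (auto simp: relabel_simps)

lemma swap_Sccc_1: "has_shape V E Sccc a b c d \<Longrightarrow> has_shape V E Sccc a b d c"
  by (erule has_shape_relabel[of _ _ _ _ _ _ _ "[0, 1, 3, 2, 4, 6, 5]"]) (auto simp: relabel_simps)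

lemma has_shape_unique_Sddd:
  assumes v: "valid Sddd a b c d" "valid Sddd a' b' c' d'"
    and eq: "invariants Sddd a b c d = invariants Sddd a' b' c' d'" and H: "has_shape V E Sddd a' b' c' d'"
  shows "has_shape V E Sddd a b c d"
proof -
  have s: "a + b + c + d = a' + b' + c' + d'"
    by (rule int_int_eq[THEN iffD1]) (use arg_cong[OF eq, of "functional [1, 0, 0, 0, 0, 0, 0, 0, 0, 0]"] in
        \<open>simp add: algebra_simps del: of_nat_eq_iff\<close>)
  have e3: "b * c * d = b' * c' * d'"
    by (rule int_int_eq[THEN iffD1]) (use arg_cong[OF eq, of "functional [0, 0, -2, 0, 0, 0, 0, 1, 0, 0]"] in
        \<open>simp add: algebra_simps del: of_nat_eq_iff\<close>)
  have p: "b * c * d * a = b' * c' * d' * a'"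
    by (rule int_int_eq[THEN iffD1]) (use arg_cong[OF eq, of "functional [0, 0, 0, 1, 0, 0, 0, 0, 0, 0]"] in
        \<open>simp add: algebra_simps del: of_nat_eq_iff\<close>)
  have e2: "b * c + b * d + c * d = b' * c' + b' * d' + c' * d'"
    by (rule int_int_eq[THEN iffD1]) (use arg_cong[OF eq, of "functional [0, -2, 0, 0, 0, 0, 0, 0, 0, 1]"] in
        \<open>simp add: algebra_simps del: of_nat_eq_iff\<close>)
  have a: "a = a'" using nat_cancel[OF e3 p] v by simp
  with s have e1: "b + c + d = b' + c' + d'" by simp
  show ?thesis unfolding a
    by (rule symmetric_triple[of "\<lambda>x y w. has_shape V E Sddd a' x y w", OF H e1 e2 e3]) (fact swap_Sddd_0 swap_Sddd_1)+
qed

lemma has_shape_unique_Sccc: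
  assumes v: "valid Sccc a b c d" "valid Sccc a' b' c' d'"
    and eq: "invariants Sccc a b c d = invariants Sccc a' b' c' d'" and H: "has_shape V E Sccc a' b' c' d'"
  shows "has_shape V E Sccc a b c d"
proof -
  have a: "a = a'"
    by (rule int_int_eq[THEN iffD1]) (use arg_cong[OF eq, of "functional [-2, 4, 0, 0, 0, 0, 0, 0, 0, -1]"] in
        \<open>simp add: algebra_simps del: of_nat_eq_iff\<close>)
  have e1: "b + c + d = b' + c' + d'"
    by (rule int_int_eq[THEN iffD1]) (use arg_cong[OF eq, of "functional [6, -4, 0, 0, 0, 0, 0, 0, 0, 1]"] in
        \<open>simp add: algebra_simps del: of_nat_eq_iff\<close>)
  have e2: "b * c + b * d + c * d = b' * c' + b' * d' + c' * d'"
    by (rule int_int_eq[THEN iffD1]) (use arg_cong[OF eq, of "functional [-18, 2, 24, 0, 0, 0, 0, -1, -6, 0]"] in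
        \<open>simp add: algebra_simps del: of_nat_eq_iff\<close>)
  have e3: "b * c * d = b' * c' * d'"
    by (rule int_int_eq[THEN iffD1]) (use arg_cong[OF eq, of "functional [0, 6, -11, 1, -7, 1, 3, 0, 0, 0]"] in
        \<open>simp add: algebra_simps del: of_nat_eq_iff\<close>)
  show ?thesis unfolding a
    by (rule symmetric_triple[of "\<lambda>x y w. has_shape V E Sccc a' x y w", OF H e1 e2 e3]) (fact swap_Sccc_0 swap_Sccc_1)+
qed

lemma swap_Sddc: "has_shape V E Sddc a b c d \<Longrightarrow> has_shape V E Sddc a c b d"
  by (erule has_shape_relabel[of _ _ _ _ _ _ _ "[0, 2, 1, 3, 4]"]) (auto simp: relabel_simps)

lemma swap_Td: "has_shape V E Td a b c d \<Longrightarrow> has_shape V E Td a c b d"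
  by (erule has_shape_relabel[of _ _ _ _ _ _ _ "[0, 2, 1, 3, 4]"]) (auto simp: relabel_simps)

lemma swap_Tc: "has_shape V E Tc a b c d \<Longrightarrow> has_shape V E Tc a c b d"
  by (erule has_shape_relabel[of _ _ _ _ _ _ _ "[0, 2, 1, 3, 4, 5]"]) (auto simp: relabel_simps)

lemma has_shape_unique_Sddc:
  assumes v: "valid Sddc a b c d" "valid Sddc a' b' c' d'"
    and eq: "invariants Sddc a b c d = invariants Sddc a' b' c' d'" and H: "has_shape V E Sddc a' b' c' d'"
  shows "has_shape V E Sddc a b c d"
proof -
  have s: "a + b + c + d = a' + b' + c' + d'"
    by (rule int_int_eq[THEN iffD1]) (use arg_cong[OF eq, of "functional [1, 0, 0, 0, 0, 0, 0, 0, 0, 0]"] in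
        \<open>simp add: algebra_simps del: of_nat_eq_iff\<close>)
  have p: "b * c * d = b' * c' * d'"
    by (rule int_int_eq[THEN iffD1]) (use arg_cong[OF eq, of "functional [0, 0, 0, -2, -2, 1, 0, 0, 0, 0]"] in
        \<open>simp add: algebra_simps del: of_nat_eq_iff\<close>)
  have q: "b * c * d * a = b' * c' * d' * a'"
    by (rule int_int_eq[THEN iffD1]) (use arg_cong[OF eq, of "functional [0, 0, 0, 0, 1, 0, 0, 0, 0, 0]"] in
        \<open>simp add: algebra_simps del: of_nat_eq_iff\<close>)
  have e2: "b * c = b' * c'"
    by (rule int_int_eq[THEN iffD1]) (use arg_cong[OF eq, of "functional [-4, 6, 2, -12, -4, 0, 4, 0, -2, -1]"]
        in \<open>simp add: algebra_simps del: of_nat_eq_iff\<close>)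
  have a: "a = a'" using nat_cancel[OF p q] v by simp
  have d: "d = d'" using nat_cancel[OF e2 p] v by simp
  from s a d have e1: "b + c = b' + c'" by simp
  show ?thesis unfolding a d
    by (rule symmetric_pair[of "\<lambda>x y. has_shape V E Sddc a' x y d'", OF H e1 e2]) (rule swap_Sddc)
qed

lemma has_shape_unique_Td:
  assumes v: "valid Td a b c d" "valid Td a' b' c' d'"
    and eq: "invariants Td a b c d = invariants Td a' b' c' d'" and H: "has_shape V E Td a' b' c' d'"
  shows "has_shape V E Td a b c d"
proof -
  have s: "a + b + c + d = a' + b' + c' + d'"
    by (rule int_int_eq[THEN iffD1]) (use arg_cong[OF eq, of "functional [1, 0, 0, 0, 0, 0, 0, 0, 0, 0]"] in
        \<open>simp add: algebra_simps del: of_nat_eq_iff\<close>)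
  have p: "b * c * d = b' * c' * d'"
    by (rule int_int_eq[THEN iffD1]) (use arg_cong[OF eq, of "functional [0, 0, 0, -2, -1, 1, 0, 0, 0, 0]"] in
        \<open>simp add: algebra_simps del: of_nat_eq_iff\<close>)
  have q: "b * c * d * a = b' * c' * d' * a'"
    by (rule int_int_eq[THEN iffD1]) (use arg_cong[OF eq, of "functional [0, 0, 0, 0, 1, 0, 0, 0, 0, 0]"] in
        \<open>simp add: algebra_simps del: of_nat_eq_iff\<close>)
  have r: "(a + 1) * (b * c) = (a' + 1) * (b' * c')"
    by (rule int_int_eq[THEN iffD1]) (use arg_cong[OF eq, of "functional [0, 0, 4, -42, -2, 3, 8, -2, 0, 0]"] in
        \<open>simp add: algebra_simps del: of_nat_eq_iff\<close>)
  have a: "a = a'" using nat_cancel[OF p q] v by simp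
  have e2: "b * c = b' * c'" using nat_cancel[OF _ r] a by simp
  have d: "d = d'" using nat_cancel[OF e2 p] v by simp
  from s a d have e1: "b + c = b' + c'" by simp
  show ?thesis unfolding a d
    by (rule symmetric_pair[of "\<lambda>x y. has_shape V E Td a' x y d'", OF H e1 e2]) (rule swap_Td)
qed

lemma has_shape_unique_Tc:
  assumes v: "valid Tc a b c d" "valid Tc a' b' c' d'"
    and eq: "invariants Tc a b c d = invariants Tc a' b' c' d'" and H: "has_shape V E Tc a' b' c' d'"
  shows "has_shape V E Tc a b c d"
proof -
  have s: "a + b + c + d = a' + b' + c' + d'"
    by (rule int_int_eq[THEN iffD1]) (use arg_cong[OF eq, of "functional [1, 0, 0, 0, 0, 0, 0, 0, 0, 0]"] in
        \<open>simp add: algebra_simps del: of_nat_eq_iff\<close>)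
  have p: "b * c * d = b' * c' * d'"
    by (rule int_int_eq[THEN iffD1]) (use arg_cong[OF eq, of "functional [-580, 362, -22, 4, -4, -2, 8, 12, -30,
        -55]"] in \<open>simp add: algebra_simps del: of_nat_eq_iff\<close>)
  have e2: "b * c = b' * c'"
    by (rule int_int_eq[THEN iffD1]) (use arg_cong[OF eq, of "functional [206, -130, 12, -8, 0, 2, -2, -5, 10,
        20]"] in \<open>simp add: algebra_simps del: of_nat_eq_iff\<close>)
  have r: "int a - int d = int a' - int d'"
    using arg_cong[OF eq, of "functional [-4, 4, 0, 0, 0, 0, 0, 0, 0, -1]"] by (simp add: algebra_simps)
  have d: "d = d'" using nat_cancel[OF e2 p] v by simp
  with r have a: "a = a'" by simp
  from s a d have e1: "b + c = b' + c'" by simp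
  show ?thesis unfolding a d
    by (rule symmetric_pair[of "\<lambda>x y. has_shape V E Tc a' x y d'", OF H e1 e2]) (rule swap_Tc)
qed

lemma swap_Sdcc: "has_shape V E Sdcc a b c d \<Longrightarrow> has_shape V E Sdcc a b d c"
  by (erule has_shape_relabel[of _ _ _ _ _ _ _ "[0, 1, 3, 2, 5, 4]"]) (auto simp: relabel_simps)

lemma has_shape_unique_Sdcc:
  assumes v: "valid Sdcc a b c d" "valid Sdcc a' b' c' d'"
    and eq: "invariants Sdcc a b c d = invariants Sdcc a' b' c' d'" and H: "has_shape V E Sdcc a' b' c' d'"
  shows "has_shape V E Sdcc a b c d"
proof -
  have s: "a + b = a' + b'"
    by (rule int_int_eq[THEN iffD1]) (use arg_cong[OF eq, of "functional [16, -10, 6, -12, 0, 2, 0, -2, 2, 1]"]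
        in \<open>simp add: algebra_simps del: of_nat_eq_iff\<close>)
  have e1: "c + d = c' + d'"
    by (rule int_int_eq[THEN iffD1]) (use arg_cong[OF eq, of "functional [-8, 10, -6, 12, 0, -2, 0, 2, -2, -1]"]
        in \<open>simp add: algebra_simps del: of_nat_eq_iff\<close>)
  have p: "(a + b) * (c * d) = (a' + b') * (c' * d')"
    by (rule int_int_eq[THEN iffD1]) (use arg_cong[OF eq, of "functional [-10, 14, -10, 6, 0, -1, 0, 2, 0, -3]"]
        in \<open>simp add: algebra_simps del: of_nat_eq_iff\<close>)
  have r: "int c * int d - 2 * int b = int c' * int d' - 2 * int b'"
    using arg_cong[OF eq, of "functional [0, 2, -10, 20, 4, -2, -4, 2, 2, -1]"] by (simp add: algebra_simps)
  have e2: "c * d = c' * d'" using nat_cancel[OF s p] v by simp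
  have "int b = int b'" using r arg_cong[OF e2, of int] by simp
  then have b: "b = b'" by simp
  with s have a: "a = a'" by simp
  show ?thesis unfolding a b
    by (rule symmetric_pair[of "\<lambda>x y. has_shape V E Sdcc a' b' x y", OF H e1 e2]) (rule swap_Sdcc)
qed

lemma swap_Q_0: "has_shape V E Q a b c d \<Longrightarrow> has_shape V E Q b a c d"
  by (erule has_shape_relabel[of _ _ _ _ _ _ _ "[1, 0, 2, 3, 4]"]) (auto simp: relabel_simps)

lemma swap_Q_1: "has_shape V E Q a b c d \<Longrightarrow> has_shape V E Q a c b d"
  by (erule has_shape_relabel[of _ _ _ _ _ _ _ "[0, 2, 1, 3, 4]"]) (auto simp: relabel_simps)

lemma swap_Q_2: "has_shape V E Q a b c d \<Longrightarrow> has_shape V E Q a b d c"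
  by (erule has_shape_relabel[of _ _ _ _ _ _ _ "[0, 1, 3, 2, 4]"]) (auto simp: relabel_simps)

lemma has_shape_unique_Q:
  assumes v: "valid Q a b c d" "valid Q a' b' c' d'"
    and eq: "invariants Q a b c d = invariants Q a' b' c' d'" and H: "has_shape V E Q a' b' c' d'"
  shows "has_shape V E Q a b c d"
proof -
  have e1: "a + b + c + d = a' + b' + c' + d'"
    by (rule int_int_eq[THEN iffD1]) (use arg_cong[OF eq, of "functional [1, 0, 0, 0, 0, 0, 0, 0, 0, 0]"] in
        \<open>simp add: algebra_simps del: of_nat_eq_iff\<close>)
  have e2: "a * b + a * c + a * d + b * c + b * d + c * d = a' * b' + a' * c' + a' * d' + b' * c' + b' * d' + c' * d'"
    by (rule int_int_eq[THEN iffD1]) (use arg_cong[OF eq, of "functional [-3, 1, 0, 0, 0, 0, 0, 0, 0, 0]"] in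
        \<open>simp add: algebra_simps del: of_nat_eq_iff\<close>)
  have e3: "a * b * c + a * b * d + a * c * d + b * c * d = a' * b' * c' + a' * b' * d' + a' * c' * d' + b' * c' * d'"
    by (rule int_int_eq[THEN iffD1]) (use arg_cong[OF eq, of "functional [0, 0, -2, 0, 0, 0, 0, 1, 0, 0]"] in
        \<open>simp add: algebra_simps del: of_nat_eq_iff\<close>)
  have e4: "a * b * c * d = a' * b' * c' * d'"
    by (rule int_int_eq[THEN iffD1]) (use arg_cong[OF eq, of "functional [0, 0, 0, 0, 1, 0, 0, 0, 0, 0]"] in
        \<open>simp add: algebra_simps del: of_nat_eq_iff\<close>)
  show ?thesis
    by (rule symmetric_quadruple[of "\<lambda>x y z w. has_shape V E Q x y z w", OF H e1 e2 e3 e4]) (fact swap_Q_0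
        swap_Q_1 swap_Q_2)+
qed

lemma has_shape_unique:
  assumes "valid s a b c d" "valid s a' b' c' d'"
    and "invariants s a b c d = invariants s a' b' c' d'" and "has_shape V E s a' b' c' d'"
  shows "has_shape V E s a b c d"
proof (cases s)
  case Star
  show ?thesis using has_shape_unique_Star assms unfolding Star by blast
next
  case Pd
  show ?thesis using has_shape_unique_Pd assms unfolding Pd by blast
next
  case Pc
  show ?thesis using has_shape_unique_Pc assms unfolding Pc by blast
next
  case Pdd
  show ?thesis using has_shape_unique_Pdd assms unfolding Pdd by blast
next
  case Pdc
  show ?thesis using has_shape_unique_Pdc assms unfolding Pdc by blast
next
  case Pcc
  show ?thesis using has_shape_unique_Pcc assms unfolding Pcc by blast
next
  case Tri
  show ?thesis using has_shape_unique_Tri assms unfolding Tri by blast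
next
  case Pddd
  show ?thesis using has_shape_unique_Pddd assms unfolding Pddd by blast
next
  case Pddc
  show ?thesis using has_shape_unique_Pddc assms unfolding Pddc by blast
next
  case Pdcd
  show ?thesis using has_shape_unique_Pdcd assms unfolding Pdcd by blast
next
  case Pcdc
  show ?thesis using has_shape_unique_Pcdc assms unfolding Pcdc by blast
next
  case Pdcc
  show ?thesis using has_shape_unique_Pdcc assms unfolding Pdcc by blast
next
  case Pccc
  show ?thesis using has_shape_unique_Pccc assms unfolding Pccc by blast
next
  case Sddd
  show ?thesis using has_shape_unique_Sddd assms unfolding Sddd by blast
next
  case Sddc
  show ?thesis using has_shape_unique_Sddc assms unfolding Sddc by blast
next
  case Sdcc
  show ?thesis using has_shape_unique_Sdcc assms unfolding Sdcc by blast
next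
  case Sccc
  show ?thesis using has_shape_unique_Sccc assms unfolding Sccc by blast
next
  case Td
  show ?thesis using has_shape_unique_Td assms unfolding Td by blast
next
  case Tc
  show ?thesis using has_shape_unique_Tc assms unfolding Tc by blast
next
  case Q
  show ?thesis using has_shape_unique_Q assms unfolding Q by blast
qed

section \<open>The theorem\<close>

lemma walk_data_shape:
  "valid s a b c d \<Longrightarrow> walk_data (core_size s) (sc (core_edges s)) (lv [a, b, c, d]) (invariants s a b c d)"
  by (cases s) (simp_all only: valid.simps core_size.simps core_edges.simps walk_data_Star walk_data_Pd
      walk_data_Pc walk_data_Pdd walk_data_Pdc walk_data_Pcc walk_data_Tri walk_data_Pddd walk_data_Pddc
      walk_data_Pdcd walk_data_Pcdc walk_data_Pdcc walk_data_Pccc walk_data_Sddd walk_data_Sddc walk_data_Sdcc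
      walk_data_Sccc walk_data_Td walk_data_Tc walk_data_Q)

lemma matching_data_shape:
  "valid s a b c d \<Longrightarrow> matching_data (cover_size s) (core_size s) (sc (core_edges s)) (lv [a, b, c, d]) (invariants
      s a b c d)"
  by (cases s) (simp_all only: valid.simps cover_size.simps core_size.simps core_edges.simps matching_data_Star
      matching_data_Pd matching_data_Pc matching_data_Pdd matching_data_Pdc matching_data_Pcc matching_data_Tri
      matching_data_Pddd matching_data_Pddc matching_data_Pdcd matching_data_Pcdc matching_data_Pdcc
      matching_data_Pccc matching_data_Sddd matching_data_Sddc matching_data_Sdcc matching_data_Sccc
      matching_data_Td matching_data_Tc matching_data_Q)

lemma core_edges_cover:
  "cover_size s \<le> core_size s" "cover_size s \<le> 4"
  "cover_size s \<le> i \<Longrightarrow> cover_size s \<le> j \<Longrightarrow> (i, j) \<notin> sc (core_edges s)" "(i, i) \<notin> sc (core_edges s)"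
  by (cases s; auto simp: sc_Cons sc_Nil)+

lemma valid_lv: "valid s a b c d \<Longrightarrow> cover_size s \<le> i \<Longrightarrow> lv [a, b, c, d] i = 0"
  by (cases s) (auto simp: lv_def nth_Cons split: nat.splits)

text \<open>The factor \<open>x ^ 8\<close> absorbs the dependence on the cover size, so that trees
  of different shapes can be compared.\<close>

lemma has_shape_char_poly:
  assumes H: "has_shape (pverts G) (parcs G) s a b c d" and v: "valid s a b c d" and x: "x \<noteq> 0"
    and inv: "invariants s a b c d = (n, m2, m3, m4, g)"
  shows "x ^ 8 * poly (char_poly (adjacency_matrix G)) x =
    x ^ card (pverts G) * (x ^ 8 - (real n - 1) * x ^ 6 + real m2 * x ^ 4 - real m3 * x\<^sup>2 + real m4)"
proof -
  let ?c = "cover_size s" and ?k = "core_size s" and ?N = "card (pverts G)"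
    and ?P = "poly (char_poly (adjacency_matrix G)) x"
  obtain f g' where M: "modelled (pverts G) (parcs G) ?k (sc (core_edges s)) (lv [a, b, c, d]) f g'"
    using H by (auto simp: has_shape_def model_def)
  let ?D = "det (mat ?c ?c (\<lambda>(i, j). schur_entry ?c ?k (sc (core_edges s)) (lv [a, b, c, d]) x i j))"
  have eq: "x ^ ?c * ?P = x ^ (?N - ?c) * ?D"
    by (rule modelled_char_poly[OF M core_edges_cover(1) _ core_edges_cover(3,4) x]) (simp_all add: valid_lv[OF v])
  have "card (f ` {..<?k}) \<le> ?N" using M by (intro card_mono) (auto simp: modelled_def)
  then have N: "?c \<le> ?N" using M core_edges_cover(1)[of s] by (simp add: modelled_def card_image)
  have D: "x ^ (8 - 2 * ?c) * ?D = x ^ 8 - (real n - 1) * x ^ 6 + real m2 * x ^ 4 - real m3 * x\<^sup>2 + real m4"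
    using matching_data_shape[OF v] unfolding inv by (cases g) simp
  have "x ^ 8 * ?P = x ^ (8 - 2 * ?c) * x ^ ?c * (x ^ ?c * ?P)"
    using core_edges_cover(2)[of s] by (simp flip: power_add)
  also have "\<dots> = x ^ ?c * x ^ (?N - ?c) * (x ^ (8 - 2 * ?c) * ?D)" unfolding eq by (simp only: ac_simps)
  also have "x ^ ?c * x ^ (?N - ?c) = x ^ ?N" using N by (simp flip: power_add)
  finally show ?thesis unfolding D .
qed

lemma quartic_coefficients:
  fixes p q r p' q' r' :: real
  assumes "\<And>x. x \<noteq> 0 \<Longrightarrow> p * x ^ 4 - q * x\<^sup>2 + r = p' * x ^ 4 - q' * x\<^sup>2 + r'"
  shows "p = p'" "q = q'" "r = r'"
  \<comment> \<open>Two quadratics in \<open>x\<^sup>2\<close> that agree at the three values 1, 4,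
    9 coincide.\<close>
  using assms[of 1] assms[of 2] assms[of 3] by simp_all

lemma walk_data_unique:
  assumes "walk_data k R l (n, m2, m3, m4, g)" "walk_data k' R' l' (n, m2, m3, m4, g')"
    and "\<And>i j. walk_count k R l i j = walk_count k' R' l' i j"
  shows "g = g'"
proof -
  obtain g0 h1 h2 g3 g4 h5 where g: "g = (g0, h1, h2, g3, g4, h5)" by (cases g)
  obtain g0' h1' h2' g3' g4' h5' where g': "g' = (g0', h1', h2', g3', g4', h5')" by (cases g')
  show ?thesis
    using assms(1,2) unfolding g g' walk_data.simps Let_def assms(3) prod.inject
    by (elim conjE, intro conjI) linarith+
qed

lemma undirected_edges_finite: "finite (parcs G) \<Longrightarrow> finite (undirected_edges G)"
  unfolding undirected_edges_def
  by (rule finite_subset[of _ "(\<lambda>(u, v). {u, v}) ` parcs G"]) auto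

lemma card_le_matching_number:
  assumes "finite (parcs G)" "edge_matching (parcs G) M"
  shows "card M \<le> matching_number G"
proof -
  have "finite {M. matching G M}"
    by (rule finite_subset[of _ "Pow (undirected_edges G)"])
      (use assms(1) in \<open>auto simp: matching_def undirected_edges_finite\<close>)
  moreover have "matching G M"
    using assms(2) by (simp add: matching_def edge_matching_def undirected_edges_def)
  ultimately show ?thesis unfolding matching_number_def by (intro Max_ge) auto
qed

lemma undirected_tree_shape:
  assumes "undirected_tree G" "matching_number G \<le> 4" "2 \<le> card (pverts G)"
  shows "\<exists>s a b c d. valid s a b c d \<and> has_shape (pverts G) (parcs G) s a b c d"
proof -
  have G: "utree (pverts G) (parcs G)" by (rule undirected_tree_utree[OF assms(1)])
  then have fin: "finite (parcs G)" by (auto simp: utree_def intro: finite_subset)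
  obtain r par dep where "rooted (pverts G) (parcs G) r par dep" using utree_rooted[OF G] by blast
  from rooted_shaped[OF this assms(3)] show ?thesis
  proof (elim disjE exE conjE)
    fix M assume "edge_matching (parcs G) M" "5 \<le> card M"
    with card_le_matching_number[OF fin this(1)] assms(2) show ?thesis by linarith
  next
    fix c assume "shaped (pverts G) (parcs G) c"
    then show ?thesis unfolding shaped_def by blast
  qed
qed

lemma adjacency_matrix_symmetric:
  assumes "undirected_tree G" "i < card (pverts G)" "j < card (pverts G)"
  shows "adjacency_matrix G $$ (i, j) = adjacency_matrix G $$ (j, i)"
  using undirected_tree_utree[OF assms(1)] assms(2,3)
  by (auto simp: adjacency_matrix_def utree_def dest: symD)

lemma isomorphic_single_vertex:
  assumes "utree V E" "utree V' E'" "card V = 1" "card V' = 1"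
  shows "\<exists>h. bij_betw h V V' \<and> (\<forall>u\<in>V. \<forall>v\<in>V. (u, v) \<in> E \<longleftrightarrow> (h u, h v) \<in> E')"
proof -
  obtain u v where V: "V = {u}" "V' = {v}" using assms(3,4) by (auto simp: card_1_singleton_iff)
  moreover have "(u, u) \<notin> E" "(v, v) \<notin> E'" using assms(1,2) by (auto simp: utree_def irrefl_def)
  ultimately show ?thesis by (intro exI[of _ "\<lambda>_. v"]) (auto simp: bij_betw_def)
qed

text \<open>The order matters: walks of length 0 give the number of vertices, after which the powers
  of \<open>x\<close> cancel and comparing coefficients gives \<open>m2, m3, m4\<close>. These in
  turn are needed to obtain the remaining components from the walk numbers.\<close>

lemma invariants_eq:
  fixes G :: "'a pair_pre_digraph" and G' :: "'b pair_pre_digraph"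
  assumes H: "has_shape (pverts G) (parcs G) s a b c d" and v: "valid s a b c d"
    and H': "has_shape (pverts G') (parcs G') t a' b' c' d'" and v': "valid t a' b' c' d'"
    and p: "char_poly (adjacency_matrix G) = char_poly (adjacency_matrix G')"
    and w: "\<And>k. (\<Sum>u\<in>pverts G. walks (pverts G) (parcs G) k u) = (\<Sum>u\<in>pverts G'. walks (pverts G') (parcs G') k u)"
  shows "invariants s a b c d = invariants t a' b' c' d'"
proof -
  obtain n m2 m3 m4 g where I: "invariants s a b c d = (n, m2, m3, m4, g)" by (metis surj_pair)
  obtain n' m2' m3' m4' g' where I': "invariants t a' b' c' d' = (n', m2', m3', m4', g')" by (metis surj_pair)
  note M = H[unfolded has_shape_def] and M' = H'[unfolded has_shape_def]
  have W: "walk_count (core_size s) (sc (core_edges s)) (lv [a, b, c, d]) i j =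
    walk_count (core_size t) (sc (core_edges t)) (lv [a', b', c', d']) i j" for i j
    using w[of "i + j"] unfolding model_sum_walks[OF M] model_sum_walks[OF M'] .
  note D = walk_data_shape[OF v, unfolded I] and D' = walk_data_shape[OF v', unfolded I']
  have "int n = int n'" using D D' W by (cases g; cases g') (simp add: Let_def)
  then have n: "n = n'" by simp
  have N: "card (pverts G) = card (pverts G')" using w[of 0] by simp
  have "real m2 * x ^ 4 - real m3 * x\<^sup>2 + real m4 = real m2' * x ^ 4 - real m3' * x\<^sup>2 + real m4'" if "x \<noteq> 0" for x
  proof -
    have "x ^ card (pverts G') * (x ^ 8 - (real n' - 1) * x ^ 6 + real m2 * x ^ 4 - real m3 * x\<^sup>2 + real m4) =
      x ^ card (pverts G') * (x ^ 8 - (real n' - 1) * x ^ 6 + real m2' * x ^ 4 - real m3' * x\<^sup>2 + real m4')"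
      using has_shape_char_poly[OF H v that I] has_shape_char_poly[OF H' v' that I'] p by (simp only: N n)
    then show ?thesis using that by simp
  qed
  from quartic_coefficients[OF this] have m: "m2 = m2'" "m3 = m3'" "m4 = m4'" by simp_all
  have "g = g'" using D D' W unfolding n m by (rule walk_data_unique)
  then show ?thesis unfolding I I' n m by simp
qed

theorem theorem1p2:
  fixes T :: "'a pair_pre_digraph" and T' :: "'b pair_pre_digraph"
  assumes "undirected_tree T" and "undirected_tree T'"
    and "matching_number T \<le> 4" and "matching_number T' \<le> 4"
    and "adjacency_spectrum T = adjacency_spectrum T'"
    and "\<And>k::nat. all_ones T \<bullet> ((adjacency_matrix T ^\<^sub>m k) *\<^sub>v all_ones T)
                 = all_ones T' \<bullet> ((adjacency_matrix T' ^\<^sub>m k) *\<^sub>v all_ones T')"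
  shows "digraph_iso (with_proj T) (with_proj T')"
proof -
  have U: "utree (pverts T) (parcs T)" "utree (pverts T') (parcs T')"
    by (rule undirected_tree_utree; fact)+
  then have fin: "finite (pverts T)" "finite (pverts T')" and pos: "card (pverts T) \<noteq> 0"
    by (auto simp: utree_def)
  have w: "(\<Sum>u\<in>pverts T. walks (pverts T) (parcs T) k u) = (\<Sum>u\<in>pverts T'. walks (pverts T') (parcs T') k u)" for k
    using assms(6)[of k] unfolding fin[THEN adjacency_pow_all_ones] of_nat_eq_iff .
  have N: "card (pverts T) = card (pverts T')" using w[of 0] by simp
  have "char_poly (adjacency_matrix T) = char_poly (adjacency_matrix T')"
    by (rule char_poly_eq_of_proots_eq[of _ "card (pverts T)" _ "card (pverts T')"])
      (use assms(1,2,5) in \<open>simp_all add: adjacency_spectrum_def adjacency_matrix_symmetric, simp_all add: adjacency_matrix_def\<close>)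
  note p = this
  have "\<exists>h. bij_betw h (pverts T) (pverts T') \<and>
    (\<forall>u\<in>pverts T. \<forall>v\<in>pverts T. (u, v) \<in> parcs T \<longleftrightarrow> (h u, h v) \<in> parcs T')"
  \<comment> \<open>A single vertex has no shape, since even \<open>Star\<close> requires a
    leaf.\<close>
  proof (cases "card (pverts T) = 1")
    case True
    then show ?thesis using isomorphic_single_vertex[OF U] N by simp
  next
    case False
    with pos N have n: "2 \<le> card (pverts T)" "2 \<le> card (pverts T')" by linarith+
    obtain s a b c d where S: "valid s a b c d" "has_shape (pverts T) (parcs T) s a b c d"
      using undirected_tree_shape[OF assms(1,3) n(1)] by blast
    obtain t a' b' c' d' where S': "valid t a' b' c' d'" "has_shape (pverts T') (parcs T') t a' b' c' d'"
      using undirected_tree_shape[OF assms(2,4) n(2)] by blast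
    have eq: "invariants s a b c d = invariants t a' b' c' d'"
      by (rule invariants_eq[OF S(2,1) S'(2,1) p w])
    have "s = t" by (rule invariants_shape[OF S(1) S'(1) eq])
    then have "has_shape (pverts T') (parcs T') s a b c d"
      using has_shape_unique[of s a b c d a' b' c' d' "pverts T'" "parcs T'"] S(1) S' eq by simp
    then show ?thesis using S(2) unfolding has_shape_def by (intro model_isomorphic)
  qed
  then show ?thesis
    using assms(1,2) digraph_iso_with_proj_iff[of T T'] by (simp add: undirected_tree_def)
qed

end
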